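(* Let $u(x,t)$, $(x,t)\in\Omega\times(0,T]$, be a weak solution of the Cauchy problem $$\begin{cases}u_t=\nabla_x\cdot\big[\,|u|\,\nabla_x\big(A^\top(Au-f)\big)\big],\quad (x,t)\in\Omega\times(0,T],\\ u(\cdot,0)=u_0,\quad u|_{\partial\Omega}=0.\end{cases}$$ Then $H(u(\cdot,t))=\frac12\|Au(\cdot,t)-f\|_2^2$ is non-increasing in time, i.e. $H(u(\cdot,t_2))\le H(u(\cdot,t_1))$ whenever $0<t_1\le t_2\le T$.
   Context: $\Omega\subset\mathbb{R}^d$ is the (bounded) image domain, $S\subset\Omega$ is a sampling region with characteristic function $\chi_S$, and $T>0$. $K$ is a real-valued continuously differentiable convolution kernel. The operator $A$ is the composition of convolution with $K$ and restriction to $S$: $$(Au)(x)=\chi_S(x)\int_\Omega K(x-y)u(y)\,dy,$$ and $A^\top$ is its conjugate (adjoint) operator, $(A^\top g)(y)=\int_S K(x-y)g(x)\,dx$. The operators $A$, $A^\top$ act in the spatial variable $x$ only. $f$ is a given observed real-valued function of $x$, $\|\cdot\|_2$ is the $L^2$ norm in $x$, and $H(u)=\frac12\|Au-f\|_2^2$. The initial function $u_0$ is a real-valued continuous function on $\Omega$. Weak solution: a real-valued locally integrable function $u$ is called a weak solution of the Cauchy problem if it satisfies the boundary condition $u|_{\partial\Omega}=0$ and, for every $C^1$ test function $\eta$, $$\int_{\Omega\times(0,T]}\big[\eta_t\, u-|u|\,\nabla_x\eta\cdot\nabla_x\big(A^\top(Au-f)\big)\big]\,dx\,dt=0,$$ $$\lim_{t\to0^+}\int_\Omega\eta(x,t)u(x,t)\,dx=\int_\Omega\eta(x,0)u_0(x)\,dx.$$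 Here, in the first identity, test functions have compact support in $\Omega\times(0,T)$, and in the second identity they have compact support in $\Omega\times[0,T)$. All the integrals and norms appearing above are understood to be well defined for $u$.
   Formalization: H(u(·,t₂)) ≤ H(u(·,t₁)) is shown for almost all times, and for all 0<t₁≤t₂≤T if u is weakly continuous in t (false otherwise: alter u at one time); u=0 on ∂Ω means that the integral of |u(·,t)| over the boundary layer of width ε is o(ε), locally uniformly in t∈(0,T]. *)

theory Defs
  imports "HOL-Analysis.Analysis"
begin

definition grad :: "('a::euclidean_space \<Rightarrow> real) \<Rightarrow> 'a \<Rightarrow> 'a" where
  "grad f x = (THE D. GDERIV f x :> D)"

definition C1 :: "('a::euclidean_space \<Rightarrow> real) \<Rightarrow> bool" where
  "C1 f \<longleftrightarrow> (\<exists>g. (\<forall>x. GDERIV f x :> g x) \<and> continuous_on UNIV g)"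

definition C1_compact_support :: "'a::euclidean_space set \<Rightarrow> ('a \<Rightarrow> real) \<Rightarrow> bool" where
  "C1_compact_support U \<eta> \<longleftrightarrow>
     C1 \<eta> \<and> compact (closure {z. \<eta> z \<noteq> 0}) \<and> closure {z. \<eta> z \<noteq> 0} \<subseteq> U"

definition L2_norm_on :: "'a::euclidean_space set \<Rightarrow> ('a \<Rightarrow> real) \<Rightarrow> real" where
  "L2_norm_on X g = sqrt (LINT x:X|lebesgue. (g x)\<^sup>2)"

definition opA :: "'a::euclidean_space set \<Rightarrow> 'a set \<Rightarrow> ('a \<Rightarrow> real) \<Rightarrow> ('a \<Rightarrow> real) \<Rightarrow> 'a \<Rightarrow> real" where
  "opA \<Omega> S K v x = indicat_real S x * (LINT y:\<Omega>|lebesgue. K (x - y) * v y)"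

definition opA_adj :: "'a::euclidean_space set \<Rightarrow> ('a \<Rightarrow> real) \<Rightarrow> ('a \<Rightarrow> real) \<Rightarrow> 'a \<Rightarrow> real" where
  "opA_adj S K g y = (LINT x:S|lebesgue. K (x - y) * g x)"

definition H_functional ::
  "'a::euclidean_space set \<Rightarrow> 'a set \<Rightarrow> ('a \<Rightarrow> real) \<Rightarrow> ('a \<Rightarrow> real) \<Rightarrow> ('a \<Rightarrow> real) \<Rightarrow> real" where
  "H_functional \<Omega> S K f v = 1/2 * (L2_norm_on \<Omega> (\<lambda>x. opA \<Omega> S K v x - f x))\<^sup>2"

definition locally_integrable_on ::
  "('a::euclidean_space \<Rightarrow> real) \<Rightarrow> 'a set \<Rightarrow> bool" where
  "locally_integrable_on g X \<longleftrightarrow> (\<forall>C. compact C \<and> C \<subseteq> X \<longrightarrow> set_integrable lebesgue C g)"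

(* The boundary condition u = 0 on the boundary of \<Omega>, in the sense of traces, since point values on
   a null set mean nothing for an integrable u: the integral of |u(.,t)| over the inner boundary
   layer of width \<epsilon> is o(\<epsilon>), locally uniformly for t in (0,T].  If the layer has volume O(\<epsilon>)
   (e.g. \<Omega> a box or a bounded Lipschitz domain), this holds as soon as u(x,t) tends to 0 when
   (x,t) tends to a point of the lateral boundary. *)
definition zero_boundary_values ::
  "'a::euclidean_space set \<Rightarrow> real \<Rightarrow> ('a \<Rightarrow> real \<Rightarrow> real) \<Rightarrow> bool" where
  "zero_boundary_values \<Omega> T u \<longleftrightarrow>
     (\<forall>a\<in>{0<..T}. uniform_limit {a..T}
        (\<lambda>\<epsilon> t. (1 / \<epsilon>) * (LINT x:{x \<in> \<Omega>. infdist x (frontier \<Omega>) < \<epsilon>}|lebesgue. \<bar>u x t\<bar>))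
        (\<lambda>t. 0) (at_right 0))"

(* Set integrability of every u(.,t), and of the integrand of the evolution equation, is what
   makes Au(.,t) and the two integral identities well defined; the library integral
   would otherwise be 0 by convention.  In the initial condition, \<eta> ranges over C^1 functions on
   the whole space-time with compact support in \<Omega> \<times> (-\<infinity>,T): their restrictions to t \<ge> 0 are
   exactly the C^1 functions with compact support in \<Omega> \<times> [0,T). *)
definition weak_solution ::
  "'a::euclidean_space set \<Rightarrow> 'a set \<Rightarrow> real \<Rightarrow> ('a \<Rightarrow> real) \<Rightarrow> ('a \<Rightarrow> real) \<Rightarrow> ('a \<Rightarrow> real) \<Rightarrow>
     ('a \<Rightarrow> real \<Rightarrow> real) \<Rightarrow> bool" where
  "weak_solution \<Omega> S T K f u\<^sub>0 u \<longleftrightarrow>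
     locally_integrable_on (\<lambda>(x, t). u x t) (\<Omega> \<times> {0<..T}) \<and>
     (\<forall>t\<in>{0<..T}. set_integrable lebesgue \<Omega> (\<lambda>x. u x t)) \<and>
     zero_boundary_values \<Omega> T u \<and>
     (\<forall>\<eta>. C1_compact_support (\<Omega> \<times> {0<..<T}) \<eta> \<longrightarrow>
        (let F = (\<lambda>(x, t). deriv (\<lambda>s. \<eta> (x, s)) t * u x t
                   - \<bar>u x t\<bar> * (grad (\<lambda>y. \<eta> (y, t)) x \<bullet>
                        grad (opA_adj S K (\<lambda>z. opA \<Omega> S K (\<lambda>y. u y t) z - f z)) x))
         in set_integrable lebesgue (\<Omega> \<times> {0<..T}) F \<and>
            (LINT z:\<Omega> \<times> {0<..T}|lebesgue. F z) = 0)) \<and>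
     (\<forall>\<eta>. C1_compact_support (\<Omega> \<times> {..<T}) \<eta> \<longrightarrow>
        ((\<lambda>t. LINT x:\<Omega>|lebesgue. \<eta> (x, t) * u x t) \<longlongrightarrow>
           (LINT x:\<Omega>|lebesgue. \<eta> (x, 0) * u\<^sub>0 x)) (at_right 0))"

(* Altering u(.,t) at a single t > 0 by a test function gives another weak solution, so the time
   slices are only determined for the representative that is weakly continuous in time. *)
definition weakly_continuous_in_time ::
  "'a::euclidean_space set \<Rightarrow> real \<Rightarrow> ('a \<Rightarrow> real \<Rightarrow> real) \<Rightarrow> bool" where
  "weakly_continuous_in_time \<Omega> T u \<longleftrightarrow>
     (\<forall>\<phi>. C1_compact_support \<Omega> \<phi> \<longrightarrow>
        continuous_on {0<..T} (\<lambda>t. LINT x:\<Omega>|lebesgue. \<phi> x * u x t))"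

end

theory Submission
  imports Defs
begin

text \<open>
Write \<open>v = A\<^sup>T(Au - f)\<close>. Formally the derivative of \<open>H(u)\<close> in time is the integral of
\<open>v u\<^sub>t\<close>, which by the equation is minus the integral of \<open>|u| |\<nabla>v|\<^sup>2\<close>. A weak solution does not
allow this computation directly: it can be tested only with functions that vanish near the boundary,
\<open>v\<close> is such a test function neither in space nor in time, and nothing bounds the mass of
\<open>u(\<cdot>, t)\<close>, hence \<open>\<nabla>v\<close>, uniformly in \<open>t\<close>.

The boundary condition removes the restriction in space. Multiplying a \<open>C\<^sup>1\<close> function \<open>\<psi>\<close> by a cutoff at
distance \<open>\<epsilon>\<close> from the boundary produces an error of size \<open>1/\<epsilon>\<close> on a layer of width \<open>\<epsilon>\<close>, and the mass
of \<open>u\<close> in that layer is \<open>o(\<epsilon>)\<close> (\<open>weak_identity\<close>). The lemma of du Bois-Reymond then gives the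
increments in time of every moment of \<open>u\<close>, for almost all times (\<open>moment_identity\<close>), and with
\<open>\<psi> = K(y - \<cdot>)\<close> for \<open>y\<close> in a countable dense set those of \<open>w = K * u\<close>, for all points at once
(\<open>w_increment\<close>).

The function \<open>|u| |\<nabla>v|\<close> is integrable over compact time intervals: in the interior because the
coordinate functions are admissible tests, and in the boundary layer because the small mass there
compensates the crude bound of \<open>\<nabla>v\<close> by the mass (\<open>flux_integrable\<close>). So if \<open>Q(t)\<close> is its integral up
to time \<open>t\<close>, then \<open>w\<close>, and with it \<open>\<nabla>v\<close>, changes between two times by at most a constant times the
increment of \<open>Q\<close>, uniformly in space (\<open>P_increment\<close>). By Fubini's theorem the energy changes between
\<open>t\<^sub>1\<close> and \<open>t\<^sub>2\<close> by minus one half of the integral of \<open>|u| \<nabla>v(s) \<bullet> (\<nabla>v(t\<^sub>1) + \<nabla>v(t\<^sub>2))\<close>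
(\<open>energy_increment\<close>); replacing both gradients by \<open>\<nabla>v(s)\<close> makes this nonpositive and costs at most
\<open>C (Q(t\<^sub>2) - Q(t\<^sub>1))\<^sup>2\<close>. Since \<open>Q\<close> is continuous, adding such estimates over fine partitions shows that
the energy does not increase (\<open>nonincreasing_if_quadratic_increments\<close>, \<open>energy_decay_slab\<close>). No
derivative of the energy is ever taken.

All this holds off a null set of times, which is the first claim. If \<open>u\<close> is weakly continuous in time,
the boundary condition extends the continuity to moments with \<open>C\<^sup>1\<close> functions that do not vanish near
the boundary (\<open>moment_continuous\<close>), so \<open>w(x, \<cdot>)\<close> is continuous for each \<open>x\<close>. On compact subintervals
of \<open>(0, T)\<close> it is also bounded, so \<open>H\<close> is continuous there by dominated convergence; up to the final
time \<open>T\<close> Fatou's lemma gives lower semicontinuity, which is what the later of the two times needs.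

A weak solution is only Lebesgue measurable in space-time, while Fubini's theorem for product measures
asks for measurability with respect to the product \<open>\<sigma>\<close>-algebra. The estimates are therefore carried out for a Borel representative \<open>U\<close> of
\<open>u\<close>, in a locale that records what is inherited from \<open>u\<close>.
\<close>

section \<open>Gradients, convolutions and cutoff functions\<close>

lemma GDERIV_unique: "GDERIV f x :> D \<Longrightarrow> GDERIV f x :> D' \<Longrightarrow> D = D'"
  unfolding gderiv_def
  by (drule (1) has_derivative_unique) (metis vector_eq_rdot inner_commute)

lemma grad_eq: "GDERIV f x :> D \<Longrightarrow> grad f x = D"
  unfolding grad_def by (blast intro: GDERIV_unique)

lemma GDERIV_imp_has_derivative: "GDERIV f x :> D \<Longrightarrow> (f has_derivative (\<lambda>h. h \<bullet> D)) (at x within S)"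
  unfolding gderiv_def by (rule has_derivative_at_withinI)

lemma GDERIV_continuous_on: "(\<And>x. GDERIV f x :> g x) \<Longrightarrow> continuous_on S f"
  unfolding gderiv_def
  by (rule has_derivative_continuous_on) (blast intro: has_derivative_at_withinI)

lemma GDERIV_reflect:
  assumes "\<And>x. GDERIV f x :> g x"
  shows "GDERIV (\<lambda>z. f (y - z)) z :> - g (y - z)"
proof -
  have "(f has_derivative (\<lambda>h. h \<bullet> g (y - z))) (at (y - z))"
    using assms[of "y - z"] unfolding gderiv_def .
  moreover have "((\<lambda>z. y - z) has_derivative (\<lambda>h. - h)) (at z)"
    by (auto intro!: derivative_eq_intros)
  ultimately have "((\<lambda>z. f (y - z)) has_derivative (\<lambda>h. (- h) \<bullet> g (y - z))) (at z)"
    using has_derivative_compose by blast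
  then show ?thesis unfolding gderiv_def by simp
qed

lemma continuous_bounded_on_bounded:
  fixes f :: "'a::heine_borel \<Rightarrow> 'b::real_normed_vector"
  assumes "continuous_on UNIV f" "bounded B"
  obtains M where "M > 0" "\<And>x. x \<in> B \<Longrightarrow> norm (f x) \<le> M"
proof -
  have "compact (f ` closure B)"
    using assms by (intro compact_continuous_image) (auto intro: continuous_on_subset)
  then obtain M where "M > 0" "\<forall>y\<in>f ` closure B. norm y \<le> M"
    using bounded_pos compact_imp_bounded by metis
  then show ?thesis
    using that closure_subset by blast
qed

text \<open>The local bound on the kernel is asked for only where the density \<open>g\<close> is nonzero; this lets one
statement serve both a bounded spatial support and a support in space-time.\<close>

lemma continuous_on_parameter_integral:
  fixes \<kappa> :: "'p \<Rightarrow> 'b::euclidean_space \<Rightarrow> 'c::euclidean_space"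
  assumes g: "integrable M g"
    and meas: "\<And>y. (\<lambda>p. \<kappa> p y) \<in> borel_measurable M"
    and cont: "\<And>p. p \<in> space M \<Longrightarrow> continuous_on UNIV (\<kappa> p)"
    and bound: "\<And>B. bounded B \<Longrightarrow> \<exists>c. \<forall>p. g p \<noteq> 0 \<longrightarrow> (\<forall>y\<in>B. norm (\<kappa> p y) \<le> c)"
  shows "continuous_on UNIV (\<lambda>y. LINT p|M. g p *\<^sub>R \<kappa> p y)"
  unfolding continuous_on_sequentially comp_def
proof (intro ballI allI impI)
  fix s :: "nat \<Rightarrow> 'b" and y assume "(\<forall>n. s n \<in> UNIV) \<and> s \<longlonglongrightarrow> y"
  then have s: "s \<longlonglongrightarrow> y" by simp
  obtain c where c: "\<And>p n. g p \<noteq> 0 \<Longrightarrow> norm (\<kappa> p (s n)) \<le> c"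
    using bound[OF convergent_imp_bounded[OF s]] by blast
  have [measurable]: "g \<in> borel_measurable M" using g by simp
  note meas[measurable]
  show "(\<lambda>n. LINT p|M. g p *\<^sub>R \<kappa> p (s n)) \<longlonglongrightarrow> (LINT p|M. g p *\<^sub>R \<kappa> p y)"
  proof (rule integral_dominated_convergence[where w="\<lambda>p. c * \<bar>g p\<bar>"])
    show "integrable M (\<lambda>p. c * \<bar>g p\<bar>)" using g by auto
    show "AE p in M. (\<lambda>n. g p *\<^sub>R \<kappa> p (s n)) \<longlonglongrightarrow> g p *\<^sub>R \<kappa> p y"
      using cont s by (intro AE_I2 tendsto_intros) (auto simp: continuous_on_sequentially comp_def)
    show "AE p in M. norm (g p *\<^sub>R \<kappa> p (s n)) \<le> c * \<bar>g p\<bar>" for n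
    proof (intro AE_I2)
      fix p show "norm (g p *\<^sub>R \<kappa> p (s n)) \<le> c * \<bar>g p\<bar>"
        using c[of p n] by (cases "g p = 0") (auto simp: mult.commute[of c] intro!: mult_left_mono)
    qed
  qed auto
qed

lemma continuous_on_integral_kernel:
  fixes \<kappa> :: "'a::euclidean_space \<Rightarrow> 'b::euclidean_space \<Rightarrow> 'c::euclidean_space"
  assumes \<kappa>: "continuous_on UNIV (\<lambda>(x, y). \<kappa> x y)"
    and g: "integrable lborel g" and B: "bounded B" and gB: "\<And>x. x \<notin> B \<Longrightarrow> g x = 0"
  shows "continuous_on UNIV (\<lambda>y. LINT x|lborel. g x *\<^sub>R \<kappa> x y)"
proof (rule continuous_on_parameter_integral[OF g])
  have cx: "continuous_on UNIV (\<kappa> x)" and cy: "continuous_on UNIV (\<lambda>x. \<kappa> x y)" for x y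
    using continuous_on_compose2[OF \<kappa>, of UNIV "\<lambda>y. (x, y)"] continuous_on_compose2[OF \<kappa>, of UNIV "\<lambda>x. (x, y)"]
    by (simp_all add: continuous_on_Pair)
  show "(\<lambda>x. \<kappa> x y) \<in> borel_measurable lborel" for y
    using borel_measurable_continuous_onI[OF cy] by simp
  show "continuous_on UNIV (\<kappa> x)" for x by (rule cx)
  fix B' :: "'b set" assume B': "bounded B'"
  obtain M where "M > 0" and M: "\<And>p. p \<in> B \<times> B' \<Longrightarrow> norm ((\<lambda>(x, y). \<kappa> x y) p) \<le> M"
    using continuous_bounded_on_bounded[OF \<kappa> bounded_Times[OF B B']] by blast
  have "norm (\<kappa> x y) \<le> M" if "g x \<noteq> 0" "y \<in> B'" for x y
    using M[of "(x, y)"] gB[of x] that by auto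
  then show "\<exists>c. \<forall>x. g x \<noteq> 0 \<longrightarrow> (\<forall>y\<in>B'. norm (\<kappa> x y) \<le> c)" by blast
qed

text \<open>Differentiation under the integral needs only uniform continuity of \<open>k\<close> on the bounded set of
differences \<open>x - y\<close> that occur, so \<open>g\<close> may be any integrable function of bounded support. It is used
with \<open>g\<close> the residual \<open>Au - f\<close>, to obtain \<open>\<nabla>v\<close>, and with \<open>g\<close> a Lipschitz ramp, to mollify it.\<close>

lemma GDERIV_integral_kernel:
  fixes K :: "'a::euclidean_space \<Rightarrow> real"
  assumes K: "\<And>x. GDERIV K x :> k x" and k: "continuous_on UNIV k"
    and g: "integrable lborel g" and B: "bounded B" and gB: "\<And>x. x \<notin> B \<Longrightarrow> g x = 0"
  shows "GDERIV (\<lambda>y. LINT x|lborel. K (x - y) * g x) y :> (LINT x|lborel. - g x *\<^sub>R k (x - y))"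
proof -
  have [measurable]: "g \<in> borel_measurable lborel" using g by simp
  have contK: "continuous_on UNIV K" using GDERIV_continuous_on[OF K] .
  have [measurable]: "K \<in> borel_measurable borel" "k \<in> borel_measurable borel"
    using contK k by (auto intro: borel_measurable_continuous_onI)
  have bB: "bounded ((\<lambda>x. x - y) ` B)" for y
    using B by (rule bounded_translation_minus)
  have int: "integrable lborel (\<lambda>x. g x *\<^sub>R F (x - y))"
    if F: "continuous_on UNIV F" for F :: "'a \<Rightarrow> 'b::euclidean_space" and y
  proof -
    have [measurable]: "F \<in> borel_measurable borel"
      using F by (rule borel_measurable_continuous_onI)
    obtain M where M: "M > 0" "\<And>p. p \<in> (\<lambda>x. x - y) ` B \<Longrightarrow> norm (F p) \<le> M"
      using continuous_bounded_on_bounded[OF F bB[of y]] by blast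
    show ?thesis
    proof (rule Bochner_Integration.integrable_bound)
      show "integrable lborel (\<lambda>x. M * \<bar>g x\<bar>)" using g by auto
      show "AE x in lborel. norm (g x *\<^sub>R F (x - y)) \<le> norm (M * \<bar>g x\<bar>)"
      proof (intro AE_I2)
        fix x show "norm (g x *\<^sub>R F (x - y)) \<le> norm (M * \<bar>g x\<bar>)"
          using gB[of x] M(1) M(2)[of "x - y"]
          by (cases "x \<in> B") (auto simp: mult.commute[of M] intro!: mult_left_mono)
      qed
    qed measurable
  qed
  have intK: "integrable lborel (\<lambda>x. K (x - y) * g x)" for y
    using int[OF contK, of y] by (simp add: mult.commute)
  have intk: "integrable lborel (\<lambda>x. - g x *\<^sub>R k (x - y))" for y
    using int[OF k, of y] by simp
  define G where "G = (\<integral>x. \<bar>g x\<bar> \<partial>lborel) + 1"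
  have G: "G > 0" unfolding G_def by (intro add_nonneg_pos Bochner_Integration.integral_nonneg) auto
  obtain R where R: "R > 0" "\<And>x. x \<in> B \<Longrightarrow> norm (x - y) \<le> R"
    using bB[of y] unfolding bounded_pos by auto
  have uc: "uniformly_continuous_on (cball 0 (R + 1)) k"
    using k by (intro compact_uniformly_continuous) (auto intro: continuous_on_subset)
  show ?thesis
    unfolding gderiv_def has_derivative_at_alt
  proof (intro conjI allI impI)
    show "bounded_linear (\<lambda>h. h \<bullet> (LINT x|lborel. - g x *\<^sub>R k (x - y)))"
      by (rule bounded_linear_inner_left)
    fix e :: real assume "e > 0"
    then have "e / G > 0" using G by simp
    then obtain d where d: "d > 0" "\<And>p q. p \<in> cball 0 (R+1) \<Longrightarrow> q \<in> cball 0 (R+1) \<Longrightarrow>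
        dist q p < d \<Longrightarrow> dist (k q) (k p) < e / G"
      using uc unfolding uniformly_continuous_on_def by metis
    have lin: "\<bar>K (p - h) - K p + h \<bullet> k p\<bar> \<le> norm h * (e / G)"
      if p: "norm p \<le> R" and h: "norm h < min d 1" for p h
    proof -
      have "norm (K (p - h) - K p - (\<lambda>v. v \<bullet> k p) ((p - h) - p)) \<le> norm ((p - h) - p) * (e / G)"
      proof (rule differentiable_bound_linearization[where f=K and f'="\<lambda>x v. v \<bullet> k x" and S="ball p (min d 1)"])
        show "p + t *\<^sub>R (p - h - p) \<in> ball p (min d 1)" if "t \<in> {0..1}" for t
        proof -
          have "norm (t *\<^sub>R h) \<le> norm h"
            using that by (simp add: mult_left_le_one_le)
          then show ?thesis using h by (simp add: dist_norm)
        qed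
        show "(K has_derivative (\<lambda>v. v \<bullet> k x)) (at x within ball p (min d 1))" for x
          using K by (rule GDERIV_imp_has_derivative)
        fix x assume x: "x \<in> ball p (min d 1)"
        have "norm x \<le> norm p + dist p x" by (metis dist_norm norm_triangle_sub norm_minus_commute)
        then have "dist (k x) (k p) < e / G"
          using x p by (intro d(2)) (auto simp: dist_commute)
        then have *: "norm (k x - k p) \<le> e / G" by (simp add: dist_norm)
        have "onorm (\<lambda>v. v \<bullet> (k x - k p)) \<le> e / G"
        proof (rule onorm_bound)
          fix v show "norm (v \<bullet> (k x - k p)) \<le> e / G * norm v"
            using Cauchy_Schwarz_ineq2[of v "k x - k p"] *
            by (smt (verit) mult.commute mult_right_mono norm_ge_zero real_norm_def)
        qed (use \<open>e / G > 0\<close> in simp)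
        then show "onorm ((\<lambda>v. v \<bullet> k x) - (\<lambda>v. v \<bullet> k p)) \<le> e / G"
          by (simp add: fun_diff_def inner_diff_right)
      qed (use d in auto)
      then show ?thesis by simp
    qed
    show "\<exists>d>0. \<forall>y'. norm (y' - y) < d \<longrightarrow>
        norm ((LINT x|lborel. K (x - y') * g x) - (LINT x|lborel. K (x - y) * g x)
          - (y' - y) \<bullet> (LINT x|lborel. - g x *\<^sub>R k (x - y))) \<le> e * norm (y' - y)"
    proof (intro exI[of _ "min d 1"] conjI allI impI)
      show "min d 1 > 0" using d by simp
      fix y' assume y': "norm (y' - y) < min d 1"
      define h where "h = y' - y"
      have eq: "(LINT x|lborel. K (x - y') * g x) - (LINT x|lborel. K (x - y) * g x)
          - h \<bullet> (LINT x|lborel. - g x *\<^sub>R k (x - y))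
          = (LINT x|lborel. K (x - y') * g x - K (x - y) * g x - h \<bullet> (- g x *\<^sub>R k (x - y)))"
        unfolding integral_inner_right[OF intk, symmetric]
        by (simp only: Bochner_Integration.integral_diff intK intk Bochner_Integration.integrable_diff
            integrable_inner_right)
      have "\<bar>(LINT x|lborel. K (x - y') * g x) - (LINT x|lborel. K (x - y) * g x)
          - h \<bullet> (LINT x|lborel. - g x *\<^sub>R k (x - y))\<bar>
          \<le> (LINT x|lborel. \<bar>K (x - y') * g x - K (x - y) * g x - h \<bullet> (- g x *\<^sub>R k (x - y))\<bar>)"
        unfolding eq by (rule integral_abs_bound)
      also have "\<dots> \<le> (LINT x|lborel. norm h * (e / G) * \<bar>g x\<bar>)"
      proof (rule integral_mono)
        show "integrable lborel (\<lambda>x. \<bar>K (x - y') * g x - K (x - y) * g x - h \<bullet> (- g x *\<^sub>R k (x - y))\<bar>)"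
          by (rule integrable_abs, rule Bochner_Integration.integrable_diff, rule Bochner_Integration.integrable_diff,
              rule intK, rule intK, rule integrable_inner_right, rule intk)
        show "integrable lborel (\<lambda>x. norm h * (e / G) * \<bar>g x\<bar>)" using g by auto
        fix x
        have "K (x - y') * g x - K (x - y) * g x - h \<bullet> (- g x *\<^sub>R k (x - y))
            = (K ((x - y) - h) - K (x - y) + h \<bullet> k (x - y)) * g x"
          by (simp add: h_def algebra_simps)
        moreover have "\<bar>(K ((x - y) - h) - K (x - y) + h \<bullet> k (x - y)) * g x\<bar> \<le> norm h * (e / G) * \<bar>g x\<bar>"
        proof (cases "x \<in> B")
          case True
          then show ?thesis
            unfolding abs_mult using R(2) y' h_def by (intro mult_right_mono lin) auto
        qed (use gB in simp)
        ultimately show "\<bar>K (x - y') * g x - K (x - y) * g x - h \<bullet> (- g x *\<^sub>R k (x - y))\<bar>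
            \<le> norm h * (e / G) * \<bar>g x\<bar>" by (simp only:)
      qed
      also have "\<dots> = e * norm h * ((G - 1) / G)" by (simp add: G_def)
      also have "\<dots> \<le> e * norm h * 1"
        using G \<open>e > 0\<close> by (intro mult_left_mono) auto
      finally show "norm ((LINT x|lborel. K (x - y') * g x) - (LINT x|lborel. K (x - y) * g x)
          - (y' - y) \<bullet> (LINT x|lborel. - g x *\<^sub>R k (x - y))) \<le> e * norm (y' - y)"
        by (simp add: h_def)
    qed
  qed
qed

lemma norm_GDERIV_le_Lipschitz:
  fixes f :: "'a::euclidean_space \<Rightarrow> real"
  assumes "GDERIV f x :> D" and L: "\<And>y. \<bar>f y - f x\<bar> \<le> C * norm (y - x)"
  shows "norm D \<le> C"
proof (rule field_le_epsilon)
  fix e :: real assume "e > 0"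
  have "\<forall>e>0. \<exists>d>0. \<forall>y. norm (y - x) < d \<longrightarrow> norm (f y - f x - (y - x) \<bullet> D) \<le> e * norm (y - x)"
    using assms(1) unfolding gderiv_def has_derivative_at_alt by (rule conjunct2)
  with \<open>e > 0\<close> obtain d where "d > 0"
      and "\<forall>y. norm (y - x) < d \<longrightarrow> norm (f y - f x - (y - x) \<bullet> D) \<le> e * norm (y - x)"
    by auto
  then have d: "d > 0" "\<And>y. norm (y - x) < d \<Longrightarrow> \<bar>f y - f x - (y - x) \<bullet> D\<bar> \<le> e * norm (y - x)"
    by (auto simp only: real_norm_def)
  show "norm D \<le> C + e"
  proof (cases "D = 0")
    case True
    obtain v :: 'a where "v \<in> Basis" using nonempty_Basis by blast
    then have "norm v = 1" by simp
    have "0 \<le> \<bar>f (x + v) - f x\<bar>" by simp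
    also have "\<dots> \<le> C" using L[of "x + v"] \<open>norm v = 1\<close> by simp
    finally show ?thesis using True \<open>e > 0\<close> by simp
  next
    case False
    define s where "s = d / (2 * norm D)"
    have s: "s > 0" "norm (s *\<^sub>R D) < d" using False d by (auto simp: s_def)
    have "s * (norm D)\<^sup>2 = (x + s *\<^sub>R D - x) \<bullet> D" by (simp add: power2_norm_eq_inner)
    also have "\<dots> \<le> C * norm (s *\<^sub>R D) + e * norm (s *\<^sub>R D)"
      using d(2)[of "x + s *\<^sub>R D"] s L[of "x + s *\<^sub>R D"] by simp
    also have "\<dots> = s * (norm D * (C + e))" using s by (simp add: algebra_simps)
    finally have "norm D * norm D \<le> norm D * (C + e)"
      using s by (simp add: power2_eq_square)
    then show ?thesis using False by simp
  qed
qed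

lemma DERIV_power2_max_0: "((\<lambda>s::real. (max 0 s)\<^sup>2) has_field_derivative 2 * max 0 s) (at s)"
proof -
  consider "s > 0" | "s < 0" | "s = 0" by linarith
  then show ?thesis
  proof cases
    case 1
    have "((\<lambda>s::real. s\<^sup>2) has_field_derivative 2 * s) (at s)"
      by (auto intro!: derivative_eq_intros)
    then show ?thesis
      using 1 by (auto intro: has_field_derivative_transform_within_open[where S="{0<..}"])
  next
    case 2
    have "((\<lambda>s::real. 0) has_field_derivative 0) (at s)"
      by (auto intro!: derivative_eq_intros)
    then show ?thesis
      using 2 by (auto simp: max_def intro: has_field_derivative_transform_within_open[where S="{..<0}" and f="\<lambda>s. 0"])
  next
    case 3
    have "(\<lambda>h::real. (max 0 h)\<^sup>2 / h) \<midarrow>0\<rightarrow> 0"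
    proof (rule Lim_null_comparison)
      show "\<forall>\<^sub>F h in at (0::real). norm ((max 0 h)\<^sup>2 / h) \<le> \<bar>h\<bar>"
        by (auto simp: max_def power2_eq_square)
      show "((\<lambda>h::real. \<bar>h\<bar>) \<longlongrightarrow> 0) (at 0)"
        by (auto intro!: tendsto_eq_intros)
    qed
    then show ?thesis using 3 by (simp add: DERIV_def)
  qed
qed

text \<open>A radial \<open>C\<^sup>1\<close> function supported in the ball of radius \<open>r\<close>, with a polynomial profile that keeps the
gradient explicit.\<close>

definition bump :: "real \<Rightarrow> 'a::euclidean_space \<Rightarrow> real" where
  "bump r x = (max 0 (r\<^sup>2 - x \<bullet> x))\<^sup>2"

lemma GDERIV_bump: "GDERIV (bump r) x :> - (4 * max 0 (r\<^sup>2 - x \<bullet> x)) *\<^sub>R x"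
proof -
  have "GDERIV (\<lambda>x. r\<^sup>2 - x \<bullet> x) x :> - (2 *\<^sub>R x)"
    unfolding gderiv_def by (auto intro!: derivative_eq_intros simp: inner_commute algebra_simps)
  from GDERIV_DERIV_compose[OF this DERIV_power2_max_0]
  show ?thesis unfolding bump_def[abs_def] by simp
qed

lemma bump_nonneg: "0 \<le> bump r x"
  by (simp add: bump_def)

lemma bump_eq_0: "r \<le> norm x \<Longrightarrow> 0 \<le> r \<Longrightarrow> bump r x = 0"
  by (simp add: bump_def dot_square_norm power_mono)

lemma bump_pos: "norm x < r \<Longrightarrow> 0 < bump r x"
  using power_strict_mono[of "norm x" r 2] by (simp add: bump_def dot_square_norm less_max_iff_disj)

lemma integrable_continuous_compact_support:
  fixes f :: "'a::euclidean_space \<Rightarrow> 'b::euclidean_space"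
  assumes "continuous_on UNIV f" "bounded B" "\<And>x. x \<notin> B \<Longrightarrow> f x = 0"
  shows "integrable lborel f"
proof -
  obtain b where b: "B \<subseteq> cbox (-b) b" using bounded_subset_cbox_symmetric[OF assms(2)] by blast
  have "integrable lborel (\<lambda>x. indicator (cbox (-b) b) x *\<^sub>R f x)"
    using assms by (intro borel_integrable_compact) (auto intro: continuous_on_subset)
  moreover have "indicator (cbox (-b) b) x *\<^sub>R f x = f x" for x
    using b assms(3)[of x] by (cases "x \<in> B") (auto simp: indicator_def)
  ultimately show ?thesis by simp
qed

lemma bump_integral_pos:
  assumes "r > 0"
  shows "0 < (LINT x|lborel. bump r (x :: 'a::euclidean_space))"
proof -
  have int: "integrable lborel (bump r :: 'a \<Rightarrow> real)"
    using assms
    by (intro integrable_continuous_compact_support[where B="cball 0 r"] GDERIV_continuous_on[OF GDERIV_bump]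
        bump_eq_0) auto
  have "\<not> (AE x::'a in lborel. bump r x = 0)"
  proof
    assume "AE x::'a in lborel. bump r x = 0"
    then have "AE x::'a in lborel. x \<notin> ball 0 r"
    proof eventually_elim
      fix x :: 'a assume "bump r x = 0"
      then show "x \<notin> ball 0 r" using bump_pos[of x r] by auto
    qed
    then have "ball (0::'a) r \<in> null_sets lborel"
      by (simp add: AE_iff_null_sets)
    then have "negligible (ball (0::'a) r)"
      by (simp add: negligible_iff_null_sets null_sets_completionI)
    then show False using assms open_not_negligible[of "ball (0::'a) r"] by simp
  qed
  then have "(LINT x|lborel. bump r (x :: 'a)) \<noteq> 0"
    by (subst integral_nonneg_eq_0_iff_AE[OF int]) (simp_all add: bump_nonneg)
  moreover have "0 \<le> (LINT x|lborel. bump r (x :: 'a))"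
    using bump_nonneg by (intro Bochner_Integration.integral_nonneg) auto
  ultimately show ?thesis by linarith
qed

lemma compact_infdist_compl_ge:
  fixes \<Omega> :: "'a::euclidean_space set"
  assumes "bounded \<Omega>" "c > 0"
  shows "compact {x. c \<le> infdist x (- \<Omega>)}" "{x. c \<le> infdist x (- \<Omega>)} \<subseteq> \<Omega>"
proof -
  show sub: "{x. c \<le> infdist x (- \<Omega>)} \<subseteq> \<Omega>"
    using assms(2) infdist_zero[of _ "- \<Omega>"] by fastforce
  have "closed {x. c \<le> infdist x (- \<Omega>)}"
    by (intro closed_Collect_le continuous_intros)
  then show "compact {x. c \<le> infdist x (- \<Omega>)}"
    using bounded_subset[OF assms(1) sub] by (simp add: compact_eq_bounded_closed)
qed

lemma GDERIV_zero_off_closed: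
  assumes "GDERIV f x :> D" "closed C" "\<And>y. y \<notin> C \<Longrightarrow> f y = 0" "x \<notin> C"
  shows "D = 0"
proof -
  have "GDERIV f x :> 0"
    unfolding gderiv_def inner_zero_right
    by (rule has_derivative_transform_within_open[OF has_derivative_const[of 0] open_Compl[OF assms(2)]])
      (use assms in auto)
  then show ?thesis using assms(1) GDERIV_unique by blast
qed

text \<open>The distance to the complement is only Lipschitz, so a piecewise linear ramp of it between
\<open>\<epsilon>/2\<close> and \<open>3\<epsilon>/4\<close> is mollified at scale \<open>\<epsilon>/8\<close>. The mollified function inherits the Lipschitz constant
\<open>4/\<epsilon>\<close> of the ramp, which bounds its gradient without any scaling of the mollifier.\<close>

lemma smooth_cutoff:
  fixes \<Omega> :: "'a::euclidean_space set"
  assumes "bounded \<Omega>" "\<epsilon> > 0"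
  obtains \<rho> \<rho>' where "\<And>x. GDERIV \<rho> x :> \<rho>' x" "continuous_on UNIV \<rho>'"
    "\<And>x. 0 \<le> \<rho> x" "\<And>x. \<rho> x \<le> 1" "\<And>x. norm (\<rho>' x) \<le> 4 / \<epsilon>"
    "\<And>x. infdist x (- \<Omega>) < \<epsilon> / 4 \<Longrightarrow> \<rho> x = 0"
    "\<And>x. \<epsilon> \<le> infdist x (- \<Omega>) \<Longrightarrow> \<rho> x = 1 \<and> \<rho>' x = 0"
proof -
  define d where "d x = infdist x (- \<Omega>)" for x
  have d_lip: "\<bar>d x - d y\<bar> \<le> norm (x - y)" for x y
    unfolding d_def dist_norm[symmetric] by (rule infdist_triangle_abs)
  have d_cont: "continuous_on S d" for S
    unfolding d_def[abs_def] by (intro continuous_intros)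
  define L where "L x = max 0 (min 1 ((d x - \<epsilon> / 2) * (4 / \<epsilon>)))" for x
  have L_lip: "\<bar>L x - L y\<bar> \<le> 4 / \<epsilon> * norm (x - y)" for x y
  proof -
    have "\<bar>L x - L y\<bar> \<le> \<bar>(d x - \<epsilon> / 2) * (4 / \<epsilon>) - (d y - \<epsilon> / 2) * (4 / \<epsilon>)\<bar>"
      unfolding L_def by linarith
    also have "\<dots> = \<bar>d x - d y\<bar> * (4 / \<epsilon>)"
      using assms(2) by (subst left_diff_distrib[symmetric]) (simp only: abs_mult, simp)
    also have "\<dots> \<le> norm (x - y) * (4 / \<epsilon>)"
      using d_lip assms(2) by (intro mult_right_mono) auto
    finally show ?thesis by (simp add: mult.commute)
  qed
  have L_cont: "continuous_on UNIV L"
    unfolding L_def[abs_def] by (intro continuous_intros d_cont)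
  have L_range: "0 \<le> L x" "L x \<le> 1" for x by (auto simp: L_def)
  have L1: "L x = 1" if "3 / 4 * \<epsilon> \<le> d x" for x
    using that assms(2) by (simp add: L_def field_simps)
  have L0: "L x = 0" if "d x \<le> \<epsilon> / 2" for x
  proof -
    have "(d x - \<epsilon> / 2) * (4 / \<epsilon>) \<le> 0"
      using that assms(2) by (intro mult_nonpos_nonneg) auto
    then show ?thesis by (simp add: L_def)
  qed
  have LO: "L x = 0" if "x \<notin> \<Omega>" for x
    using that assms(2) infdist_zero[of x "- \<Omega>"] by (intro L0) (auto simp: d_def)
  have L_int: "integrable lborel L"
    using L_cont assms(1) LO by (rule integrable_continuous_compact_support)
  define r where "r = \<epsilon> / 8"
  have "r > 0" using assms by (simp add: r_def)
  define I where "I = (LINT x|lborel. bump r (x::'a))"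
  have "I > 0" unfolding I_def using \<open>r > 0\<close> by (rule bump_integral_pos)
  define b where "b x = bump r x / I" for x :: 'a
  define b' where "b' x = (1 / I) *\<^sub>R (- (4 * max 0 (r\<^sup>2 - x \<bullet> x)) *\<^sub>R x)" for x :: 'a
  have Gb: "GDERIV b x :> b' x" for x
    unfolding b_def[abs_def] b'_def
    using GDERIV_mult[OF GDERIV_const[of "1 / I"] GDERIV_bump[of r x]] by (simp add: mult.commute)
  have b_nonneg: "0 \<le> b x" for x
    using bump_nonneg[of r x] \<open>I > 0\<close> by (simp add: b_def)
  have b_supp: "b x = 0" if "r \<le> norm x" for x
    using bump_eq_0[OF that] \<open>r > 0\<close> by (simp add: b_def)
  have b'_cont: "continuous_on UNIV b'"
    unfolding b'_def[abs_def] by (intro continuous_intros)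
  have b_cont: "continuous_on UNIV b" using Gb by (rule GDERIV_continuous_on)
  have b_int: "integrable lborel b"
    using b_cont b_supp by (intro integrable_continuous_compact_support[where B="cball 0 r"]) auto
  have b1: "(LINT x|lborel. b x) = 1"
    using \<open>I > 0\<close> by (simp add: b_def I_def)
  define \<rho> where "\<rho> y = (LINT x|lborel. b (x - y) * L x)" for y
  define \<rho>' where "\<rho>' y = (LINT x|lborel. - L x *\<^sub>R b' (x - y))" for y
  have G: "GDERIV \<rho> y :> \<rho>' y" for y
    unfolding \<rho>_def[abs_def] \<rho>'_def using Gb b'_cont L_int assms(1) LO
    by (rule GDERIV_integral_kernel)
  have c: "continuous_on UNIV \<rho>'"
    unfolding \<rho>'_def[abs_def]
    using assms(1) LO L_int
    by (intro continuous_on_integral_kernel[where B=\<Omega>])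
      (auto simp: case_prod_beta intro!: continuous_intros continuous_on_compose2[OF b'_cont])
  have bLint: "integrable lborel (\<lambda>x. b x * L (y + x))" for y
    using b_cont L_cont b_supp by (intro integrable_continuous_compact_support[where B="cball 0 r"])
      (auto intro!: continuous_intros intro: continuous_on_compose2)
  have \<rho>_eq: "\<rho> y = (LINT x|lborel. b x * L (y + x))" for y
  proof -
    have [measurable]: "b \<in> borel_measurable borel" "L \<in> borel_measurable borel"
      using b_cont L_cont by (auto intro: borel_measurable_continuous_onI)
    have "\<rho> y = (LINT x|distr lborel borel ((+) y). b (x - y) * L x)"
      unfolding \<rho>_def lborel_distr_plus ..
    also have "\<dots> = (LINT x|lborel. b (y + x - y) * L (y + x))"
      by (subst integral_distr) auto
    finally show ?thesis by simp
  qed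
  have bb: "b x * L (y + x) \<le> b x" for x y
    using b_nonneg[of x] L_range[of "y + x"] by (simp add: mult_left_le)
  have \<rho>_range: "0 \<le> \<rho> y" "\<rho> y \<le> 1" for y
  proof -
    show "0 \<le> \<rho> y" unfolding \<rho>_eq
      using b_nonneg L_range by (intro Bochner_Integration.integral_nonneg) auto
    have "\<rho> y \<le> (LINT x|lborel. b x)" unfolding \<rho>_eq
      using bLint b_int bb by (rule integral_mono)
    then show "\<rho> y \<le> 1" using b1 by simp
  qed
  have \<rho>_lip: "\<bar>\<rho> y - \<rho> z\<bar> \<le> 4 / \<epsilon> * norm (y - z)" for y z
  proof -
    have "\<bar>\<rho> y - \<rho> z\<bar> = \<bar>LINT x|lborel. b x * L (y + x) - b x * L (z + x)\<bar>"
      using bLint by (simp add: \<rho>_eq)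
    also have "\<dots> \<le> (LINT x|lborel. \<bar>b x * L (y + x) - b x * L (z + x)\<bar>)"
      by (rule integral_abs_bound)
    also have "\<dots> \<le> (LINT x|lborel. (4 / \<epsilon> * norm (y - z)) * b x)"
    proof (rule integral_mono)
      show "integrable lborel (\<lambda>x. \<bar>b x * L (y + x) - b x * L (z + x)\<bar>)"
        using bLint by (intro integrable_abs Bochner_Integration.integrable_diff)
      show "integrable lborel (\<lambda>x. 4 / \<epsilon> * norm (y - z) * b x)"
        using b_int by (intro integrable_mult_right)
      fix x
      have "\<bar>b x * L (y + x) - b x * L (z + x)\<bar> = \<bar>L (y + x) - L (z + x)\<bar> * b x"
        using b_nonneg[of x] by (simp add: abs_mult flip: right_diff_distrib)
      also have "\<dots> \<le> (4 / \<epsilon> * norm (y - z)) * b x"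
        using L_lip[of "y + x" "z + x"] b_nonneg[of x] by (intro mult_right_mono) auto
      finally show "\<bar>b x * L (y + x) - b x * L (z + x)\<bar> \<le> 4 / \<epsilon> * norm (y - z) * b x" .
    qed
    also have "\<dots> = 4 / \<epsilon> * norm (y - z)" using b1 by simp
    finally show ?thesis .
  qed
  have near: "\<bar>d (y + x) - d y\<bar> < r" if "norm x < r" for x y
    using d_lip[of "y + x" y] that by simp
  have \<rho>0: "\<rho> y = 0" if "d y < \<epsilon> / 4" for y
  proof -
    have "b x * L (y + x) = 0" for x
    proof (cases "norm x < r")
      case True
      then have "d (y + x) \<le> \<epsilon> / 2" using near[of x y] that assms(2) unfolding r_def by linarith
      then show ?thesis using L0 by simp
    qed (use b_supp in simp)
    then show ?thesis unfolding \<rho>_eq by (simp only: Bochner_Integration.integral_zero)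
  qed
  have \<rho>1: "\<rho> y = 1" if "7 / 8 * \<epsilon> < d y" for y
  proof -
    have "b x * L (y + x) = b x" for x
    proof (cases "norm x < r")
      case True
      then have "3 / 4 * \<epsilon> \<le> d (y + x)" using near[of x y] that assms(2) unfolding r_def by linarith
      then show ?thesis using L1 by simp
    qed (use b_supp in simp)
    then show ?thesis unfolding \<rho>_eq by (simp only: b1)
  qed
  have \<rho>'0: "\<rho>' y = 0" if "\<epsilon> \<le> d y" for y
  proof -
    have y: "y \<in> {z. 7 / 8 * \<epsilon> < d z}" using that assms(2) by auto
    have o: "open {z. 7 / 8 * \<epsilon> < d z}" by (intro open_Collect_less d_cont continuous_intros)
    have "GDERIV \<rho> y :> 0"
      unfolding gderiv_def inner_zero_right
      by (rule has_derivative_transform_within_open[OF has_derivative_const o y]) (use \<rho>1 in auto)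
    then show ?thesis using G GDERIV_unique by blast
  qed
  show ?thesis
  proof (rule that[OF G c])
    show "norm (\<rho>' x) \<le> 4 / \<epsilon>" for x
      using G \<rho>_lip by (rule norm_GDERIV_le_Lipschitz)
    show "\<rho> x = 0" if "infdist x (- \<Omega>) < \<epsilon> / 4" for x
      using that \<rho>0 by (simp add: d_def)
    show "\<rho> x = 1 \<and> \<rho>' x = 0" if "\<epsilon> \<le> infdist x (- \<Omega>)" for x
    proof -
      have "\<epsilon> \<le> d x" using that by (simp add: d_def)
      moreover have "7 / 8 * \<epsilon> < \<epsilon>" using assms(2) by simp
      ultimately show ?thesis using \<rho>1 \<rho>'0 by simp
    qed
  qed (use \<rho>_range in auto)
qed

section \<open>Monotonicity and distributional derivatives on the line\<close>

lemma null_set_avoid: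
  fixes p q :: real
  assumes "N \<in> null_sets lebesgue" "p < q"
  obtains s where "p < s" "s < q" "s \<notin> N"
proof -
  have "\<not> {p<..<q} \<subseteq> N"
  proof
    assume "{p<..<q} \<subseteq> N"
    then have "negligible {p<..<q}"
      using assms(1) negligible_iff_null_sets negligible_subset by blast
    then show False
      using assms(2) open_not_negligible[of "{p<..<q}"] by auto
  qed
  then obtain s where "s \<in> {p<..<q}" "s \<notin> N" by blast
  then show ?thesis using that[of s] by simp
qed

text \<open>On a partition with small increments of \<open>Q\<close>, the sum of the squared increments is at most any given
fraction of the total increment. The partition points are chosen off \<open>N\<close>, where alone the estimate
is known.\<close>

lemma nonincreasing_if_quadratic_increments:
  fixes E Q :: "real \<Rightarrow> real"
  assumes N: "N \<in> null_sets lebesgue"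
    and Q: "continuous_on {a..b} Q"
    and mono: "\<And>s t. a \<le> s \<Longrightarrow> s \<le> t \<Longrightarrow> t \<le> b \<Longrightarrow> Q s \<le> Q t"
    and inc: "\<And>s t. s \<in> {a..b} - N \<Longrightarrow> t \<in> {a..b} - N \<Longrightarrow> s < t \<Longrightarrow> E t - E s \<le> C * (Q t - Q s)\<^sup>2"
    and "0 \<le> C" and t: "t1 \<in> {a..b} - N" "t2 \<in> {a..b} - N" "t1 \<le> t2"
  shows "E t2 \<le> E t1"
proof -
  have main: "E t2 - E t1 \<le> e * (Q t2 - Q t1)" if "e > 0" for e
  proof -
    have "uniformly_continuous_on {a..b} Q"
      using Q by (intro compact_uniformly_continuous) auto
    moreover have "e / (C + 1) > 0" using that \<open>0 \<le> C\<close> by simp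
    ultimately obtain \<delta> where \<delta>: "\<delta> > 0"
      "\<And>s t. s \<in> {a..b} \<Longrightarrow> t \<in> {a..b} \<Longrightarrow> dist t s < \<delta> \<Longrightarrow> dist (Q t) (Q s) < e / (C + 1)"
      unfolding uniformly_continuous_on_def by metis
    have short: "E t - E s \<le> e * (Q t - Q s)"
      if st: "s \<in> {a..b} - N" "t \<in> {a..b} - N" "s < t" "t - s < \<delta>" for s t
    proof -
      have "Q s \<le> Q t" using st by (intro mono) auto
      moreover have "dist (Q t) (Q s) < e / (C + 1)"
        using st by (intro \<delta>(2)) (auto simp: dist_real_def)
      ultimately have "(Q t - Q s) * (C + 1) \<le> e"
        using \<open>0 \<le> C\<close> by (simp add: dist_real_def field_simps)
      then have "C * (Q t - Q s) \<le> e"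
        using \<open>Q s \<le> Q t\<close> by (simp add: algebra_simps)
      then have "C * (Q t - Q s) * (Q t - Q s) \<le> e * (Q t - Q s)"
        using \<open>Q s \<le> Q t\<close> by (intro mult_right_mono) auto
      then show ?thesis using inc[OF st(1-3)] by (simp add: power2_eq_square mult.assoc)
    qed
    have chain: "E t2 - E s \<le> e * (Q t2 - Q s)"
      if "s \<in> {a..b} - N" "s < t2" "t2 - s < real n * (\<delta> / 2)" for s n
      using that
    proof (induction n arbitrary: s)
      case 0
      then show ?case by simp
    next
      case (Suc n)
      show ?case
      proof (cases "t2 - s < \<delta>")
        case True
        then show ?thesis using short Suc.prems t by blast
      next
        case False
        obtain r where r: "s + \<delta> / 2 < r" "r < s + \<delta>" "r \<notin> N"
          using null_set_avoid[OF N, of "s + \<delta> / 2" "s + \<delta>"] \<delta>(1) by auto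
        have r': "r \<in> {a..b} - N" "r < t2" "s < r" "r - s < \<delta>"
          using r False Suc.prems \<delta>(1) t by auto
        have "E t2 - E r \<le> e * (Q t2 - Q r)"
          using r r' Suc.prems by (intro Suc.IH) (auto simp: algebra_simps)
        moreover have "E r - E s \<le> e * (Q r - Q s)"
          using r' Suc.prems by (intro short) auto
        ultimately show ?thesis by (simp add: algebra_simps)
      qed
    qed
    show ?thesis
    proof (cases "t1 = t2")
      case False
      obtain n where "(t2 - t1) / (\<delta> / 2) < real n" using reals_Archimedean2 by blast
      then have "t2 - t1 < real n * (\<delta> / 2)"
        using \<delta>(1) by (simp add: field_simps)
      then show ?thesis using chain t False by auto
    qed simp
  qed
  have "Q t1 \<le> Q t2" using t by (intro mono) auto
  show ?thesis
  proof (rule field_le_epsilon)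
    fix e :: real assume "e > 0"
    define e' where "e' = e / (Q t2 - Q t1 + 1)"
    have "e' > 0" using \<open>e > 0\<close> \<open>Q t1 \<le> Q t2\<close> by (simp add: e'_def)
    have "e' * (Q t2 - Q t1) \<le> e' * (Q t2 - Q t1 + 1)"
      using \<open>e' > 0\<close> by (intro mult_left_mono) auto
    also have "\<dots> = e" using \<open>Q t1 \<le> Q t2\<close> by (simp add: e'_def)
    finally show "E t2 \<le> E t1 + e" using main[OF \<open>e' > 0\<close>] by simp
  qed
qed

text \<open>The positive and the negative part of \<open>f\<close> are densities of finite measures that agree on all half-lines,
hence of the same measure.\<close>

lemma AE_zero_if_integral_Ioi_zero:
  fixes f :: "real \<Rightarrow> real"
  assumes f: "integrable lborel f" and 0: "\<And>x. (LINT t:{x<..}|lborel. f t) = 0"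
  shows "AE t in lborel. f t = 0"
proof -
  have [measurable]: "f \<in> borel_measurable borel" using f by simp
  define M N where "M = density lborel (\<lambda>t. ennreal (f t))" and "N = density lborel (\<lambda>t. ennreal (- f t))"
  have fin: "integrable lborel (\<lambda>t. indicator {x<..} t * max 0 (f t))" "integrable lborel (\<lambda>t. indicator {x<..} t * max 0 (- f t))" for x
    using f by (auto intro!: integrable_real_mult_indicator simp: mult.commute[of "indicator _ _"])
  have M: "emeasure M {x<..} = ennreal (LINT t|lborel. indicator {x<..} t * max 0 (f t))" for x
  proof -
    have "emeasure M {x<..} = (\<integral>\<^sup>+t. ennreal (indicator {x<..} t * max 0 (f t)) \<partial>lborel)"
      unfolding M_def by (subst emeasure_density) (auto intro!: nn_integral_cong simp: indicator_def max_def ennreal_neg)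
    also have "\<dots> = ennreal (LINT t|lborel. indicator {x<..} t * max 0 (f t))"
      using fin by (intro nn_integral_eq_integral) auto
    finally show ?thesis .
  qed
  have N: "emeasure N {x<..} = ennreal (LINT t|lborel. indicator {x<..} t * max 0 (- f t))" for x
  proof -
    have "emeasure N {x<..} = (\<integral>\<^sup>+t. ennreal (indicator {x<..} t * max 0 (- f t)) \<partial>lborel)"
      unfolding N_def by (subst emeasure_density) (auto intro!: nn_integral_cong simp: indicator_def max_def ennreal_neg)
    also have "\<dots> = ennreal (LINT t|lborel. indicator {x<..} t * max 0 (- f t))"
      using fin by (intro nn_integral_eq_integral) auto
    finally show ?thesis .
  qed
  have eq: "(LINT t|lborel. indicator {x<..} t * max 0 (f t)) = (LINT t|lborel. indicator {x<..} t * max 0 (- f t))" for x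
  proof -
    have "(LINT t|lborel. indicator {x<..} t * max 0 (f t)) - (LINT t|lborel. indicator {x<..} t * max 0 (- f t))
      = (LINT t|lborel. indicator {x<..} t * max 0 (f t) - indicator {x<..} t * max 0 (- f t))"
      using fin by (simp only: Bochner_Integration.integral_diff)
    also have "\<dots> = (LINT t:{x<..}|lborel. f t)"
      unfolding set_lebesgue_integral_def by (intro Bochner_Integration.integral_cong) (auto simp: indicator_def max_def)
    finally show ?thesis using 0 by simp
  qed
  have "M = N"
    by (rule measure_eqI_lessThan) (auto simp: M N eq, auto simp: M_def N_def)
  then have "AE t in lborel. ennreal (f t) = ennreal (- f t)"
    unfolding M_def N_def by (intro sigma_finite_measure.density_unique[OF sigma_finite_lborel]) auto
  then show ?thesis
  proof eventually_elim
    fix t assume "ennreal (f t) = ennreal (- f t)"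
    then show "f t = 0"
      by (cases "0 \<le> f t") (auto simp: ennreal_neg ennreal_eq_0_iff dest: sym)
  qed
qed

text \<open>By Fubini's theorem the hypothesis says that \<open>F = g + \<integral>h\<close> annihilates every continuous function of mean
zero with compact support in \<open>(a, b)\<close>. Subtracting a fixed profile \<open>\<beta>\<close> of integral one from arbitrary
functions turns this into \<open>\<integral> \<rho> (F - m) = 0\<close> with \<open>m = \<integral> \<beta> F\<close>, for all continuous \<open>\<rho>\<close>, and trapezoids
\<open>\<rho>\<close> approximate the indicator functions of intervals.\<close>

lemma du_Bois_Reymond:
  fixes g h :: "real \<Rightarrow> real"
  assumes "a < b" and g: "set_integrable lborel {a..b} g" and h: "set_integrable lborel {a..b} h"
    and weak: "\<And>\<theta> \<theta>' c d. (\<And>t. (\<theta> has_field_derivative \<theta>' t) (at t)) \<Longrightarrow> continuous_on UNIV \<theta>' \<Longrightarrow>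
       a < c \<Longrightarrow> c < d \<Longrightarrow> d < b \<Longrightarrow> (\<And>t. t \<notin> {c..d} \<Longrightarrow> \<theta> t = 0 \<and> \<theta>' t = 0) \<Longrightarrow>
       (LINT t:{a..b}|lborel. \<theta>' t * g t) = (LINT t:{a..b}|lborel. \<theta> t * h t)"
  shows "\<exists>m. AE t in lborel. t \<in> {a..b} \<longrightarrow> g t = m - (LINT s:{a..t}|lborel. h s)"
proof -
  define g0 h0 where "g0 t = indicator {a..b} t * g t" and "h0 t = indicator {a..b} t * h t" for t
  have g0: "integrable lborel g0" and h0: "integrable lborel h0"
    using g h by (auto simp: set_integrable_def g0_def[abs_def] h0_def[abs_def])
  have [measurable]: "g0 \<in> borel_measurable borel" "h0 \<in> borel_measurable borel" using g0 h0 by auto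
  define I where "I t = (LINT s|lborel. indicator {..t} s * h0 s)" for t
  have I_meas[measurable]: "I \<in> borel_measurable borel"
  proof -
    have "(\<lambda>t. LINT s|lborel. (if s \<le> t then 1 else 0) * h0 s) \<in> borel_measurable lborel"
      by measurable
    then show ?thesis by (simp add: I_def[abs_def] indicator_def[abs_def])
  qed
  have I_bound: "\<bar>I t\<bar> \<le> (LINT s|lborel. \<bar>h0 s\<bar>)" for t
  proof -
    have "\<bar>I t\<bar> \<le> (LINT s|lborel. \<bar>indicator {..t} s * h0 s\<bar>)"
      unfolding I_def by (rule integral_abs_bound)
    also have "\<dots> \<le> (LINT s|lborel. \<bar>h0 s\<bar>)"
      using h0 by (intro integral_mono integrable_abs integrable_mult_indicator[where f=h0, simplified])
        (auto simp: indicator_def)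
    finally show ?thesis .
  qed
  define F where "F t = indicator {a..b} t * (g0 t + I t)" for t
  have I_int: "integrable lborel (\<lambda>t. indicator {a..b} t * I t)"
  proof (rule Bochner_Integration.integrable_bound)
    show "integrable lborel (\<lambda>t. indicator {a..b} t * (LINT s|lborel. \<bar>h0 s\<bar>))"
      by (intro integrable_mult_left integrable_real_indicator) (auto simp: emeasure_lborel_Icc_eq)
    show "AE t in lborel. norm (indicator {a..b} t * I t) \<le> norm (indicator {a..b} t * (LINT s|lborel. \<bar>h0 s\<bar>))"
      using I_bound by (intro AE_I2) (auto simp: indicator_def intro: order_trans[OF _ abs_ge_self])
  qed auto
  have F_eq: "F = (\<lambda>t. g0 t + indicator {a..b} t * I t)"
    by (auto simp: F_def g0_def indicator_def)
  have F: "integrable lborel F"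
    unfolding F_eq using g0 I_int by (rule Bochner_Integration.integrable_add)
  have F0: "F t = 0" if "t \<notin> {a..b}" for t using that by (simp add: F_def)
  have [measurable]: "F \<in> borel_measurable borel" using F by auto
  have mult_int: "integrable lborel (\<lambda>t. \<rho> t * f t)"
    if *: "continuous_on UNIV \<rho>" "integrable lborel f" "\<And>t. t \<notin> {a..b} \<Longrightarrow> f t = 0" for \<rho> f :: "real \<Rightarrow> real"
  proof -
    have [measurable]: "\<rho> \<in> borel_measurable borel" "f \<in> borel_measurable borel"
      using *(1,2) by (auto intro: borel_measurable_continuous_onI)
    obtain M where M: "M > 0" "\<And>t. t \<in> {a..b} \<Longrightarrow> norm (\<rho> t) \<le> M"
      using continuous_bounded_on_bounded[OF *(1), of "{a..b}"] by auto
    show ?thesis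
    proof (rule Bochner_Integration.integrable_bound)
      show "integrable lborel (\<lambda>t. M * f t)" using *(2) by auto
      show "AE t in lborel. norm (\<rho> t * f t) \<le> norm (M * f t)"
      proof (intro AE_I2)
        fix t show "norm (\<rho> t * f t) \<le> norm (M * f t)"
          using M(1) M(2)[of t] *(3)[of t]
          by (cases "t \<in> {a..b}") (auto simp: abs_mult intro!: mult_right_mono)
      qed
    qed auto
  qed
  \<comment> \<open>A continuous function of mean zero is the derivative of an admissible \<open>\<theta>\<close>.\<close>
  have zero_mean: "(LINT t|lborel. \<rho> t * F t) = 0"
    if \<rho>: "continuous_on UNIV \<rho>" "a < c" "c < d" "d < b" "\<And>t. t \<notin> {c..d} \<Longrightarrow> \<rho> t = 0"
      and \<rho>0: "(LINT t|lborel. \<rho> t) = 0" for \<rho> :: "real \<Rightarrow> real" and c d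
  proof -
    have \<rho>_int: "integrable lborel \<rho>"
      using \<rho>(1,5) by (intro integrable_continuous_compact_support[where B="{c..d}"]) auto
    have [measurable]: "\<rho> \<in> borel_measurable borel" using \<rho>_int by auto
    obtain P where P: "\<And>t. (P has_vector_derivative \<rho> t) (at t)"
      using einterval_antiderivative[of "-\<infinity>" "\<infinity>" \<rho>] \<rho>(1) by (auto simp: continuous_on_eq_continuous_at)
    define \<theta> where "\<theta> t = P t - P c" for t
    have \<theta>D: "(\<theta> has_field_derivative \<rho> t) (at t)" for t
      unfolding \<theta>_def[abs_def] using P[of t]
      by (auto intro!: derivative_eq_intros simp: has_real_derivative_iff_has_vector_derivative)
    have FTC: "(LINT t|lborel. indicator {x..y} t * \<rho> t) = \<theta> y - \<theta> x" if "x \<le> y" for x y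
      using integral_FTC_Icc_real[of x y \<theta> \<rho>] that \<theta>D \<rho>(1)
      by (simp add: mult.commute continuous_on_eq_continuous_at)
    have \<theta>_eq: "\<theta> t = (LINT s|lborel. indicator {..t} s * \<rho> s)" for t
    proof (cases "c \<le> t")
      case True
      have "indicator {c..t} s * \<rho> s = indicator {..t} s * \<rho> s" for s
        using \<rho>(5)[of s] by (auto simp: indicator_def)
      then have "(LINT s|lborel. indicator {..t} s * \<rho> s) = \<theta> t - \<theta> c"
        using FTC[OF True] by (simp only:)
      then show ?thesis by (simp add: \<theta>_def)
    next
      case False
      have z: "indicator {t..c} s * \<rho> s = 0" if "s \<noteq> c" for s
        using \<rho>(5)[of s] that by (auto simp: indicator_def)
      have "(LINT s|lborel. indicator {t..c} s * \<rho> s) = 0"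
      proof (rule integral_eq_zero_AE)
        show "AE s in lborel. indicator {t..c} s * \<rho> s = 0"
          using AE_lborel_singleton[of c] by eventually_elim (rule z)
      qed
      then have "\<theta> t = 0" using FTC[of t c] False by (simp add: \<theta>_def)
      moreover have "indicator {..t} s * \<rho> s = 0" for s
        using \<rho>(5)[of s] False by (auto simp: indicator_def)
      ultimately show ?thesis by (simp only: Bochner_Integration.integral_zero)
    qed
    have \<theta>0: "\<theta> t = 0" if "t \<notin> {c..d}" for t
    proof (cases "t < c")
      case True
      then have "indicator {..t} s * \<rho> s = 0" for s
        using \<rho>(5)[of s] by (auto simp: indicator_def)
      then show ?thesis unfolding \<theta>_eq by (simp only: Bochner_Integration.integral_zero)
    next
      case False
      then have "indicator {..t} s * \<rho> s = \<rho> s" for s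
        using \<rho>(5)[of s] that by (auto simp: indicator_def)
      then show ?thesis unfolding \<theta>_eq by (simp only: \<rho>0)
    qed
    have "(LINT t:{a..b}|lborel. \<rho> t * g t) = (LINT t:{a..b}|lborel. \<theta> t * h t)"
      using \<theta>D \<rho>(1-4) by (rule weak) (use \<theta>0 \<rho>(5) in auto)
    then have 1: "(LINT t|lborel. \<rho> t * g0 t) = (LINT t|lborel. \<theta> t * h0 t)"
      by (simp add: set_lebesgue_integral_def g0_def h0_def mult.left_commute)
    \<comment> \<open>Exchanging the integrals moves the primitive from \<open>\<rho>\<close> to \<open>h\<close>, with the opposite sign.\<close>
    have pint: "integrable (lborel \<Otimes>\<^sub>M lborel) (\<lambda>(s, t). (if s \<le> t then 1 else 0) * (\<rho> s * h0 t))"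
    proof (rule Bochner_Integration.integrable_bound)
      show "integrable (lborel \<Otimes>\<^sub>M lborel) (\<lambda>(s, t). \<rho> s * h0 t)"
        using \<rho>_int h0 by (intro lborel_pair.Fubini_integrable) (auto simp: abs_mult)
      show "AE x in lborel \<Otimes>\<^sub>M lborel. norm (case x of (s, t) \<Rightarrow> (if s \<le> t then 1 else 0) * (\<rho> s * h0 t))
           \<le> norm (case x of (s, t) \<Rightarrow> \<rho> s * h0 t)"
        by (intro AE_I2) auto
    qed measurable
    have "(LINT t|lborel. \<theta> t * h0 t) = (LINT t|lborel. LINT s|lborel. (if s \<le> t then 1 else 0) * (\<rho> s * h0 t))"
      unfolding \<theta>_eq by (intro Bochner_Integration.integral_cong refl) (simp add: indicator_def of_bool_def mult.assoc flip: integral_mult_left_zero)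
    also have "\<dots> = (LINT s|lborel. LINT t|lborel. (if s \<le> t then 1 else 0) * (\<rho> s * h0 t))"
      by (rule lborel_pair.Fubini_integral[OF pint])
    also have "\<dots> = (LINT s|lborel. \<rho> s * ((LINT t|lborel. h0 t) - I s))"
    proof (intro Bochner_Integration.integral_cong refl)
      fix s
      have "(LINT t|lborel. (if s \<le> t then 1 else 0) * (\<rho> s * h0 t)) = \<rho> s * (LINT t|lborel. h0 t - indicator {..s} t * h0 t)"
        unfolding integral_mult_right_zero[symmetric]
        by (intro Bochner_Integration.integral_cong_AE) (auto simp: indicator_def intro!: eventually_mono[OF AE_lborel_singleton[of s]])
      also have "(LINT t|lborel. h0 t - indicator {..s} t * h0 t) = (LINT t|lborel. h0 t) - I s"
        unfolding I_def
        by (intro Bochner_Integration.integral_diff h0 integrable_mult_indicator[where f=h0, simplified]) auto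
      finally show "(LINT t|lborel. (if s \<le> t then 1 else 0) * (\<rho> s * h0 t)) = \<rho> s * ((LINT t|lborel. h0 t) - I s)" .
    qed
    also have "\<dots> = (LINT s|lborel. (LINT t|lborel. h0 t) * \<rho> s - \<rho> s * (indicator {a..b} s * I s))"
    proof (intro Bochner_Integration.integral_cong refl)
      fix s show "\<rho> s * ((LINT t|lborel. h0 t) - I s) = (LINT t|lborel. h0 t) * \<rho> s - \<rho> s * (indicator {a..b} s * I s)"
        using \<rho>(2-5) by (cases "s \<in> {a..b}") (auto simp: algebra_simps)
    qed
    also have "\<dots> = - (LINT s|lborel. \<rho> s * (indicator {a..b} s * I s))"
      using \<rho>_int mult_int[OF \<rho>(1) I_int] \<rho>0 by simp
    finally have "(LINT t|lborel. \<rho> t * g0 t) + (LINT s|lborel. \<rho> s * (indicator {a..b} s * I s)) = 0"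
      using 1 by simp
    moreover have "(LINT t|lborel. \<rho> t * F t) = (LINT t|lborel. \<rho> t * g0 t + \<rho> t * (indicator {a..b} t * I t))"
      by (simp add: F_eq algebra_simps)
    ultimately show ?thesis
      using mult_int[OF \<rho>(1) I_int] mult_int[OF \<rho>(1) g0] by (simp add: g0_def)
  qed
  define e where "e = (b - a) / 4"
  define \<beta> where "\<beta> t = bump e (t - (a + b) / 2) / (LINT t|lborel. bump e (t::real))" for t
  have "e > 0" using \<open>a < b\<close> by (simp add: e_def)
  note Bpos = bump_integral_pos[OF this, where ?'a=real]
  have \<beta>_cont: "continuous_on UNIV \<beta>"
    unfolding \<beta>_def[abs_def] using Bpos
    by (auto intro!: continuous_intros continuous_on_compose2[OF GDERIV_continuous_on[OF GDERIV_bump]])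
  have \<beta>_supp: "\<beta> t = 0" if "t \<notin> {a + e..b - e}" for t
    using that \<open>e > 0\<close> unfolding \<beta>_def by (subst bump_eq_0) (auto simp: e_def field_simps)
  have \<beta>1: "(LINT t|lborel. \<beta> t) = 1"
  proof -
    have "(LINT t|lborel. bump e (t - (a + b) / 2)) = (LINT t|lborel. bump e (t::real))"
      using lborel_integral_real_affine[of 1 "bump e" "- ((a + b) / 2)"] by simp
    then show ?thesis using Bpos by (simp add: \<beta>_def)
  qed
  define m where "m = (LINT t|lborel. \<beta> t * F t)"
  have mean: "(LINT t|lborel. \<rho> t * (F t - m * indicator {a..b} t)) = 0"
    if \<rho>: "continuous_on UNIV \<rho>" "a < c" "c < d" "d < b" "\<And>t. t \<notin> {c..d} \<Longrightarrow> \<rho> t = 0" for \<rho> :: "real \<Rightarrow> real" and c d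
  proof -
    define J where "J = (LINT t|lborel. \<rho> t)"
    have ints: "integrable lborel \<rho>" "integrable lborel \<beta>"
      using \<rho>(1,5) \<beta>_cont \<beta>_supp
      by (auto intro: integrable_continuous_compact_support[where B="{c..d}"] integrable_continuous_compact_support[where B="{a + e..b - e}"])
    have "(LINT t|lborel. (\<rho> t - J * \<beta> t) * F t) = 0"
    proof (rule zero_mean[where c="min c (a + e)" and d="max d (b - e)"])
      show "continuous_on UNIV (\<lambda>t. \<rho> t - J * \<beta> t)" using \<rho>(1) \<beta>_cont by (intro continuous_intros)
      show "(LINT t|lborel. \<rho> t - J * \<beta> t) = 0" using ints \<beta>1 by (simp add: J_def)
      show "\<rho> t - J * \<beta> t = 0" if "t \<notin> {min c (a + e)..max d (b - e)}" for t
      proof -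
        have "t \<notin> {c..d}" "t \<notin> {a + e..b - e}"
          using that by (auto simp: min_le_iff_disj le_max_iff_disj)
        then show ?thesis using \<rho>(5) \<beta>_supp by simp
      qed
    qed (use \<rho> \<open>e > 0\<close> in auto)
    moreover have "(LINT t|lborel. (\<rho> t - J * \<beta> t) * F t) = (LINT t|lborel. \<rho> t * F t - J * (\<beta> t * F t))"
      by (simp add: algebra_simps)
    moreover have "(LINT t|lborel. \<rho> t * F t - J * (\<beta> t * F t)) = (LINT t|lborel. \<rho> t * F t) - J * m"
      using mult_int[OF \<rho>(1) F F0] mult_int[OF \<beta>_cont F F0] by (simp add: m_def)
    moreover have "(LINT t|lborel. \<rho> t * (F t - m * indicator {a..b} t)) = (LINT t|lborel. \<rho> t * F t - m * \<rho> t)"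
    proof (intro Bochner_Integration.integral_cong refl)
      fix t show "\<rho> t * (F t - m * indicator {a..b} t) = \<rho> t * F t - m * \<rho> t"
        using \<rho>(2-5) by (cases "t \<in> {a..b}") (auto simp: algebra_simps)
    qed
    moreover have "(LINT t|lborel. \<rho> t * F t - m * \<rho> t) = (LINT t|lborel. \<rho> t * F t) - m * J"
      using mult_int[OF \<rho>(1) F F0] ints by (simp add: J_def)
    ultimately show ?thesis by simp
  qed
  define D where "D t = F t - m * indicator {a..b} t" for t
  have D: "integrable lborel D" unfolding D_def[abs_def]
    by (intro Bochner_Integration.integrable_diff F integrable_mult_right integrable_real_indicator)
      (auto simp: emeasure_lborel_Icc_eq)
  have [measurable]: "D \<in> borel_measurable borel" using D by auto
  have D_int: "(LINT t:{p<..<b}|lborel. D t) = 0" if "a \<le> p" "p < b" for p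
  proof -
    \<comment> \<open>The subtracted 1 keeps the support of the trapezoid at distance \<open>1/n\<close> from both end points.\<close>
    define \<rho> where "\<rho> n t = max 0 (min 1 (real n * (min (t - p) (b - t)) - 1))" for n t
    have z: "(LINT t|lborel. \<rho> n t * D t) = 0" if n: "n > 2 / (b - p)" for n
      unfolding D_def
    proof (rule mean[where c="p + 1 / n" and d="b - 1 / n"])
      have "real n > 0" using n \<open>p < b\<close> by (smt (verit) divide_pos_pos)
      show "continuous_on UNIV (\<rho> n)" unfolding \<rho>_def[abs_def] by (intro continuous_intros)
      have "2 / n < b - p" using n \<open>p < b\<close> \<open>real n > 0\<close> by (simp add: field_simps)
      then show "p + 1 / n < b - 1 / n" by linarith
      have "1 / real n > 0" using \<open>real n > 0\<close> by simp
      then show "a < p + 1 / n" "b - 1 / n < b" using \<open>a \<le> p\<close> by linarith+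
      fix t assume "t \<notin> {p + 1 / n..b - 1 / n}"
      then have "min (t - p) (b - t) \<le> 1 / n" by auto
      then have "n * min (t - p) (b - t) \<le> 1" using \<open>real n > 0\<close> by (simp add: field_simps)
      then show "\<rho> n t = 0" by (simp add: \<rho>_def)
    qed
    have "(\<lambda>n. LINT t|lborel. \<rho> n t * D t) \<longlonglongrightarrow> (LINT t|lborel. indicator {p<..<b} t * D t)"
    proof (rule integral_dominated_convergence[where w="\<lambda>t. \<bar>D t\<bar>"])
      show "integrable lborel (\<lambda>t. \<bar>D t\<bar>)" using D by auto
      show "(\<lambda>t. \<rho> n t * D t) \<in> borel_measurable lborel" for n unfolding \<rho>_def by measurable
      show "AE t in lborel. norm (\<rho> n t * D t) \<le> \<bar>D t\<bar>" for n
        by (intro AE_I2) (auto simp: abs_mult \<rho>_def intro!: mult_left_le_one_le)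
      show "AE t in lborel. (\<lambda>n. \<rho> n t * D t) \<longlonglongrightarrow> indicator {p<..<b} t * D t"
      proof (intro AE_I2 tendsto_mult_right)
        fix t show "(\<lambda>n. \<rho> n t) \<longlonglongrightarrow> indicator {p<..<b} t"
        proof (cases "t \<in> {p<..<b}")
          case True
          define w where "w = min (t - p) (b - t)"
          have "w > 0" using True by (simp add: w_def)
          obtain n0 where n0: "2 / w < real n0" using reals_Archimedean2 by blast
          have "\<rho> n t = 1" if "n \<ge> n0" for n
          proof -
            have "2 / w < real n" using that n0 by linarith
            then have "2 \<le> real n * w" using \<open>w > 0\<close> by (simp add: field_simps)
            then show ?thesis by (simp add: \<rho>_def w_def)
          qed
          then have "\<forall>\<^sub>F n in sequentially. \<rho> n t = 1" unfolding eventually_sequentially by blast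
          then show ?thesis using True by (simp add: tendsto_eventually)
        next
          case False
          then have "min (t - p) (b - t) \<le> 0" by auto
          then have *: "real n * min (t - p) (b - t) \<le> 0" for n by (rule mult_nonneg_nonpos[OF of_nat_0_le_iff])
          have "\<rho> n t = 0" for n using *[of n] unfolding \<rho>_def by linarith
          then show ?thesis using False by simp
        qed
      qed
    qed auto
    moreover have "(\<lambda>n. LINT t|lborel. \<rho> n t * D t) \<longlonglongrightarrow> 0"
    proof -
      obtain n0 where "2 / (b - p) < real n0" using reals_Archimedean2 by blast
      then have "\<forall>\<^sub>F n in sequentially. (LINT t|lborel. \<rho> n t * D t) = 0"
        unfolding eventually_sequentially by (intro exI[of _ n0]) (auto intro!: z)
      then show ?thesis by (rule tendsto_eventually)
    qed
    ultimately show ?thesis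
      using LIMSEQ_unique by (fastforce simp: set_lebesgue_integral_def)
  qed
  have D0: "D t = 0" if "t \<notin> {a..b}" for t using that F0 by (simp add: D_def)
  have "AE t in lborel. D t = 0"
  proof (rule AE_zero_if_integral_Ioi_zero[OF D])
    fix x
    show "(LINT t:{x<..}|lborel. D t) = 0"
    proof (cases "x < b")
      case True
      have "(LINT t:{x<..}|lborel. D t) = (LINT t:{max a x<..<b}|lborel. D t)"
        unfolding set_lebesgue_integral_def
      proof (intro Bochner_Integration.integral_cong_AE)
        show "AE t in lborel. indicator {x<..} t *\<^sub>R D t = indicator {max a x<..<b} t *\<^sub>R D t"
          using AE_lborel_singleton[of a] AE_lborel_singleton[of b]
        proof eventually_elim
          fix t assume "t \<noteq> a" "t \<noteq> b"
          then show "indicator {x<..} t *\<^sub>R D t = indicator {max a x<..<b} t *\<^sub>R D t"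
            using D0[of t] by (auto simp: indicator_def)
        qed
      qed auto
      then show ?thesis using D_int[of "max a x"] True \<open>a < b\<close> by simp
    next
      case False
      then have "indicator {x<..} t *\<^sub>R D t = 0" for t
        using D0[of t] by (auto simp: indicator_def)
      then show ?thesis unfolding set_lebesgue_integral_def by (simp only: Bochner_Integration.integral_zero)
    qed
  qed
  then have "AE t in lborel. t \<in> {a..b} \<longrightarrow> g t = m - (LINT s:{a..t}|lborel. h s)"
  proof eventually_elim
    fix t assume "D t = 0"
    show "t \<in> {a..b} \<longrightarrow> g t = m - (LINT s:{a..t}|lborel. h s)"
    proof
      assume t: "t \<in> {a..b}"
      have "I t = (LINT s:{a..t}|lborel. h s)"
        unfolding I_def set_lebesgue_integral_def h0_def using t
        by (intro Bochner_Integration.integral_cong) (auto simp: indicator_def)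
      then show "g t = m - (LINT s:{a..t}|lborel. h s)"
        using \<open>D t = 0\<close> t by (simp add: D_def F_def g0_def)
    qed
  qed
  then show ?thesis by blast
qed

section \<open>Bounds for the convolution and the potential gradient\<close>

lemma mult_right_mono_on:
  fixes a b c :: real
  assumes "x \<in> S \<Longrightarrow> a \<le> c" "x \<notin> S \<Longrightarrow> b = 0" "0 \<le> b"
  shows "a * b \<le> c * b"
  using assms by (cases "x \<in> S") (auto intro: mult_right_mono)

lemma integrable_prod_by_slices:
  fixes f :: "'b::euclidean_space \<times> 'c::euclidean_space \<Rightarrow> real"
  assumes [measurable]: "f \<in> borel_measurable (lborel \<Otimes>\<^sub>M lborel)"
    and slice: "\<And>t. integrable lborel (\<lambda>x. f (t, x))"
    and B: "integrable lborel B" "\<And>t. (LINT x|lborel. \<bar>f (t, x)\<bar>) \<le> B t"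
  shows "integrable (lborel \<Otimes>\<^sub>M lborel) f"
proof (rule lborel_pair.Fubini_integrable)
  show "integrable lborel (\<lambda>t. LINT x|lborel. norm (f (t, x)))"
  proof (rule Bochner_Integration.integrable_bound[OF B(1)])
    show "AE t in lborel. norm (LINT x|lborel. norm (f (t, x))) \<le> norm (B t)"
    proof (intro AE_I2)
      fix t
      have "0 \<le> (LINT x|lborel. \<bar>f (t, x)\<bar>)" by (intro Bochner_Integration.integral_nonneg) auto
      then show "norm (LINT x|lborel. norm (f (t, x))) \<le> norm (B t)" using B(2)[of t] by simp
    qed
  qed measurable
qed (use slice in auto)

text \<open>In the following, \<open>\<sigma>\<close> and \<open>\<phi>\<close> stand for Borel versions of \<open>\<chi>\<^sub>S\<close> and \<open>\<chi>\<^sub>S f\<close>, so that, up to null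
sets, the residual is \<open>Au - f\<close> on \<open>S\<close> and zero elsewhere, and \<open>potential_grad\<close> is the gradient of \<open>A\<^sup>T(Au - f)\<close>. The time
argument comes first because integrals over space for fixed time are the inner ones.\<close>

definition conv :: "('a::euclidean_space \<Rightarrow> real) \<Rightarrow> (real \<Rightarrow> 'a \<Rightarrow> real) \<Rightarrow> real \<Rightarrow> 'a \<Rightarrow> real" where
  "conv K U t x = (LINT z|lborel. K (x - z) * U t z)"

definition residual :: "('a::euclidean_space \<Rightarrow> real) \<Rightarrow> ('a \<Rightarrow> real) \<Rightarrow> ('a \<Rightarrow> real) \<Rightarrow> (real \<Rightarrow> 'a \<Rightarrow> real) \<Rightarrow> real \<Rightarrow> 'a \<Rightarrow> real" where
  "residual K \<sigma> \<phi> U t x = \<sigma> x * conv K U t x - \<phi> x"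

definition potential_grad :: "('a::euclidean_space \<Rightarrow> real) \<Rightarrow> ('a \<Rightarrow> 'a) \<Rightarrow> ('a \<Rightarrow> real) \<Rightarrow> ('a \<Rightarrow> real) \<Rightarrow> (real \<Rightarrow> 'a \<Rightarrow> real) \<Rightarrow> real \<Rightarrow> 'a \<Rightarrow> 'a" where
  "potential_grad K k \<sigma> \<phi> U t z = (LINT x|lborel. - residual K \<sigma> \<phi> U t x *\<^sub>R k (x - z))"

text \<open>What is needed at a fixed time. Integrability is required of every slice; a representative of a weak
solution attains this by being zero at the exceptional times.\<close>

locale borel_flow_data =
  fixes \<Omega> :: "'a::euclidean_space set"
    and K :: "'a \<Rightarrow> real" and k :: "'a \<Rightarrow> 'a"
    and \<sigma> \<phi> :: "'a \<Rightarrow> real" and U :: "real \<Rightarrow> 'a \<Rightarrow> real"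
  assumes open_\<Omega>: "open \<Omega>" and bounded_\<Omega>: "bounded \<Omega>"
    and K: "\<And>x. GDERIV K x :> k x" and k: "continuous_on UNIV k"
    and \<sigma>_meas[measurable]: "\<sigma> \<in> borel_measurable borel"
    and \<sigma>_01: "\<And>x. \<sigma> x = 0 \<or> \<sigma> x = 1" and \<sigma>_out: "\<And>x. x \<notin> \<Omega> \<Longrightarrow> \<sigma> x = 0"
    and \<phi>_meas[measurable]: "\<phi> \<in> borel_measurable borel"
    and \<phi>_sq: "integrable lborel (\<lambda>x. (\<phi> x)\<^sup>2)" and \<sigma>_\<phi>: "\<And>x. \<sigma> x * \<phi> x = \<phi> x"
    and U_meas[measurable]: "(\<lambda>(t, x). U t x) \<in> borel_measurable (borel \<Otimes>\<^sub>M borel)"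
    and U_out: "\<And>t x. x \<notin> \<Omega> \<Longrightarrow> U t x = 0"
    and U_slice: "\<And>t. integrable lborel (U t)"
begin

abbreviation "D x \<equiv> infdist x (- \<Omega>)"
abbreviation "w \<equiv> conv K U"
abbreviation "R \<equiv> residual K \<sigma> \<phi> U"
abbreviation "P \<equiv> potential_grad K k \<sigma> \<phi> U"

lemma K_cont: "continuous_on UNIV K" using K by (rule GDERIV_continuous_on)

lemma K_meas[measurable]: "K \<in> borel_measurable borel" and k_meas[measurable]: "k \<in> borel_measurable borel"
  using K_cont k by (auto intro: borel_measurable_continuous_onI)

lemma \<Omega>_meas[measurable]: "\<Omega> \<in> sets borel" using open_\<Omega> by auto

lemma D_meas[measurable]: "D \<in> borel_measurable borel"
  by (intro borel_measurable_continuous_onI continuous_intros)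

lemma U_slice_meas[measurable]: "U t \<in> borel_measurable borel"
  using U_slice[of t] by auto

lemma w_meas[measurable]: "(\<lambda>(t, x). w t x) \<in> borel_measurable (borel \<Otimes>\<^sub>M borel)"
  unfolding conv_def by measurable

lemma w_slice_meas[measurable]: "w t \<in> borel_measurable borel"
  unfolding conv_def by measurable

lemma R_meas[measurable]: "(\<lambda>(t, x). R t x) \<in> borel_measurable (borel \<Otimes>\<^sub>M borel)"
  unfolding residual_def by measurable

lemma R_slice_meas[measurable]: "R t \<in> borel_measurable borel"
  unfolding residual_def by measurable

lemma P_meas[measurable]: "(\<lambda>(t, x). P t x) \<in> borel_measurable (borel \<Otimes>\<^sub>M borel)"
  unfolding potential_grad_def by measurable

lemma P_slice_meas[measurable]: "P t \<in> borel_measurable borel"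
  unfolding potential_grad_def by measurable

text \<open>One bound for the kernel and its gradient at all differences of points of \<open>\<Omega>\<close>.\<close>

definition M :: real where
  "M = (SOME M. 0 < M \<and> (\<forall>x\<in>\<Omega>. \<forall>z\<in>\<Omega>. \<bar>K (x - z)\<bar> \<le> M \<and> norm (k (x - z)) \<le> M))"

lemma M: "0 < M" "x \<in> \<Omega> \<Longrightarrow> z \<in> \<Omega> \<Longrightarrow> \<bar>K (x - z)\<bar> \<le> M" "x \<in> \<Omega> \<Longrightarrow> z \<in> \<Omega> \<Longrightarrow> norm (k (x - z)) \<le> M"
proof -
  let ?B = "(\<lambda>(x, z). x - z) ` (\<Omega> \<times> \<Omega>)"
  have B: "bounded ?B" using bounded_minus[OF bounded_\<Omega> bounded_\<Omega>] by (simp add: image_def case_prod_beta Bex_def)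
  obtain M1 where M1: "M1 > 0" "\<And>x. x \<in> ?B \<Longrightarrow> norm (K x) \<le> M1"
    using continuous_bounded_on_bounded[OF K_cont B] by blast
  obtain M2 where M2: "M2 > 0" "\<And>x. x \<in> ?B \<Longrightarrow> norm (k x) \<le> M2"
    using continuous_bounded_on_bounded[OF k B] by blast
  have "0 < max M1 M2 \<and> (\<forall>x\<in>\<Omega>. \<forall>z\<in>\<Omega>. \<bar>K (x - z)\<bar> \<le> max M1 M2 \<and> norm (k (x - z)) \<le> max M1 M2)"
  proof (intro conjI ballI)
    show "0 < max M1 M2" using M1(1) by simp
    fix x z assume "x \<in> \<Omega>" "z \<in> \<Omega>"
    then have "x - z \<in> ?B" by (intro image_eqI[of _ _ "(x, z)"]) auto
    then show "\<bar>K (x - z)\<bar> \<le> max M1 M2" "norm (k (x - z)) \<le> max M1 M2"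
      using M1(2)[of "x - z"] M2(2)[of "x - z"] by auto
  qed
  then have "0 < M \<and> (\<forall>x\<in>\<Omega>. \<forall>z\<in>\<Omega>. \<bar>K (x - z)\<bar> \<le> M \<and> norm (k (x - z)) \<le> M)"
    unfolding M_def by (rule someI)
  then show "0 < M" "x \<in> \<Omega> \<Longrightarrow> z \<in> \<Omega> \<Longrightarrow> \<bar>K (x - z)\<bar> \<le> M" "x \<in> \<Omega> \<Longrightarrow> z \<in> \<Omega> \<Longrightarrow> norm (k (x - z)) \<le> M"
    by auto
qed

definition mass :: "real \<Rightarrow> real" where "mass t = (LINT x|lborel. \<bar>U t x\<bar>)"
definition vol :: real where "vol = measure lborel \<Omega>"

lemma mass_nonneg: "0 \<le> mass t" unfolding mass_def by (intro Bochner_Integration.integral_nonneg) auto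
lemma vol_nonneg: "0 \<le> vol" unfolding vol_def by simp

lemma \<Omega>_finite: "emeasure lborel \<Omega> < \<infinity>"
  using emeasure_bounded_finite[OF bounded_\<Omega>] by simp

lemma ind_\<Omega>_int: "integrable lborel (indicator \<Omega> :: 'a \<Rightarrow> real)"
  using \<Omega>_finite by (intro integrable_real_indicator) auto

lemma w_cont: "continuous_on UNIV (w t)"
proof -
  have "continuous_on UNIV (\<lambda>x. LINT z|lborel. U t z *\<^sub>R K (x - z))"
    using U_slice bounded_\<Omega> U_out
    by (intro continuous_on_integral_kernel[where B=\<Omega>])
      (auto simp: case_prod_beta intro!: continuous_intros continuous_on_compose2[OF K_cont])
  then show ?thesis by (simp add: conv_def[abs_def] mult.commute)
qed

lemma w_bound: assumes "x \<in> \<Omega>" shows "\<bar>w t x\<bar> \<le> M * mass t"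
proof -
  have "\<bar>w t x\<bar> \<le> (LINT z|lborel. M * \<bar>U t z\<bar>)"
    unfolding conv_def
  proof (rule integral_abs_bound[THEN order_trans], rule integral_mono_AE')
    show "integrable lborel (\<lambda>z. M * \<bar>U t z\<bar>)" using U_slice[of t] by auto
    show "AE z in lborel. \<bar>K (x - z) * U t z\<bar> \<le> M * \<bar>U t z\<bar>"
      unfolding abs_mult
    proof (intro AE_I2)
      fix z show "\<bar>K (x - z)\<bar> * \<bar>U t z\<bar> \<le> M * \<bar>U t z\<bar>"
        using M(2)[OF assms] U_out by (intro mult_right_mono_on[where x=z and S=\<Omega>]) auto
    qed
  qed (intro AE_I2 mult_nonneg_nonneg less_imp_le[OF M(1)] abs_ge_zero)
  then show ?thesis by (simp add: mass_def)
qed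

lemma \<phi>_out: "x \<notin> \<Omega> \<Longrightarrow> \<phi> x = 0" using \<sigma>_\<phi>[of x] \<sigma>_out[of x] by simp

lemma \<phi>_int: "integrable lborel \<phi>"
proof (rule Bochner_Integration.integrable_bound)
  show "integrable lborel (\<lambda>x. indicator \<Omega> x + (\<phi> x)\<^sup>2)" using ind_\<Omega>_int \<phi>_sq by auto
  show "AE x in lborel. norm (\<phi> x) \<le> norm (indicator \<Omega> x + (\<phi> x)\<^sup>2)"
  proof (intro AE_I2)
    fix x
    have "0 \<le> (\<bar>\<phi> x\<bar> - 1)\<^sup>2" by simp
    then have "2 * \<bar>\<phi> x\<bar> \<le> 1 + (\<phi> x)\<^sup>2" by (simp add: power2_diff)
    then show "norm (\<phi> x) \<le> norm (indicator \<Omega> x + (\<phi> x)\<^sup>2)"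
      using \<phi>_out[of x] by (cases "x \<in> \<Omega>") auto
  qed
qed auto

lemma R_out: "x \<notin> \<Omega> \<Longrightarrow> R t x = 0" by (simp add: residual_def \<sigma>_out \<phi>_out)

lemma R_bound: "\<bar>R t x\<bar> \<le> indicator \<Omega> x * (M * mass t) + \<bar>\<phi> x\<bar>"
proof (cases "x \<in> \<Omega>")
  case True
  have "\<bar>\<sigma> x * w t x\<bar> \<le> \<bar>w t x\<bar>" using \<sigma>_01[of x] by auto
  then show ?thesis using True w_bound[OF True, of t] unfolding residual_def by simp
qed (simp add: R_out)

lemma R_bound_int: "integrable lborel (\<lambda>x. indicator \<Omega> x * (M * mass t) + \<bar>\<phi> x\<bar>)"
  by (intro Bochner_Integration.integrable_add integrable_mult_left ind_\<Omega>_int integrable_abs \<phi>_int)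

lemma R_int: "integrable lborel (R t)"
proof (rule Bochner_Integration.integrable_bound[OF R_bound_int])
  show "AE x in lborel. norm (R t x) \<le> norm (indicator \<Omega> x * (M * mass t) + \<bar>\<phi> x\<bar>)"
  proof (intro AE_I2)
    fix x show "norm (R t x) \<le> norm (indicator \<Omega> x * (M * mass t) + \<bar>\<phi> x\<bar>)"
      using R_bound[of t x] by simp
  qed
qed measurable

lemma R_norm1: "(LINT x|lborel. \<bar>R t x\<bar>) \<le> vol * (M * mass t) + (LINT x|lborel. \<bar>\<phi> x\<bar>)"
proof -
  have "(LINT x|lborel. \<bar>R t x\<bar>) \<le> (LINT x|lborel. indicator \<Omega> x * (M * mass t) + \<bar>\<phi> x\<bar>)"
    using R_int R_bound_int R_bound by (intro integral_mono) auto
  also have "\<dots> = vol * (M * mass t) + (LINT x|lborel. \<bar>\<phi> x\<bar>)"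
    using ind_\<Omega>_int \<phi>_int by (simp add: vol_def)
  finally show ?thesis .
qed

lemma norm_integral_R_k_le:
  assumes "integrable lborel f" "\<And>x. x \<notin> \<Omega> \<Longrightarrow> f x = 0" "z \<in> \<Omega>"
  shows "norm (LINT x|lborel. f x *\<^sub>R k (x - z)) \<le> M * (LINT x|lborel. \<bar>f x\<bar>)"
proof -
  have [measurable]: "f \<in> borel_measurable borel" using assms(1) by auto
  have "norm (LINT x|lborel. f x *\<^sub>R k (x - z)) \<le> (LINT x|lborel. M * \<bar>f x\<bar>)"
  proof (rule integral_norm_bound[THEN order_trans], rule integral_mono_AE')
    show "integrable lborel (\<lambda>x. M * \<bar>f x\<bar>)" using assms(1) by auto
    show "AE x in lborel. norm (f x *\<^sub>R k (x - z)) \<le> M * \<bar>f x\<bar>"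
      unfolding norm_scaleR mult.commute[of "\<bar>f _\<bar>"]
    proof (intro AE_I2)
      fix x show "norm (k (x - z)) * \<bar>f x\<bar> \<le> M * \<bar>f x\<bar>"
        using M(3)[OF _ assms(3)] assms(2) by (intro mult_right_mono_on[where x=x and S=\<Omega>]) auto
    qed
  qed (intro AE_I2 mult_nonneg_nonneg less_imp_le[OF M(1)] abs_ge_zero)
  then show ?thesis by simp
qed

lemma P_bound:
  assumes "z \<in> \<Omega>" shows "norm (P t z) \<le> M * (vol * (M * mass t) + (LINT x|lborel. \<bar>\<phi> x\<bar>))"
proof -
  have "norm (P t z) \<le> M * (LINT x|lborel. \<bar>- R t x\<bar>)"
    unfolding potential_grad_def using R_int R_out assms by (intro norm_integral_R_k_le) auto
  also have "\<dots> \<le> M * (vol * (M * mass t) + (LINT x|lborel. \<bar>\<phi> x\<bar>))"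
    using R_norm1[of t] M(1) by (intro mult_left_mono) auto
  finally show ?thesis .
qed

text \<open>This bound of the potential gradient on \<open>\<Omega>\<close> grows linearly with the mass and is therefore known
to be integrable in time, but not to be bounded.\<close>

definition P_max :: "real \<Rightarrow> real" where "P_max t = M * (vol * (M * mass t) + (LINT x|lborel. \<bar>\<phi> x\<bar>))"

lemma P_max_nonneg: "0 \<le> P_max t"
  unfolding P_max_def using M(1) mass_nonneg vol_nonneg
  by (intro mult_nonneg_nonneg add_nonneg_nonneg Bochner_Integration.integral_nonneg) auto

lemma mass_meas[measurable]: "mass \<in> borel_measurable borel"
  unfolding mass_def[abs_def] by measurable

lemma P_max_meas[measurable]: "P_max \<in> borel_measurable borel"
  unfolding P_max_def[abs_def] by measurable

lemma layer_set_int: "integrable lborel (\<lambda>x. indicator {x. D x < \<epsilon>} x * \<bar>U t x\<bar>)"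
proof -
  have "integrable lborel (\<lambda>x. indicator {x. D x < \<epsilon>} x *\<^sub>R \<bar>U t x\<bar>)"
    using U_slice[of t] by (intro integrable_mult_indicator) auto
  then show ?thesis by simp
qed

end

text \<open>The three hypotheses on the solution in space-time: boundary values, local integrability up to time \<open>T\<close>,
and the weak equation, tested with products of a function of space and a function of time.\<close>

locale borel_weak_solution = borel_flow_data +
  fixes T :: real
  assumes layer: "\<And>a e. 0 < a \<Longrightarrow> 0 < e \<Longrightarrow> \<exists>\<epsilon>0>0. \<forall>\<epsilon>. 0 < \<epsilon> \<longrightarrow> \<epsilon> < \<epsilon>0 \<longrightarrow> (\<forall>t\<in>{a..T}.
        (LINT x|lborel. indicator {x. infdist x (- \<Omega>) < \<epsilon>} x * \<bar>U t x\<bar>) \<le> e * \<epsilon>)"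
    and loc_int: "\<And>C a. compact C \<Longrightarrow> C \<subseteq> \<Omega> \<Longrightarrow> 0 < a \<Longrightarrow>
        integrable (lborel \<Otimes>\<^sub>M lborel) (\<lambda>(t, x). indicator {a..T} t * (indicator C x * U t x))"
    and weak: "\<And>\<psi> \<psi>' C \<theta> \<theta>' a b.
        (\<And>x. GDERIV \<psi> x :> \<psi>' x) \<Longrightarrow> continuous_on UNIV \<psi>' \<Longrightarrow> compact C \<Longrightarrow> C \<subseteq> \<Omega> \<Longrightarrow>
        (\<And>x. x \<notin> C \<Longrightarrow> \<psi> x = 0) \<Longrightarrow>
        (\<And>t. (\<theta> has_field_derivative \<theta>' t) (at t)) \<Longrightarrow> continuous_on UNIV \<theta>' \<Longrightarrow>
        0 < a \<Longrightarrow> b < T \<Longrightarrow> (\<And>t. t \<notin> {a..b} \<Longrightarrow> \<theta> t = 0) \<Longrightarrow>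
        integrable (lborel \<Otimes>\<^sub>M lborel) (\<lambda>(t, x). \<theta>' t * \<psi> x * U t x
          - \<bar>U t x\<bar> * \<theta> t * (\<psi>' x \<bullet> potential_grad K k \<sigma> \<phi> U t x)) \<and>
        (LINT p|(lborel \<Otimes>\<^sub>M lborel). (\<lambda>(t, x). \<theta>' t * \<psi> x * U t x
          - \<bar>U t x\<bar> * \<theta> t * (\<psi>' x \<bullet> potential_grad K k \<sigma> \<phi> U t x)) p) = 0"
begin

lemma thin_layer:
  assumes "0 < a"
  obtains \<epsilon> where "\<epsilon> > 0"
    "\<And>t. t \<in> {a..T} \<Longrightarrow> (LINT x|lborel. indicator {x. D x < \<epsilon>} x * \<bar>U t x\<bar>) \<le> 1 * \<epsilon>"
proof -
  obtain \<epsilon>0 where e: "\<epsilon>0 > 0" "\<forall>\<epsilon>. 0 < \<epsilon> \<longrightarrow> \<epsilon> < \<epsilon>0 \<longrightarrow> (\<forall>t\<in>{a..T}.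
      (LINT x|lborel. indicator {x. D x < \<epsilon>} x * \<bar>U t x\<bar>) \<le> 1 * \<epsilon>)"
    using layer[OF assms, of 1] by auto
  show ?thesis
  proof (rule that)
    show "\<epsilon>0 / 2 > 0" using e(1) by simp
    show "(LINT x|lborel. indicator {x. D x < \<epsilon>0 / 2} x * \<bar>U t x\<bar>) \<le> 1 * (\<epsilon>0 / 2)" if "t \<in> {a..T}" for t
      using e(2)[rule_format, of "\<epsilon>0 / 2" t] e(1) that by simp
  qed
qed

text \<open>Local integrability handles a compact part of \<open>\<Omega>\<close>; on the remaining layer the boundary condition
bounds the mass uniformly in time.\<close>

lemma U_integrable:
  assumes "0 < a"
  shows "integrable (lborel \<Otimes>\<^sub>M lborel) (\<lambda>(t, x). indicator {a..T} t * U t x)"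
proof -
  obtain \<epsilon> where \<epsilon>: "\<epsilon> > 0"
      "\<And>t. t \<in> {a..T} \<Longrightarrow> (LINT x|lborel. indicator {x. D x < \<epsilon>} x * \<bar>U t x\<bar>) \<le> 1 * \<epsilon>"
    using thin_layer[OF assms] by blast
  let ?C = "{x. \<epsilon> \<le> D x}"
  have inner: "integrable (lborel \<Otimes>\<^sub>M lborel) (\<lambda>(t, x). indicator {a..T} t * (indicator ?C x * U t x))"
    using compact_infdist_compl_ge[OF bounded_\<Omega> \<epsilon>(1)] assms by (rule loc_int)
  have outer: "integrable (lborel \<Otimes>\<^sub>M lborel) (\<lambda>(t, x). indicator {a..T} t * (indicator {x. D x < \<epsilon>} x * \<bar>U t x\<bar>))"
  proof (rule integrable_prod_by_slices[where B="\<lambda>t. indicator {a..T} t * \<epsilon>"])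
    show "integrable lborel (\<lambda>t. indicator {a..T} t * \<epsilon>)"
      by (intro integrable_mult_left integrable_real_indicator) (auto simp: emeasure_lborel_Icc_eq)
    fix t
    show "integrable lborel (\<lambda>x. case (t, x) of (t, x) \<Rightarrow> indicator {a..T} t * (indicator {x. D x < \<epsilon>} x * \<bar>U t x\<bar>))"
      using layer_set_int[of \<epsilon> t] by simp
    show "(LINT x|lborel. \<bar>case (t, x) of (t, x) \<Rightarrow> indicator {a..T} t * (indicator {x. D x < \<epsilon>} x * \<bar>U t x\<bar>)\<bar>) \<le> indicator {a..T} t * \<epsilon>"
      using \<epsilon>(2)[of t] by (cases "t \<in> {a..T}") (auto simp: abs_mult)
  qed measurable
  show ?thesis
  proof (rule Bochner_Integration.integrable_bound[OF Bochner_Integration.integrable_add[OF integrable_abs[OF inner] outer]])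
    show "AE p in lborel \<Otimes>\<^sub>M lborel. norm (case p of (t, x) \<Rightarrow> indicator {a..T} t * U t x)
      \<le> norm (\<bar>case p of (t, x) \<Rightarrow> indicator {a..T} t * (indicator ?C x * U t x)\<bar>
        + (case p of (t, x) \<Rightarrow> indicator {a..T} t * (indicator {x. D x < \<epsilon>} x * \<bar>U t x\<bar>)))"
      by (intro AE_I2) (auto simp: indicator_def)
  qed measurable
qed

lemma mass_integrable: assumes "0 < a" shows "integrable lborel (\<lambda>t. indicator {a..T} t * mass t)"
proof -
  have "integrable lborel (\<lambda>t. LINT x|lborel. \<bar>case (t, x) of (t, x) \<Rightarrow> indicator {a..T} t * U t x\<bar>)"
    by (rule lborel_pair.integrable_fst'[OF integrable_abs[OF U_integrable[OF assms]]])
  then show ?thesis by (simp add: abs_mult mass_def)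
qed

lemma P_max_integrable: assumes "0 < a" shows "integrable lborel (\<lambda>t. indicator {a..T} t * P_max t)"
proof -
  have "integrable lborel (\<lambda>t. M * vol * M * (indicator {a..T} t * mass t) + M * (LINT x|lborel. \<bar>\<phi> x\<bar>) * indicator {a..T} t)"
    by (intro Bochner_Integration.integrable_add integrable_mult_right mass_integrable assms integrable_real_indicator)
      (auto simp: emeasure_lborel_Icc_eq)
  then show ?thesis by (simp add: P_max_def algebra_simps)
qed

text \<open>The product of the mass of a slice and its bound of the potential gradient is quadratic in the mass, which
need not be integrable in time. Near the boundary, however, one of the two factors is uniformly small, and
the bound is linear.\<close>

lemma layer_flux_integrable:
  assumes "0 < a" "0 < \<epsilon>" "0 \<le> e"
    and e: "\<And>t. t \<in> {a..T} \<Longrightarrow> (LINT x|lborel. indicator {x. D x < \<epsilon>} x * \<bar>U t x\<bar>) \<le> e * \<epsilon>"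
  shows "integrable (lborel \<Otimes>\<^sub>M lborel) (\<lambda>(t, x). indicator {a..T} t * (indicator {x. D x < \<epsilon>} x * \<bar>U t x\<bar> * norm (P t x)))" (is "integrable _ ?f")
    and "(LINT p|(lborel \<Otimes>\<^sub>M lborel). (\<lambda>(t, x). indicator {a..T} t * (indicator {x. D x < \<epsilon>} x * \<bar>U t x\<bar> * norm (P t x))) p)
      \<le> e * \<epsilon> * (LINT t|lborel. indicator {a..T} t * P_max t)"
proof -
  have bd: "indicator {x. D x < \<epsilon>} x * \<bar>U t x\<bar> * norm (P t x) \<le> indicator {x. D x < \<epsilon>} x * \<bar>U t x\<bar> * P_max t" for t x
  proof (cases "x \<in> \<Omega>")
    case True
    show ?thesis
      by (rule mult_left_mono[OF P_bound[OF True, folded P_max_def]]) simp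
  qed (simp add: U_out)
  have sl: "integrable lborel (\<lambda>x. indicator {x. D x < \<epsilon>} x * \<bar>U t x\<bar> * norm (P t x))" for t
  proof (rule Bochner_Integration.integrable_bound[OF integrable_mult_left[OF layer_set_int]])
    show "AE x in lborel. norm (indicator {x. D x < \<epsilon>} x * \<bar>U t x\<bar> * norm (P t x)) \<le> norm (indicator {x. D x < \<epsilon>} x * \<bar>U t x\<bar> * P_max t)"
      using bd P_max_nonneg[of t] by (intro AE_I2) (auto simp: abs_mult)
  qed measurable
  have slb: "(LINT x|lborel. ?f (t, x)) \<le> e * \<epsilon> * (indicator {a..T} t * P_max t)" for t
  proof (cases "t \<in> {a..T}")
    case True
    have "(LINT x|lborel. indicator {x. D x < \<epsilon>} x * \<bar>U t x\<bar> * norm (P t x)) \<le> (LINT x|lborel. indicator {x. D x < \<epsilon>} x * \<bar>U t x\<bar> * P_max t)"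
      using sl integrable_mult_left[OF layer_set_int] bd by (rule integral_mono)
    also have "\<dots> \<le> e * \<epsilon> * P_max t"
      using mult_right_mono[OF e[OF True] P_max_nonneg] by simp
    finally show ?thesis using True by simp
  qed simp
  have nn: "0 \<le> ?f p" for p by (auto simp: case_prod_beta)
  show 1: "integrable (lborel \<Otimes>\<^sub>M lborel) ?f"
  proof (rule integrable_prod_by_slices[where B="\<lambda>t. e * \<epsilon> * (indicator {a..T} t * P_max t)"])
    show "integrable lborel (\<lambda>t. e * \<epsilon> * (indicator {a..T} t * P_max t))"
      using P_max_integrable[OF assms(1)] by (intro integrable_mult_right)
    show "integrable lborel (\<lambda>x. ?f (t, x))" for t
      using sl[of t] by simp
    show "(LINT x|lborel. \<bar>?f (t, x)\<bar>) \<le> e * \<epsilon> * (indicator {a..T} t * P_max t)" for t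
      unfolding abs_of_nonneg[OF nn] by (rule slb)
  qed measurable
  have "(LINT p|(lborel \<Otimes>\<^sub>M lborel). ?f p) = (LINT t|lborel. LINT x|lborel. ?f (t, x))"
    by (rule lborel_pair.integral_fst'[OF 1, symmetric])
  also have "\<dots> \<le> (LINT t|lborel. e * \<epsilon> * (indicator {a..T} t * P_max t))"
    using lborel_pair.integrable_fst'[OF 1] integrable_mult_right[OF P_max_integrable[OF assms(1)]] slb by (rule integral_mono)
  finally show "(LINT p|(lborel \<Otimes>\<^sub>M lborel). ?f p) \<le> e * \<epsilon> * (LINT t|lborel. indicator {a..T} t * P_max t)" by simp
qed

end

section \<open>The weak identity up to the boundary\<close>

lemma continuous_compact_support_bounded:
  fixes f :: "real \<Rightarrow> real"
  assumes "continuous_on UNIV f" "\<And>t. t \<notin> {a..b} \<Longrightarrow> f t = 0"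
  obtains m where "m > 0" "\<And>t. \<bar>f t\<bar> \<le> m"
proof -
  obtain m where m: "m > 0" "\<And>t. t \<in> {a..b} \<Longrightarrow> norm (f t) \<le> m"
    using continuous_bounded_on_bounded[OF assms(1), of "{a..b}"] by auto
  have "\<bar>f t\<bar> \<le> m" for t
    using m assms(2)[of t] by (cases "t \<in> {a..b}") auto
  then show ?thesis using that m(1) by blast
qed

lemma time_cutoff:
  fixes a b T :: real
  assumes "0 < a" "b < T"
  obtains \<theta> \<theta>' c d where "\<And>t. (\<theta> has_field_derivative \<theta>' t) (at t)" "continuous_on UNIV \<theta>'"
    "0 < c" "d < T" "\<And>t. t \<notin> {c..d} \<Longrightarrow> \<theta> t = 0" "\<And>t. t \<in> {a..b} \<Longrightarrow> \<theta> t = 1"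
proof -
  define \<epsilon> where "\<epsilon> = min a (T - b)"
  have \<epsilon>: "\<epsilon> > 0" using assms by (simp add: \<epsilon>_def)
  have bd: "bounded {0<..<T}" by simp
  obtain \<theta> \<theta>' where *: "\<And>x. GDERIV \<theta> x :> \<theta>' x" "continuous_on UNIV \<theta>'"
    "\<And>x. 0 \<le> \<theta> x" "\<And>x. \<theta> x \<le> 1" "\<And>x. norm (\<theta>' x) \<le> 4 / \<epsilon>"
    "\<And>x. infdist x (- {0<..<T}) < \<epsilon> / 4 \<Longrightarrow> \<theta> x = 0"
    "\<And>x. \<epsilon> \<le> infdist x (- {0<..<T}) \<Longrightarrow> \<theta> x = 1 \<and> \<theta>' x = 0"
    using smooth_cutoff[OF bd \<epsilon>] by blast
  have supp: "\<theta> t = 0" if "t \<notin> {\<epsilon> / 4..T - \<epsilon> / 4}" for t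
  proof (rule *(6))
    show "infdist t (- {0<..<T}) < \<epsilon> / 4"
    proof (cases "t \<in> {0<..<T}")
      case False
      then show ?thesis using \<epsilon> by (simp add: infdist_zero)
    next
      case True
      have "infdist t (- {0<..<T}) \<le> dist t 0" "infdist t (- {0<..<T}) \<le> dist t T"
        using infdist_le[of 0 "- {0<..<T}" t] infdist_le[of T "- {0<..<T}" t] by simp_all
      then show ?thesis using that True by (auto simp: dist_real_def)
    qed
  qed
  have one: "\<theta> t = 1" if "t \<in> {a..b}" for t
  proof -
    have ne: "- {0<..<T} \<noteq> {}" by auto
    have "\<epsilon> \<le> dist t y" if y: "y \<in> - {0<..<T}" for y
      using y \<open>t \<in> {a..b}\<close> by (auto simp: \<epsilon>_def dist_real_def)
    then have "\<epsilon> \<le> infdist t (- {0<..<T})"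
      unfolding infdist_notempty[OF ne] by (intro cINF_greatest ne)
    then show ?thesis using *(7) by blast
  qed
  show ?thesis
  proof (rule that)
    show "(\<theta> has_field_derivative \<theta>' t) (at t)" for t using *(1)[of t] by simp
    show "continuous_on UNIV \<theta>'" by (rule *(2))
    show "0 < \<epsilon> / 4" "T - \<epsilon> / 4 < T" using \<epsilon> by auto
  qed (use supp one in auto)
qed

context borel_weak_solution begin

lemma U_mult_integrable:
  assumes [measurable]: "\<eta> \<in> borel_measurable borel" and "\<And>t. \<bar>\<eta> t\<bar> \<le> m" "0 < c" "d \<le> T" "\<And>t. t \<notin> {c..d} \<Longrightarrow> \<eta> t = 0"
    and \<psi>: "continuous_on UNIV \<psi>"
  shows "integrable (lborel \<Otimes>\<^sub>M lborel) (\<lambda>(t, x). \<eta> t * \<psi> x * U t x)"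
proof -
  have [measurable]: "\<psi> \<in> borel_measurable borel" using \<psi> by (rule borel_measurable_continuous_onI)
  obtain m2 where m2: "m2 > 0" "\<And>x. x \<in> \<Omega> \<Longrightarrow> norm (\<psi> x) \<le> m2"
    using continuous_bounded_on_bounded[OF \<psi> bounded_\<Omega>] by blast
  have "0 \<le> m" using assms(2)[of 0] by linarith
  have bd: "\<bar>\<eta> t * \<psi> x * U t x\<bar> \<le> m * m2 * \<bar>indicator {c..T} t * U t x\<bar>" for t x
  proof (cases "t \<in> {c..d} \<and> x \<in> \<Omega>")
    case True
    then have "\<bar>\<eta> t\<bar> * \<bar>\<psi> x\<bar> * \<bar>U t x\<bar> \<le> m * m2 * \<bar>U t x\<bar>"
      using assms(2) m2 \<open>0 \<le> m\<close> by (intro mult_right_mono mult_mono) auto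
    then show ?thesis using True assms(4) by (simp add: abs_mult)
  next
    case False
    then have z: "\<eta> t * \<psi> x * U t x = 0" using assms(5) U_out by auto
    show ?thesis unfolding z using \<open>0 \<le> m\<close> m2(1) by simp
  qed
  show ?thesis
  proof (rule Bochner_Integration.integrable_bound)
    show "integrable (lborel \<Otimes>\<^sub>M lborel) (\<lambda>p. m * m2 * \<bar>(\<lambda>(t, x). indicator {c..T} t * U t x) p\<bar>)"
      by (intro integrable_mult_right integrable_abs U_integrable assms)
    show "AE p in lborel \<Otimes>\<^sub>M lborel. norm (case p of (t, x) \<Rightarrow> \<eta> t * \<psi> x * U t x)
        \<le> norm (m * m2 * \<bar>(\<lambda>(t, x). indicator {c..T} t * U t x) p\<bar>)"
    proof (intro AE_I2)
      fix p :: "real \<times> 'a"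
      show "norm (case p of (t, x) \<Rightarrow> \<eta> t * \<psi> x * U t x) \<le> norm (m * m2 * \<bar>(\<lambda>(t, x). indicator {c..T} t * U t x) p\<bar>)"
        using bd[of "fst p" "snd p"] by (simp add: case_prod_beta)
    qed
  qed measurable
qed

text \<open>Away from the boundary the only source of integrability is the weak formulation itself: tested with
\<open>x \<bullet> i\<close> times cutoffs, its integrand is the sum of an integrable function and, where the cutoffs are
one, the \<open>i\<close>-th component of \<open>|u| \<nabla>v\<close>.\<close>

lemma flux_integrable:
  assumes "0 < a" "b < T"
  shows "integrable (lborel \<Otimes>\<^sub>M lborel) (\<lambda>(t, x). indicator {a..b} t * (\<bar>U t x\<bar> * norm (P t x)))"
proof -
  obtain \<epsilon> where \<epsilon>: "\<epsilon> > 0"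
      "\<And>t. t \<in> {a..T} \<Longrightarrow> (LINT x|lborel. indicator {x. D x < \<epsilon>} x * \<bar>U t x\<bar>) \<le> 1 * \<epsilon>"
    using thin_layer[OF assms(1)] by blast
  note outer = layer_flux_integrable(1)[OF assms(1) \<epsilon>(1) zero_le_one \<epsilon>(2)]
  obtain \<rho> \<rho>' where \<rho>: "\<And>x. GDERIV \<rho> x :> \<rho>' x" "continuous_on UNIV \<rho>'"
    "\<And>x. 0 \<le> \<rho> x" "\<And>x. \<rho> x \<le> 1" "\<And>x. norm (\<rho>' x) \<le> 4 / \<epsilon>"
    "\<And>x. D x < \<epsilon> / 4 \<Longrightarrow> \<rho> x = 0" "\<And>x. \<epsilon> \<le> D x \<Longrightarrow> \<rho> x = 1 \<and> \<rho>' x = 0"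
    using smooth_cutoff[OF bounded_\<Omega> \<epsilon>(1)] by blast
  obtain \<theta> \<theta>' c d where \<theta>: "\<And>t. (\<theta> has_field_derivative \<theta>' t) (at t)" "continuous_on UNIV \<theta>'"
    "0 < c" "d < T" "\<And>t. t \<notin> {c..d} \<Longrightarrow> \<theta> t = 0" "\<And>t. t \<in> {a..b} \<Longrightarrow> \<theta> t = 1"
    using time_cutoff[OF assms] by blast
  have \<theta>'0: "\<theta>' t = 0" if "t \<notin> {c..d}" for t
    using GDERIV_zero_off_closed[of \<theta> t "\<theta>' t" "{c..d}"] \<theta>(1,5) that by simp
  have [measurable]: "\<theta>' \<in> borel_measurable borel" using \<theta>(2) by (rule borel_measurable_continuous_onI)
  obtain m where m: "m > 0" "\<And>t. \<bar>\<theta>' t\<bar> \<le> m"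
    using continuous_compact_support_bounded[OF \<theta>(2) \<theta>'0] by blast
  have \<rho>_cont: "continuous_on UNIV \<rho>" using \<rho>(1) by (rule GDERIV_continuous_on)
  let ?Q = "\<lambda>(t, x). indicator ({a..b} \<times> {x. \<epsilon> \<le> D x}) (t, x) * \<bar>U t x\<bar>"
  \<comment> \<open>One component of \<open>|u| \<nabla>v\<close>, on the part of space-time where both cutoffs are one.\<close>
  have comp: "integrable (lborel \<Otimes>\<^sub>M lborel) (\<lambda>(t, x). indicator ({a..b} \<times> {x. \<epsilon> \<le> D x}) (t, x) * (\<bar>U t x\<bar> * (i \<bullet> P t x)))"
    if i: "i \<in> Basis" for i
  proof -
    define \<psi> \<psi>' where "\<psi> x = \<rho> x * (x \<bullet> i)" and "\<psi>' x = \<rho> x *\<^sub>R i + (x \<bullet> i) *\<^sub>R \<rho>' x" for x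
    have "GDERIV (\<lambda>x. x \<bullet> i) x :> i" for x
      unfolding gderiv_def by (auto intro!: derivative_eq_intros)
    then have G: "GDERIV \<psi> x :> \<psi>' x" for x
      unfolding \<psi>_def[abs_def] \<psi>'_def using \<rho>(1) by (intro GDERIV_mult)
    have \<psi>'_cont: "continuous_on UNIV \<psi>'"
      unfolding \<psi>'_def[abs_def] by (intro continuous_intros \<rho>_cont \<rho>(2))
    have \<psi>_cont: "continuous_on UNIV \<psi>" using G by (rule GDERIV_continuous_on)
    have "\<epsilon> / 4 > 0" using \<epsilon>(1) by simp
    note C = compact_infdist_compl_ge[OF bounded_\<Omega> this]
    have \<psi>0: "\<psi> x = 0" if "x \<notin> {x. \<epsilon> / 4 \<le> D x}" for x
      using \<rho>(6)[of x] that by (simp add: \<psi>_def)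
    note W = weak[OF G \<psi>'_cont C \<psi>0 \<theta>(1-5), THEN conjunct1]
    have "integrable (lborel \<Otimes>\<^sub>M lborel) (\<lambda>(t, x). \<theta>' t * \<psi> x * U t x)"
      using m(2) \<theta>(3) less_imp_le[OF \<theta>(4)] \<theta>'0 \<psi>_cont by (intro U_mult_integrable) auto
    from Bochner_Integration.integrable_diff[OF this W]
    have "integrable (lborel \<Otimes>\<^sub>M lborel) (\<lambda>p. indicator ({a..b} \<times> {x. \<epsilon> \<le> D x}) p *\<^sub>R ((case p of (t, x) \<Rightarrow> \<theta>' t * \<psi> x * U t x) -
       (case p of (t, x) \<Rightarrow> \<theta>' t * \<psi> x * U t x - \<bar>U t x\<bar> * \<theta> t * (\<psi>' x \<bullet> P t x))))"
      by (intro integrable_mult_indicator) (auto intro!: pair_measureI)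
    moreover have "indicator ({a..b} \<times> {x. \<epsilon> \<le> D x}) p *\<^sub>R ((case p of (t, x) \<Rightarrow> \<theta>' t * \<psi> x * U t x) -
       (case p of (t, x) \<Rightarrow> \<theta>' t * \<psi> x * U t x - \<bar>U t x\<bar> * \<theta> t * (\<psi>' x \<bullet> P t x)))
       = (\<lambda>(t, x). indicator ({a..b} \<times> {x. \<epsilon> \<le> D x}) (t, x) * (\<bar>U t x\<bar> * (i \<bullet> P t x))) p" for p
      using \<theta>(6)[of "fst p"] \<rho>(7)[of "snd p"]
      by (cases "p \<in> {a..b} \<times> {x. \<epsilon> \<le> D x}") (auto simp: \<psi>'_def case_prod_beta)
    ultimately show ?thesis by (simp only:)
  qed
  have inner: "integrable (lborel \<Otimes>\<^sub>M lborel) (\<lambda>p. \<Sum>i\<in>Basis. \<bar>(\<lambda>(t, x). indicator ({a..b} \<times> {x. \<epsilon> \<le> D x}) (t, x) * (\<bar>U t x\<bar> * (i \<bullet> P t x))) p\<bar>)"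
    using comp by (intro Bochner_Integration.integrable_sum integrable_abs)
  show ?thesis
  proof (rule Bochner_Integration.integrable_bound[OF Bochner_Integration.integrable_add[OF inner outer]])
    show "AE p in lborel \<Otimes>\<^sub>M lborel. norm (case p of (t, x) \<Rightarrow> indicator {a..b} t * (\<bar>U t x\<bar> * norm (P t x)))
      \<le> norm ((\<Sum>i\<in>Basis. \<bar>(\<lambda>(t, x). indicator ({a..b} \<times> {x. \<epsilon> \<le> D x}) (t, x) * (\<bar>U t x\<bar> * (i \<bullet> P t x))) p\<bar>)
          + (case p of (t, x) \<Rightarrow> indicator {a..T} t * (indicator {x. D x < \<epsilon>} x * \<bar>U t x\<bar> * norm (P t x))))"
    proof (intro AE_I2)
      fix p :: "real \<times> 'a"
      obtain t x where p: "p = (t, x)" by (cases p)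
      let ?S = "\<Sum>i\<in>Basis. \<bar>indicator ({a..b} \<times> {x. \<epsilon> \<le> D x}) (t, x) * (\<bar>U t x\<bar> * (i \<bullet> P t x))\<bar>"
      let ?L = "indicator {a..T} t * (indicator {x. D x < \<epsilon>} x * \<bar>U t x\<bar> * norm (P t x))"
      have S: "0 \<le> ?S" by (intro sum_nonneg) auto
      have L: "0 \<le> ?L" by simp
      have "indicator {a..b} t * (\<bar>U t x\<bar> * norm (P t x)) \<le> ?S + ?L"
      proof (cases "t \<in> {a..b}")
        case True
        show ?thesis
        proof (cases "\<epsilon> \<le> D x")
          case False
          then show ?thesis using True assms(2) S by simp
        next
          case D: True
          have "?S = \<bar>U t x\<bar> * (\<Sum>i\<in>Basis. \<bar>P t x \<bullet> i\<bar>)"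
            using True D by (simp add: abs_mult sum_distrib_left inner_commute)
          moreover have "\<bar>U t x\<bar> * norm (P t x) \<le> \<bar>U t x\<bar> * (\<Sum>i\<in>Basis. \<bar>P t x \<bullet> i\<bar>)"
            by (intro mult_left_mono norm_le_l1) auto
          moreover have "indicator {a..b} t * (\<bar>U t x\<bar> * norm (P t x)) = \<bar>U t x\<bar> * norm (P t x)"
            using True by simp
          ultimately show ?thesis using L by linarith
        qed
      qed (use S L in simp)
      then show "norm (case p of (t, x) \<Rightarrow> indicator {a..b} t * (\<bar>U t x\<bar> * norm (P t x)))
        \<le> norm ((\<Sum>i\<in>Basis. \<bar>(\<lambda>(t, x). indicator ({a..b} \<times> {x. \<epsilon> \<le> D x}) (t, x) * (\<bar>U t x\<bar> * (i \<bullet> P t x))) p\<bar>)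
          + (case p of (t, x) \<Rightarrow> indicator {a..T} t * (indicator {x. D x < \<epsilon>} x * \<bar>U t x\<bar> * norm (P t x))))"
        unfolding p prod.case real_norm_def by (simp add: abs_mult)
    qed
  qed measurable
qed

lemma flux_mult_integrable:
  assumes [measurable]: "\<eta> \<in> borel_measurable borel" and "\<And>t. \<bar>\<eta> t\<bar> \<le> m" "0 < c" "d < T" "\<And>t. t \<notin> {c..d} \<Longrightarrow> \<eta> t = 0"
    and F[measurable]: "(\<lambda>(t, x). F t x) \<in> borel_measurable (borel \<Otimes>\<^sub>M borel)" and F_bd: "\<And>t x. x \<in> \<Omega> \<Longrightarrow> norm (F t x) \<le> m2"
  shows "integrable (lborel \<Otimes>\<^sub>M lborel) (\<lambda>(t, x). \<bar>U t x\<bar> * \<eta> t * (F t x \<bullet> P t x))"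
proof -
  have "0 \<le> m" using assms(2)[of 0] by linarith
  have bd: "\<bar>\<bar>U t x\<bar> * \<eta> t * (F t x \<bullet> P t x)\<bar> \<le> \<bar>m * m2 * (indicator {c..d} t * (\<bar>U t x\<bar> * norm (P t x)))\<bar>" for t x
  proof (cases "t \<in> {c..d} \<and> x \<in> \<Omega>")
    case True
    have F: "norm (F t x) \<le> m2" using F_bd True by simp
    then have "0 \<le> m2" using norm_ge_zero[of "F t x"] by linarith
    have "\<bar>U t x\<bar> * \<bar>\<eta> t\<bar> * \<bar>F t x \<bullet> P t x\<bar> \<le> \<bar>U t x\<bar> * m * (m2 * norm (P t x))"
      using assms(2) \<open>0 \<le> m\<close> \<open>0 \<le> m2\<close>
      by (intro mult_mono order_trans[OF Cauchy_Schwarz_ineq2] mult_right_mono F mult_left_mono) auto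
    then show ?thesis using True \<open>0 \<le> m\<close> \<open>0 \<le> m2\<close> by (simp add: abs_mult mult_ac)
  next
    case False
    then have z: "\<bar>U t x\<bar> * \<eta> t * (F t x \<bullet> P t x) = 0" using assms(5) U_out by auto
    show ?thesis unfolding z by simp
  qed
  show ?thesis
  proof (rule Bochner_Integration.integrable_bound)
    show "integrable (lborel \<Otimes>\<^sub>M lborel) (\<lambda>p. m * m2 * (\<lambda>(t, x). indicator {c..d} t * (\<bar>U t x\<bar> * norm (P t x))) p)"
      by (intro integrable_mult_right flux_integrable assms)
    show "AE p in lborel \<Otimes>\<^sub>M lborel. norm (case p of (t, x) \<Rightarrow> \<bar>U t x\<bar> * \<eta> t * (F t x \<bullet> P t x))
        \<le> norm (m * m2 * (\<lambda>(t, x). indicator {c..d} t * (\<bar>U t x\<bar> * norm (P t x))) p)"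
    proof (intro AE_I2)
      fix p :: "real \<times> 'a"
      show "norm (case p of (t, x) \<Rightarrow> \<bar>U t x\<bar> * \<eta> t * (F t x \<bullet> P t x))
        \<le> norm (m * m2 * (\<lambda>(t, x). indicator {c..d} t * (\<bar>U t x\<bar> * norm (P t x))) p)"
        unfolding case_prod_beta real_norm_def by (rule bd)
    qed
  qed measurable
qed

text \<open>The gradient of the cutoff is at most \<open>4/\<epsilon>\<close> and lives on the layer of width \<open>\<epsilon>\<close>, where the integral
of \<open>|u| |\<nabla>v|\<close> is at most \<open>e \<epsilon>\<close> times a constant, for any \<open>e > 0\<close> and all small \<open>\<epsilon>\<close>. So the error term
tends to zero with \<open>\<epsilon>\<close>, while the main term converges by dominated convergence.\<close>

lemma weak_identity:
  assumes \<psi>: "\<And>x. GDERIV \<psi> x :> \<psi>' x" "continuous_on UNIV \<psi>'"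
    and \<theta>: "\<And>t. (\<theta> has_field_derivative \<theta>' t) (at t)" "continuous_on UNIV \<theta>'"
      "0 < a" "b < T" "\<And>t. t \<notin> {a..b} \<Longrightarrow> \<theta> t = 0"
  shows "(LINT p|(lborel \<Otimes>\<^sub>M lborel). (\<lambda>(t, x). \<theta>' t * \<psi> x * U t x) p)
    = (LINT p|(lborel \<Otimes>\<^sub>M lborel). (\<lambda>(t, x). \<bar>U t x\<bar> * \<theta> t * (\<psi>' x \<bullet> P t x)) p)"
    (is "integral\<^sup>L _ ?A = integral\<^sup>L _ ?B")
proof -
  let ?M = "lborel \<Otimes>\<^sub>M lborel :: (real \<times> 'a) measure"
  have \<theta>'0: "\<theta>' t = 0" if "t \<notin> {a..b}" for t
    using GDERIV_zero_off_closed[of \<theta> t "\<theta>' t" "{a..b}"] \<theta>(1,5) that by simp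
  have \<theta>_cont: "continuous_on UNIV \<theta>"
    using \<theta>(1) by (auto intro!: GDERIV_continuous_on)
  have \<psi>_cont: "continuous_on UNIV \<psi>" using \<psi>(1) by (rule GDERIV_continuous_on)
  have [measurable]: "\<theta> \<in> borel_measurable borel" "\<theta>' \<in> borel_measurable borel" "\<psi> \<in> borel_measurable borel" "\<psi>' \<in> borel_measurable borel"
    using \<theta>_cont \<theta>(2) \<psi>_cont \<psi>(2) by (auto intro: borel_measurable_continuous_onI)
  obtain m' where m': "m' > 0" "\<And>t. \<bar>\<theta>' t\<bar> \<le> m'"
    using continuous_compact_support_bounded[OF \<theta>(2) \<theta>'0] by blast
  obtain m where m: "m > 0" "\<And>t. \<bar>\<theta> t\<bar> \<le> m"
    using continuous_compact_support_bounded[OF \<theta>_cont \<theta>(5)] by blast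
  obtain m2 where m2: "m2 > 0" "\<And>x. x \<in> \<Omega> \<Longrightarrow> norm (\<psi> x) \<le> m2"
    using continuous_bounded_on_bounded[OF \<psi>_cont bounded_\<Omega>] by blast
  obtain m3 where m3: "m3 > 0" "\<And>x. x \<in> \<Omega> \<Longrightarrow> norm (\<psi>' x) \<le> m3"
    using continuous_bounded_on_bounded[OF \<psi>(2) bounded_\<Omega>] by blast
  have A: "integrable ?M ?A"
    using m'(2) \<theta>(3) less_imp_le[OF \<theta>(4)] \<theta>'0 \<psi>_cont by (intro U_mult_integrable) auto
  have B: "integrable ?M ?B"
    using m(2) \<theta>(3-5) m3(2) by (intro flux_mult_integrable[where F="\<lambda>t x. \<psi>' x"]) auto
  define G where "G p = ?A p - ?B p" for p
  have G: "integrable ?M G" unfolding G_def[abs_def] by (intro Bochner_Integration.integrable_diff A B)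
  have [measurable]: "G \<in> borel_measurable ?M" using G by auto
  have G_out: "G p = 0" if "snd p \<notin> \<Omega>" for p
    using U_out[OF that, of "fst p"] by (simp add: G_def case_prod_beta)
  define \<epsilon> where "\<epsilon> n = 1 / real (Suc n)" for n
  have \<epsilon>_pos: "\<epsilon> n > 0" for n by (simp add: \<epsilon>_def)
  have \<epsilon>_lim: "\<epsilon> \<longlonglongrightarrow> 0" unfolding \<epsilon>_def[abs_def] by (rule LIMSEQ_Suc[OF lim_1_over_n])
  let ?cut = "\<lambda>n \<rho> \<rho>'. (\<forall>x. GDERIV \<rho> x :> \<rho>' x) \<and> continuous_on UNIV \<rho>' \<and> (\<forall>x. 0 \<le> \<rho> x \<and> \<rho> x \<le> 1) \<and>
      (\<forall>x. norm (\<rho>' x) \<le> 4 / \<epsilon> n) \<and> (\<forall>x. D x < \<epsilon> n / 4 \<longrightarrow> \<rho> x = 0) \<and> (\<forall>x. \<epsilon> n \<le> D x \<longrightarrow> \<rho> x = 1 \<and> \<rho>' x = 0)"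
  have "\<exists>c. ?cut n (fst c) (snd c)" for n
  proof -
    obtain \<rho> \<rho>' where \<rho>: "\<And>x. GDERIV \<rho> x :> \<rho>' x" "continuous_on UNIV \<rho>'"
      "\<And>x. 0 \<le> \<rho> x" "\<And>x. \<rho> x \<le> 1" "\<And>x. norm (\<rho>' x) \<le> 4 / \<epsilon> n"
      "\<And>x. D x < \<epsilon> n / 4 \<Longrightarrow> \<rho> x = 0" "\<And>x. \<epsilon> n \<le> D x \<Longrightarrow> \<rho> x = 1 \<and> \<rho>' x = 0"
      using smooth_cutoff[OF bounded_\<Omega> \<epsilon>_pos] by blast
    then show ?thesis by (intro exI[of _ "(\<rho>, \<rho>')"]) simp
  qed
  then obtain cc where cc: "\<And>n. ?cut n (fst (cc n)) (snd (cc n))" by metis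
  define \<rho> \<rho>' where "\<rho> n = fst (cc n)" and "\<rho>' n = snd (cc n)" for n
  have \<rho>: "GDERIV (\<rho> n) x :> \<rho>' n x" "continuous_on UNIV (\<rho>' n)"
      "0 \<le> \<rho> n x" "\<rho> n x \<le> 1" "norm (\<rho>' n x) \<le> 4 / \<epsilon> n"
      "D x < \<epsilon> n / 4 \<Longrightarrow> \<rho> n x = 0" "\<epsilon> n \<le> D x \<Longrightarrow> \<rho> n x = 1" "\<epsilon> n \<le> D x \<Longrightarrow> \<rho>' n x = 0" for n x
    using cc[of n] unfolding \<rho>_def \<rho>'_def by auto
  have \<rho>_cont: "continuous_on UNIV (\<rho> n)" for n using \<rho>(1) by (rule GDERIV_continuous_on)
  have [measurable]: "\<rho> n \<in> borel_measurable borel" "\<rho>' n \<in> borel_measurable borel" for n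
    using \<rho>_cont \<rho>(2) by (auto intro: borel_measurable_continuous_onI)
  have \<rho>G: "integrable ?M (\<lambda>p. \<rho> n (snd p) * G p)" for n
  proof (rule Bochner_Integration.integrable_bound[OF G])
    show "AE p in ?M. norm (\<rho> n (snd p) * G p) \<le> norm (G p)"
      using \<rho>(3,4) by (intro AE_I2) (simp add: abs_mult mult_left_le_one_le)
  qed measurable
  have lim1: "(\<lambda>n. LINT p|?M. \<rho> n (snd p) * G p) \<longlonglongrightarrow> (LINT p|?M. G p)"
  proof (rule integral_dominated_convergence[where w="\<lambda>p. \<bar>G p\<bar>"])
    show "integrable ?M (\<lambda>p. \<bar>G p\<bar>)" using G by (rule integrable_abs)
    show "AE p in ?M. norm (\<rho> n (snd p) * G p) \<le> \<bar>G p\<bar>" for n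
      using \<rho>(3,4) by (intro AE_I2) (simp add: abs_mult mult_left_le_one_le)
    show "AE p in ?M. (\<lambda>n. \<rho> n (snd p) * G p) \<longlonglongrightarrow> G p"
    proof (intro AE_I2)
      fix p :: "real \<times> 'a"
      show "(\<lambda>n. \<rho> n (snd p) * G p) \<longlonglongrightarrow> G p"
      proof (cases "snd p \<in> \<Omega>")
        case False
        then show ?thesis using G_out by simp
      next
        case True
        have "- \<Omega> \<noteq> {}" using bounded_\<Omega> not_bounded_UNIV[where ?'a='a] by (metis boolean_algebra.compl_zero double_complement)
        then have "D (snd p) > 0"
          using True open_\<Omega> by (intro infdist_pos_not_in_closed) (auto simp: closed_Compl)
        then have "\<forall>\<^sub>F n in sequentially. \<epsilon> n < D (snd p)"
          using \<epsilon>_lim by (auto dest: order_tendstoD(2))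
        then have "\<forall>\<^sub>F n in sequentially. \<rho> n (snd p) * G p = G p"
          by eventually_elim (use \<rho>(7) in simp)
        then show ?thesis by (rule tendsto_eventually)
      qed
    qed
  qed measurable
  define err where "err n = (\<lambda>(t, x). \<bar>U t x\<bar> * \<theta> t * (\<psi> x * (\<rho>' n x \<bullet> P t x)))" for n
  have err: "integrable ?M (err n)" "(LINT p|?M. \<rho> n (snd p) * G p) = (LINT p|?M. err n p)" for n
  proof -
    have GG: "GDERIV (\<lambda>x. \<rho> n x * \<psi> x) x :> \<rho> n x *\<^sub>R \<psi>' x + \<psi> x *\<^sub>R \<rho>' n x" for x
      using \<rho>(1) \<psi>(1) by (rule GDERIV_mult)
    have cG: "continuous_on UNIV (\<lambda>x. \<rho> n x *\<^sub>R \<psi>' x + \<psi> x *\<^sub>R \<rho>' n x)"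
      by (intro continuous_intros \<rho>_cont \<rho>(2) \<psi>(2) \<psi>_cont)
    have "\<epsilon> n / 4 > 0" using \<epsilon>_pos by simp
    note C = compact_infdist_compl_ge[OF bounded_\<Omega> this]
    have off: "\<rho> n x * \<psi> x = 0" if "x \<notin> {x. \<epsilon> n / 4 \<le> D x}" for x
      using \<rho>(6)[of x n] that by simp
    let ?W = "\<lambda>(t, x). \<theta>' t * (\<rho> n x * \<psi> x) * U t x - \<bar>U t x\<bar> * \<theta> t * ((\<rho> n x *\<^sub>R \<psi>' x + \<psi> x *\<^sub>R \<rho>' n x) \<bullet> P t x)"
    have W: "integrable ?M ?W" "(LINT p|?M. ?W p) = 0"
      using weak[OF GG cG C off \<theta>] by auto
    have eq: "err n = (\<lambda>p. \<rho> n (snd p) * G p - ?W p)"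
      by (auto simp: err_def G_def fun_eq_iff inner_add_left algebra_simps)
    show "integrable ?M (err n)" unfolding eq by (intro Bochner_Integration.integrable_diff \<rho>G W)
    show "(LINT p|?M. \<rho> n (snd p) * G p) = (LINT p|?M. err n p)"
      unfolding eq Bochner_Integration.integral_diff[OF \<rho>G W(1)] W(2) by simp
  qed
  define c where "c = (LINT t|lborel. indicator {a..T} t * P_max t)"
  have "c \<ge> 0" unfolding c_def by (intro Bochner_Integration.integral_nonneg) (simp add: P_max_nonneg)
  have lim2: "(\<lambda>n. LINT p|?M. err n p) \<longlonglongrightarrow> 0"
  proof (rule LIMSEQ_I)
    fix r :: real assume "r > 0"
    \<comment> \<open>The error for the cutoff at distance \<open>\<epsilon>\<close> is at most \<open>4 m m2 e c\<close>; adding 1 to \<open>c\<close> makes it less than \<open>r\<close>.\<close>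
    define e where "e = r / (4 * m * m2 * (c + 1))"
    have "e > 0" unfolding e_def using \<open>r > 0\<close> m(1) m2(1) \<open>c \<ge> 0\<close> by (intro divide_pos_pos mult_pos_pos) auto
    obtain \<epsilon>0 where \<epsilon>0: "\<epsilon>0 > 0" "\<forall>\<epsilon>. 0 < \<epsilon> \<longrightarrow> \<epsilon> < \<epsilon>0 \<longrightarrow> (\<forall>t\<in>{a..T}.
        (LINT x|lborel. indicator {x. D x < \<epsilon>} x * \<bar>U t x\<bar>) \<le> e * \<epsilon>)"
      using layer[OF \<theta>(3) \<open>e > 0\<close>] by blast
    have small: "\<bar>LINT p|?M. err n p\<bar> < r" if n: "\<epsilon> n < \<epsilon>0" for n
    proof -
      have en: "\<And>t. t \<in> {a..T} \<Longrightarrow> (LINT x|lborel. indicator {x. D x < \<epsilon> n} x * \<bar>U t x\<bar>) \<le> e * \<epsilon> n"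
        using \<epsilon>0(2) n \<epsilon>_pos by blast
      note L = layer_flux_integrable[OF \<theta>(3) \<epsilon>_pos less_imp_le[OF \<open>e > 0\<close>] en]
      let ?L = "\<lambda>(t, x). indicator {a..T} t * (indicator {x. D x < \<epsilon> n} x * \<bar>U t x\<bar> * norm (P t x))"
      have pt: "\<bar>err n p\<bar> \<le> (4 * m * m2 / \<epsilon> n) * ?L p" for p
      proof -
        obtain t x where p: "p = (t, x)" by (cases p)
        show ?thesis
        proof (cases "t \<in> {a..b} \<and> x \<in> \<Omega> \<and> D x < \<epsilon> n")
          case True
          have "\<bar>\<rho>' n x \<bullet> P t x\<bar> \<le> 4 / \<epsilon> n * norm (P t x)"
            by (rule order_trans[OF Cauchy_Schwarz_ineq2]) (intro mult_right_mono \<rho>(5) norm_ge_zero)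
          then have "\<bar>U t x\<bar> * \<bar>\<theta> t\<bar> * (\<bar>\<psi> x\<bar> * \<bar>\<rho>' n x \<bullet> P t x\<bar>) \<le> \<bar>U t x\<bar> * m * (m2 * (4 / \<epsilon> n * norm (P t x)))"
            using m m2 True by (intro mult_mono) auto
          then show ?thesis using True \<theta>(4) by (simp add: p err_def abs_mult mult_ac)
        next
          case False
          then have "err n p = 0"
            using \<theta>(5)[of t] U_out[of x t] \<rho>(8)[of n x] by (auto simp: p err_def)
          moreover have "0 \<le> (4 * m * m2 / \<epsilon> n) * ?L p"
            using m(1) m2(1) \<epsilon>_pos[of n] by (intro mult_nonneg_nonneg divide_nonneg_pos) (auto simp: p)
          ultimately show ?thesis by simp
        qed
      qed
      have "\<bar>LINT p|?M. err n p\<bar> \<le> (LINT p|?M. \<bar>err n p\<bar>)" by (rule integral_abs_bound)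
      also have "\<dots> \<le> (LINT p|?M. (4 * m * m2 / \<epsilon> n) * ?L p)"
        by (intro integral_mono integrable_abs err integrable_mult_right L(1) pt)
      also have "\<dots> = (4 * m * m2 / \<epsilon> n) * (LINT p|?M. ?L p)"
        by (rule integral_mult_right_zero)
      also have "\<dots> \<le> (4 * m * m2 / \<epsilon> n) * (e * \<epsilon> n * c)"
        using L(2) m(1) m2(1) \<epsilon>_pos[of n] unfolding c_def by (intro mult_left_mono) auto
      also have "\<dots> = (4 * m * m2) * e * c" using \<epsilon>_pos[of n] by simp
      also have "\<dots> < (4 * m * m2) * e * (c + 1)"
        using m(1) m2(1) \<open>e > 0\<close> by (intro mult_strict_left_mono) auto
      also have "\<dots> = r"
        using m(1) m2(1) \<open>c \<ge> 0\<close> by (simp add: e_def)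
      finally show ?thesis .
    qed
    have "\<forall>\<^sub>F n in sequentially. \<epsilon> n < \<epsilon>0" using order_tendstoD(2)[OF \<epsilon>_lim \<epsilon>0(1)] .
    then show "\<exists>no. \<forall>n\<ge>no. norm ((LINT p|?M. err n p) - 0) < r"
      unfolding eventually_sequentially using small by auto
  qed
  have "(LINT p|?M. G p) = 0"
    using LIMSEQ_unique[OF lim1] lim2 err(2) by simp
  then show ?thesis
    unfolding G_def by (simp only: Bochner_Integration.integral_diff[OF A B])
qed

text \<open>If \<open>F\<close> is the gradient of \<open>\<psi>\<close>, this is, by the equation, minus the rate of change of the integral of
\<open>\<psi> u\<close>.\<close>

definition flux :: "('a \<Rightarrow> 'a) \<Rightarrow> real \<Rightarrow> real" where
  "flux F t = (LINT z|lborel. \<bar>U t z\<bar> * (F z \<bullet> P t z))"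

lemma flux_set_integrable:
  assumes "0 < a" "b < T" and F: "continuous_on UNIV F"
  shows "integrable (lborel \<Otimes>\<^sub>M lborel) (\<lambda>(t, z). \<bar>U t z\<bar> * indicator {a..b} t * (F z \<bullet> P t z))"
    and "set_integrable lborel {a..b} (flux F)"
proof -
  have [measurable]: "F \<in> borel_measurable borel" using F by (rule borel_measurable_continuous_onI)
  obtain m where m: "m > 0" "\<And>x. x \<in> \<Omega> \<Longrightarrow> norm (F x) \<le> m"
    using continuous_bounded_on_bounded[OF F bounded_\<Omega>] by blast
  show *: "integrable (lborel \<Otimes>\<^sub>M lborel) (\<lambda>(t, z). \<bar>U t z\<bar> * indicator {a..b} t * (F z \<bullet> P t z))"
    using assms m by (intro flux_mult_integrable[where F="\<lambda>t x. F x" and m=1 and c=a and d=b]) (auto simp: indicator_def)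
  have "integrable lborel (\<lambda>t. LINT z|lborel. (case (t, z) of (t, z) \<Rightarrow> \<bar>U t z\<bar> * indicator {a..b} t * (F z \<bullet> P t z)))"
    using * by (rule lborel_pair.integrable_fst')
  moreover have "(LINT z|lborel. (case (t, z) of (t, z) \<Rightarrow> \<bar>U t z\<bar> * indicator {a..b} t * (F z \<bullet> P t z))) = indicator {a..b} t *\<^sub>R flux F t" for t
    by (cases "t \<in> {a..b}") (simp_all add: flux_def)
  ultimately show "set_integrable lborel {a..b} (flux F)"
    unfolding set_integrable_def by (simp only:)
qed

lemma moment_identity:
  assumes \<psi>: "\<And>x. GDERIV \<psi> x :> \<psi>' x" "continuous_on UNIV \<psi>'" and ab: "0 < a" "a < b" "b < T"
  shows "\<exists>m. AE t in lborel. t \<in> {a..b} \<longrightarrow>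
    (LINT z|lborel. \<psi> z * U t z) = m - (LINT s:{a..t}|lborel. flux \<psi>' s)"
proof (rule du_Bois_Reymond[OF ab(2)])
  have \<psi>_cont: "continuous_on UNIV \<psi>" using \<psi>(1) by (rule GDERIV_continuous_on)
  have [measurable]: "\<psi> \<in> borel_measurable borel" "\<psi>' \<in> borel_measurable borel"
    using \<psi>_cont \<psi>(2) by (auto intro: borel_measurable_continuous_onI)
  show "set_integrable lborel {a..b} (flux \<psi>')"
    using ab(1,3) \<psi>(2) by (rule flux_set_integrable)
  have "integrable (lborel \<Otimes>\<^sub>M lborel) (\<lambda>(t, x). indicator {a..b} t * \<psi> x * U t x)"
    using ab \<psi>_cont by (intro U_mult_integrable[where m=1 and c=a and d=b]) (auto simp: indicator_def)
  then have "integrable lborel (\<lambda>t. LINT x|lborel. (case (t, x) of (t, x) \<Rightarrow> indicator {a..b} t * \<psi> x * U t x))"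
    by (rule lborel_pair.integrable_fst')
  moreover have "(LINT x|lborel. (case (t, x) of (t, x) \<Rightarrow> indicator {a..b} t * \<psi> x * U t x)) = indicator {a..b} t *\<^sub>R (LINT x|lborel. \<psi> x * U t x)" for t
    by (cases "t \<in> {a..b}") simp_all
  ultimately show "set_integrable lborel {a..b} (\<lambda>t. LINT x|lborel. \<psi> x * U t x)"
    unfolding set_integrable_def by (simp only:)
  fix \<theta> \<theta>' c d
  assume \<theta>: "\<And>t. (\<theta> has_field_derivative \<theta>' t) (at t)" "continuous_on UNIV \<theta>'" "a < c" "c < d" "d < b"
    and off: "\<And>t. t \<notin> {c..d} \<Longrightarrow> \<theta> t = 0 \<and> \<theta>' t = 0"
  have \<theta>_cont: "continuous_on UNIV \<theta>" using \<theta>(1) by (auto intro!: GDERIV_continuous_on)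
  have [measurable]: "\<theta> \<in> borel_measurable borel" "\<theta>' \<in> borel_measurable borel"
    using \<theta>_cont \<theta>(2) by (auto intro: borel_measurable_continuous_onI)
  have cd: "0 < c" "d < T" using \<theta> ab by auto
  obtain m' where m': "m' > 0" "\<And>t. \<bar>\<theta>' t\<bar> \<le> m'"
    using continuous_compact_support_bounded[OF \<theta>(2)] off by blast
  obtain m where m: "m > 0" "\<And>t. \<bar>\<theta> t\<bar> \<le> m"
    using continuous_compact_support_bounded[OF \<theta>_cont] off by blast
  obtain m3 where m3: "m3 > 0" "\<And>x. x \<in> \<Omega> \<Longrightarrow> norm (\<psi>' x) \<le> m3"
    using continuous_bounded_on_bounded[OF \<psi>(2) bounded_\<Omega>] by blast
  let ?A = "\<lambda>(t, x). \<theta>' t * \<psi> x * U t x" and ?B = "\<lambda>(t, x). \<bar>U t x\<bar> * \<theta> t * (\<psi>' x \<bullet> P t x)"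
  have A: "integrable (lborel \<Otimes>\<^sub>M lborel) ?A"
    using m'(2) cd off \<psi>_cont by (intro U_mult_integrable[where m=m' and c=c and d=d]) auto
  have B: "integrable (lborel \<Otimes>\<^sub>M lborel) ?B"
    using m(2) cd off m3(2) by (intro flux_mult_integrable[where F="\<lambda>t x. \<psi>' x" and m=m and c=c and d=d]) auto
  have "(LINT t:{a..b}|lborel. \<theta>' t * (LINT x|lborel. \<psi> x * U t x)) = (LINT t|lborel. LINT x|lborel. ?A (t, x))"
    unfolding set_lebesgue_integral_def
  proof (intro Bochner_Integration.integral_cong refl)
    fix t show "indicator {a..b} t *\<^sub>R (\<theta>' t * (LINT x|lborel. \<psi> x * U t x)) = (LINT x|lborel. ?A (t, x))"
      using off[of t] \<theta>(3-5) by (cases "t \<in> {a..b}") (auto simp: mult.assoc)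
  qed
  also have "\<dots> = integral\<^sup>L (lborel \<Otimes>\<^sub>M lborel) ?A" by (rule lborel_pair.integral_fst'[OF A])
  also have "\<dots> = integral\<^sup>L (lborel \<Otimes>\<^sub>M lborel) ?B"
    using \<psi> \<theta>(1,2) cd off by (intro weak_identity) auto
  also have "\<dots> = (LINT t|lborel. LINT x|lborel. ?B (t, x))" by (rule lborel_pair.integral_fst'[OF B, symmetric])
  also have "\<dots> = (LINT t:{a..b}|lborel. \<theta> t * flux \<psi>' t)"
    unfolding set_lebesgue_integral_def
  proof (intro Bochner_Integration.integral_cong refl)
    fix t
    have "(LINT x|lborel. ?B (t, x)) = (LINT x|lborel. \<theta> t * (\<bar>U t x\<bar> * (\<psi>' x \<bullet> P t x)))"
      by (simp add: mult_ac)
    also have "\<dots> = \<theta> t * flux \<psi>' t" unfolding flux_def by (rule integral_mult_right_zero)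
    finally show "(LINT x|lborel. ?B (t, x)) = indicator {a..b} t *\<^sub>R (\<theta> t * flux \<psi>' t)"
      using off[of t] \<theta>(3-5) by (cases "t \<in> {a..b}") auto
  qed
  finally show "(LINT t:{a..b}|lborel. \<theta>' t * (LINT x|lborel. \<psi> x * U t x)) = (LINT t:{a..b}|lborel. \<theta> t * flux \<psi>' t)" .
qed

end

section \<open>Decay of the energy on a compact time interval\<close>

lemma set_integral_Icc_diff:
  fixes f :: "real \<Rightarrow> real"
  assumes "set_integrable lborel {a..b} f" "a \<le> s" "s \<le> t" "t \<le> b"
  shows "(LINT r:{a..t}|lborel. f r) - (LINT r:{a..s}|lborel. f r) = (LINT r:{s..t}|lborel. f r)"
proof -
  have si: "set_integrable lborel {p..q} f" if "a \<le> p" "q \<le> b" for p q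
    using assms(1) that by (auto intro: set_integrable_subset)
  note eq = set_borel_integral_eq_integral[OF si]
  show ?thesis
    using assms Henstock_Kurzweil_Integration.integral_combine[OF assms(2,3) eq(1)[of a t]]
    by (simp add: eq(2))
qed

context borel_weak_solution begin

lemma k_diff_cont: "continuous_on UNIV (\<lambda>z. k (y - z))"
  by (intro continuous_on_compose2[OF k] continuous_intros) auto

lemma P_cont: "continuous_on UNIV (P t)"
  unfolding potential_grad_def[abs_def]
  using R_int[of t] bounded_\<Omega> R_out
  by (intro continuous_on_integral_kernel[where B=\<Omega>])
    (auto simp: case_prod_beta intro!: continuous_intros continuous_on_compose2[OF k])

definition flux_mass :: "real \<Rightarrow> real" where
  "flux_mass s = (LINT z|lborel. \<bar>U s z\<bar> * norm (P s z))"

lemma U_P_int: "integrable lborel (\<lambda>z. \<bar>U s z\<bar> * norm (P s z))"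
proof (rule Bochner_Integration.integrable_bound)
  show "integrable lborel (\<lambda>z. \<bar>U s z\<bar> * P_max s)"
    by (intro integrable_mult_left integrable_abs U_slice)
  show "AE z in lborel. norm (\<bar>U s z\<bar> * norm (P s z)) \<le> norm (\<bar>U s z\<bar> * P_max s)"
  proof (intro AE_I2)
    fix z show "norm (\<bar>U s z\<bar> * norm (P s z)) \<le> norm (\<bar>U s z\<bar> * P_max s)"
    proof (cases "z \<in> \<Omega>")
      case True
      have "\<bar>U s z\<bar> * norm (P s z) \<le> \<bar>U s z\<bar> * P_max s"
        unfolding P_max_def by (intro mult_left_mono P_bound True abs_ge_zero)
      then show ?thesis using P_max_nonneg[of s] by (simp add: abs_mult)
    qed (simp add: U_out)
  qed
qed measurable

lemma flux_mass_set_integrable: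
  assumes "0 < a" "b < T" shows "set_integrable lborel {a..b} flux_mass"
proof -
  have "integrable lborel (\<lambda>t. LINT z|lborel. (case (t, z) of (t, z) \<Rightarrow> indicator {a..b} t * (\<bar>U t z\<bar> * norm (P t z))))"
    using flux_integrable[OF assms] by (rule lborel_pair.integrable_fst')
  then show ?thesis
    unfolding set_integrable_def by (simp add: flux_mass_def)
qed

lemma flux_prod_integral:
  assumes "0 < a" "b < T" and F: "continuous_on UNIV F"
  shows "(LINT p|(lborel \<Otimes>\<^sub>M lborel). (\<lambda>(t, z). \<bar>U t z\<bar> * indicator {a..b} t * (F z \<bullet> P t z)) p)
    = (LINT t:{a..b}|lborel. flux F t)"
proof -
  have "(LINT z|lborel. (\<lambda>(t, z). \<bar>U t z\<bar> * indicator {a..b} t * (F z \<bullet> P t z)) (t, z)) = indicator {a..b} t *\<^sub>R flux F t" for t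
    by (cases "t \<in> {a..b}") (simp_all add: flux_def)
  then show ?thesis
    using lborel_pair.integral_fst'[OF flux_set_integrable(1)[OF assms]]
    unfolding set_lebesgue_integral_def by (simp only:)
qed

lemma abs_flux_le:
  assumes F: "continuous_on UNIV F" and m: "\<And>z. z \<in> \<Omega> \<Longrightarrow> norm (F z) \<le> m"
  shows "\<bar>flux F s\<bar> \<le> m * flux_mass s"
proof -
  have [measurable]: "F \<in> borel_measurable borel" using F by (rule borel_measurable_continuous_onI)
  have "\<bar>flux F s\<bar> \<le> (LINT z|lborel. m * (\<bar>U s z\<bar> * norm (P s z)))"
    unfolding flux_def
  proof (rule order_trans[OF integral_abs_bound], rule integral_mono_AE')
    show "integrable lborel (\<lambda>z. m * (\<bar>U s z\<bar> * norm (P s z)))"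
      by (intro integrable_mult_right U_P_int)
    have bd: "\<bar>\<bar>U s z\<bar> * (F z \<bullet> P s z)\<bar> \<le> m * (\<bar>U s z\<bar> * norm (P s z))" for z
    proof (cases "z \<in> \<Omega>")
      case True
      have "\<bar>F z \<bullet> P s z\<bar> \<le> m * norm (P s z)"
        by (rule order_trans[OF Cauchy_Schwarz_ineq2]) (intro mult_right_mono m True norm_ge_zero)
      then have "\<bar>U s z\<bar> * \<bar>F z \<bullet> P s z\<bar> \<le> \<bar>U s z\<bar> * (m * norm (P s z))"
        by (intro mult_left_mono) auto
      then show ?thesis by (simp add: abs_mult mult_ac)
    qed (simp add: U_out)
    show "AE z in lborel. \<bar>\<bar>U s z\<bar> * (F z \<bullet> P s z)\<bar> \<le> m * (\<bar>U s z\<bar> * norm (P s z))"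
      using bd by (intro AE_I2)
    show "AE z in lborel. 0 \<le> m * (\<bar>U s z\<bar> * norm (P s z))"
      by (intro AE_I2 order_trans[OF abs_ge_zero bd])
  qed
  then show ?thesis by (simp add: flux_mass_def)
qed

text \<open>The null set from \<open>moment_identity\<close> depends on the test function. Using it for \<open>K(y - \<cdot>)\<close> with \<open>y\<close> in a
countable dense set leaves one null set, and both sides are continuous in \<open>y\<close>.\<close>

lemma w_increment:
  assumes ab: "0 < a" "a < b" "b < T"
  obtains N where "N \<in> null_sets lebesgue"
    "\<And>t1 t2 y. t1 \<in> {a..b} - N \<Longrightarrow> t2 \<in> {a..b} - N \<Longrightarrow> t1 \<le> t2 \<Longrightarrow>
      w t2 y - w t1 y = (LINT s:{t1..t2}|lborel. flux (\<lambda>z. k (y - z)) s)"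
proof -
  obtain Y :: "'a set" where Y: "countable Y" "\<And>X. open X \<Longrightarrow> X \<noteq> {} \<Longrightarrow> \<exists>d\<in>Y. d \<in> X"
    using countable_dense_setE by blast
  have minus: "flux (\<lambda>z. - k (y - z)) s = - flux (\<lambda>z. k (y - z)) s" for y s
    by (simp add: flux_def)
  have "\<exists>m. AE t in lborel. t \<in> {a..b} \<longrightarrow> w t y = m - (LINT s:{a..t}|lborel. flux (\<lambda>z. - k (y - z)) s)" for y
    unfolding conv_def
    by (rule moment_identity[OF GDERIV_reflect[OF K] _ ab]) (intro continuous_intros k_diff_cont)
  then obtain m where m: "\<And>y. AE t in lborel. t \<in> {a..b} \<longrightarrow> w t y = m y - (LINT s:{a..t}|lborel. flux (\<lambda>z. - k (y - z)) s)"
    by metis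
  have "AE t in lborel. \<forall>y\<in>Y. t \<in> {a..b} \<longrightarrow> w t y = m y - (LINT s:{a..t}|lborel. flux (\<lambda>z. - k (y - z)) s)"
    using m Y(1) by (subst AE_ball_countable) auto
  then obtain N where N: "N \<in> null_sets lborel"
      "\<And>t y. t \<notin> N \<Longrightarrow> y \<in> Y \<Longrightarrow> t \<in> {a..b} \<Longrightarrow> w t y = m y - (LINT s:{a..t}|lborel. flux (\<lambda>z. - k (y - z)) s)"
    by (elim AE_E3) auto
  show ?thesis
  proof (rule that)
    show "N \<in> null_sets lebesgue" using N(1) by (rule null_sets_completionI)
    fix t1 t2 y assume t: "t1 \<in> {a..b} - N" "t2 \<in> {a..b} - N" "t1 \<le> t2"
    have t': "0 < t1" "t2 < T" using t ab by auto
    have on_Y: "w t2 y - w t1 y = (LINT s:{t1..t2}|lborel. flux (\<lambda>z. k (y - z)) s)" if "y \<in> Y" for y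
    proof -
      have "set_integrable lborel {a..b} (flux (\<lambda>z. - k (y - z)))"
        using ab by (intro flux_set_integrable continuous_intros k_diff_cont) auto
      from set_integral_Icc_diff[OF this, of t1 t2]
      have "w t2 y - w t1 y = - (LINT s:{t1..t2}|lborel. flux (\<lambda>z. - k (y - z)) s)"
        using N(2)[OF _ that, of t1] N(2)[OF _ that, of t2] t by simp
      then show ?thesis unfolding minus by (simp add: set_lebesgue_integral_def)
    qed
    \<comment> \<open>The integrand is written as an integrable density times a bounded kernel, continuous in \<open>y\<close>.\<close>
    let ?g = "\<lambda>(t, z). indicator {t1..t2} t * (\<bar>U t z\<bar> * norm (P t z))"
    let ?\<kappa> = "\<lambda>p y. k (y - snd p) \<bullet> sgn (P (fst p) (snd p))"
    have "continuous_on UNIV (\<lambda>y. LINT p|(lborel \<Otimes>\<^sub>M lborel). ?g p *\<^sub>R ?\<kappa> p y)"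
    proof (rule continuous_on_parameter_integral)
      show "integrable (lborel \<Otimes>\<^sub>M lborel) ?g" using t' by (rule flux_integrable)
      show "(\<lambda>p. ?\<kappa> p y) \<in> borel_measurable (lborel \<Otimes>\<^sub>M lborel)" for y
        unfolding sgn_div_norm by measurable
      show "continuous_on UNIV (?\<kappa> p)" for p
        by (intro continuous_intros continuous_on_compose2[OF k]) auto
      fix B :: "'a set" assume "bounded B"
      then have "bounded ((\<lambda>(x, y). x - y) ` (B \<times> \<Omega>))"
        using bounded_minus[OF _ bounded_\<Omega>, of B] by (simp add: image_def case_prod_beta Bex_def)
      then obtain c where c: "c > 0" "\<And>x. x \<in> (\<lambda>(x, y). x - y) ` (B \<times> \<Omega>) \<Longrightarrow> norm (k x) \<le> c"
        using continuous_bounded_on_bounded[OF k] by blast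
      have "norm (?\<kappa> p y) \<le> c" if "?g p \<noteq> 0" "y \<in> B" for p y
      proof -
        have "snd p \<in> \<Omega>" using that(1) U_out[of "snd p" "fst p"] by (cases "snd p \<in> \<Omega>") (auto simp: case_prod_beta)
        then have "norm (k (y - snd p)) \<le> c" using that(2) by (intro c(2)) (auto intro!: image_eqI[of _ _ "(y, snd p)"])
        moreover have "norm (sgn (P (fst p) (snd p))) \<le> 1" by (simp add: norm_sgn)
        ultimately have "norm (k (y - snd p)) * norm (sgn (P (fst p) (snd p))) \<le> c * 1"
          using c(1) by (intro mult_mono) auto
        then show ?thesis using Cauchy_Schwarz_ineq2[of "k (y - snd p)" "sgn (P (fst p) (snd p))"] by simp
      qed
      then show "\<exists>c. \<forall>p. ?g p \<noteq> 0 \<longrightarrow> (\<forall>y\<in>B. norm (?\<kappa> p y) \<le> c)" by blast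
    qed
    moreover have "(LINT p|(lborel \<Otimes>\<^sub>M lborel). ?g p *\<^sub>R ?\<kappa> p y) = (LINT s:{t1..t2}|lborel. flux (\<lambda>z. k (y - z)) s)" for y
      unfolding flux_prod_integral[OF t' k_diff_cont, symmetric]
    proof (intro Bochner_Integration.integral_cong refl)
      fix p :: "real \<times> 'a"
      have "v \<bullet> P (fst p) (snd p) = norm (P (fst p) (snd p)) * (v \<bullet> sgn (P (fst p) (snd p)))" for v
        by (cases "P (fst p) (snd p) = 0") (simp_all add: sgn_div_norm)
      then show "?g p *\<^sub>R ?\<kappa> p y = (case p of (t, z) \<Rightarrow> \<bar>U t z\<bar> * indicator {t1..t2} t * (k (y - z) \<bullet> P t z))"
        by (simp add: case_prod_beta)
    qed
    ultimately have cR: "continuous_on UNIV (\<lambda>y. LINT s:{t1..t2}|lborel. flux (\<lambda>z. k (y - z)) s)" by (simp only:)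
    have cL: "continuous_on UNIV (\<lambda>y. w t2 y - w t1 y)" by (intro continuous_intros w_cont)
    have "open {y. w t2 y - w t1 y \<noteq> (LINT s:{t1..t2}|lborel. flux (\<lambda>z. k (y - z)) s)}"
      by (intro open_Collect_neq cL cR)
    then have "{y. w t2 y - w t1 y \<noteq> (LINT s:{t1..t2}|lborel. flux (\<lambda>z. k (y - z)) s)} = {}"
      using Y(2) on_Y by blast
    then show "w t2 y - w t1 y = (LINT s:{t1..t2}|lborel. flux (\<lambda>z. k (y - z)) s)" by blast
  qed
qed

lemma set_integral_abs_flux_le:
  assumes "0 < t1" "t2 < T" and F: "continuous_on UNIV F" and m: "\<And>z. z \<in> \<Omega> \<Longrightarrow> norm (F z) \<le> m"
  shows "\<bar>LINT s:{t1..t2}|lborel. flux F s\<bar> \<le> m * (LINT s:{t1..t2}|lborel. flux_mass s)"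
proof -
  have "\<bar>LINT s:{t1..t2}|lborel. flux F s\<bar> \<le> (LINT s:{t1..t2}|lborel. \<bar>flux F s\<bar>)"
    unfolding set_lebesgue_integral_def using integral_abs_bound[of lborel "\<lambda>s. indicator {t1..t2} s *\<^sub>R flux F s"]
    by (simp add: abs_mult)
  also have "\<dots> \<le> (LINT s:{t1..t2}|lborel. m * flux_mass s)"
    using assms by (intro set_integral_mono set_integrable_abs flux_set_integrable(2) set_integrable_mult_right flux_mass_set_integrable
        abs_flux_le) auto
  finally show ?thesis by simp
qed

text \<open>The part of \<open>H\<close> that comes from \<open>S\<close>; the rest of \<open>\<Omega>\<close> contributes a constant.\<close>

definition energy :: "real \<Rightarrow> real" where
  "energy t = 1/2 * (LINT x|lborel. (R t x)\<^sup>2)"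

lemma R_sq_int: "integrable lborel (\<lambda>x. (R t x)\<^sup>2)"
proof (rule Bochner_Integration.integrable_bound)
  show "integrable lborel (\<lambda>x. indicator \<Omega> x * (2 * (M * mass t)\<^sup>2) + 2 * (\<phi> x)\<^sup>2)"
    by (intro Bochner_Integration.integrable_add integrable_mult_left integrable_mult_right ind_\<Omega>_int \<phi>_sq)
  show "AE x in lborel. norm ((R t x)\<^sup>2) \<le> norm (indicator \<Omega> x * (2 * (M * mass t)\<^sup>2) + 2 * (\<phi> x)\<^sup>2)"
  proof (intro AE_I2)
    fix x
    have "(R t x)\<^sup>2 \<le> indicator \<Omega> x * (2 * (M * mass t)\<^sup>2) + 2 * (\<phi> x)\<^sup>2"
    proof (cases "x \<in> \<Omega>")
      case True
      have "\<bar>R t x\<bar>\<^sup>2 \<le> (M * mass t + \<bar>\<phi> x\<bar>)\<^sup>2"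
        using R_bound[of t x] True by (intro power_mono) auto
      also have "\<dots> \<le> 2 * (M * mass t)\<^sup>2 + 2 * (\<phi> x)\<^sup>2"
        using sum_squares_bound[of "M * mass t" "\<bar>\<phi> x\<bar>"] by (simp add: power2_sum)
      finally show ?thesis using True by simp
    qed (simp add: R_out)
    then show "norm ((R t x)\<^sup>2) \<le> norm (indicator \<Omega> x * (2 * (M * mass t)\<^sup>2) + 2 * (\<phi> x)\<^sup>2)" by simp
  qed
qed measurable

lemma \<sigma>_R: "\<sigma> x * R t x = R t x"
  using \<sigma>_01[of x] \<sigma>_\<phi>[of x] by (auto simp: residual_def algebra_simps)

lemma integrable_scaleR_k:
  assumes f: "integrable lborel f" "\<And>x. x \<notin> \<Omega> \<Longrightarrow> f x = 0" and z: "z \<in> \<Omega>"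
  shows "integrable lborel (\<lambda>x. f x *\<^sub>R k (x - z))"
proof (rule Bochner_Integration.integrable_bound[OF integrable_mult_right[OF f(1), of M]])
  have [measurable]: "f \<in> borel_measurable borel" using f(1) by auto
  show "(\<lambda>x. f x *\<^sub>R k (x - z)) \<in> borel_measurable lborel" by measurable
  show "AE x in lborel. norm (f x *\<^sub>R k (x - z)) \<le> norm (M * f x)"
  proof (intro AE_I2)
    fix x show "norm (f x *\<^sub>R k (x - z)) \<le> norm (M * f x)"
      using M(1) M(3)[OF _ z, of x] f(2)[of x] mult_right_mono_on[of x \<Omega> "norm (k (x - z))" M "\<bar>f x\<bar>"]
      by (simp add: abs_mult mult.commute)
  qed
qed

text \<open>The increment of the square of the residual is its sum at the two times multiplied by the increment of \<open>w\<close>.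
Exchanging the integration over \<open>x\<close> with that over space-time turns the sum of the two residuals,
integrated against \<open>\<nabla>K\<close>, into minus the sum of the two potential gradients.\<close>

lemma energy_increment:
  assumes t: "0 < t1" "t1 \<le> t2" "t2 < T"
    and inc: "\<And>y. w t2 y - w t1 y = (LINT s:{t1..t2}|lborel. flux (\<lambda>z. k (y - z)) s)"
  shows "energy t2 - energy t1 = - 1/2 * (LINT s:{t1..t2}|lborel. flux (\<lambda>z. P t1 z + P t2 z) s)"
proof -
  define V where "V x = R t1 x + R t2 x" for x
  have V: "integrable lborel V" unfolding V_def[abs_def] by (intro Bochner_Integration.integrable_add R_int)
  have V_out: "V x = 0" if "x \<notin> \<Omega>" for x using R_out[OF that] by (simp add: V_def)
  have [measurable]: "V \<in> borel_measurable borel" using V by auto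
  let ?M = "lborel \<Otimes>\<^sub>M lborel :: (real \<times> 'a) measure"
  define G where "G = (\<lambda>(s, z). indicator {t1..t2} s * (\<bar>U s z\<bar> * norm (P s z)))"
  have G: "integrable ?M G" unfolding G_def using t(1,3) by (rule flux_integrable)
  have [measurable]: "G \<in> borel_measurable ?M" using G by auto
  define f where "f x = (\<lambda>(s, z). \<bar>U s z\<bar> * indicator {t1..t2} s * (k (x - z) \<bullet> P s z))" for x
  have f_bd: "\<bar>V x * f x p\<bar> \<le> M * \<bar>V x * G p\<bar>" for x p
  proof (cases "x \<in> \<Omega> \<and> snd p \<in> \<Omega>")
    case True
    have "\<bar>k (x - snd p) \<bullet> P (fst p) (snd p)\<bar> \<le> M * norm (P (fst p) (snd p))"
      using True by (intro order_trans[OF Cauchy_Schwarz_ineq2] mult_right_mono M(3)) auto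
    then have "\<bar>V x\<bar> * (\<bar>U (fst p) (snd p)\<bar> * indicator {t1..t2} (fst p)) * \<bar>k (x - snd p) \<bullet> P (fst p) (snd p)\<bar>
        \<le> \<bar>V x\<bar> * (\<bar>U (fst p) (snd p)\<bar> * indicator {t1..t2} (fst p)) * (M * norm (P (fst p) (snd p)))"
      by (intro mult_left_mono) auto
    then show ?thesis by (simp add: f_def G_def case_prod_beta abs_mult mult_ac)
  next
    case False
    then have z: "V x * f x p = 0" using V_out U_out by (auto simp: f_def case_prod_beta)
    show ?thesis unfolding z using M(1) by simp
  qed
  interpret L3: pair_sigma_finite "lborel :: 'a measure" ?M
    unfolding lborel_prod ..
  have VG: "integrable (lborel \<Otimes>\<^sub>M ?M) (\<lambda>(x, p). V x * G p)"
    using V G by (intro L3.Fubini_integrable) (auto simp: abs_mult)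
  have Vf: "integrable (lborel \<Otimes>\<^sub>M ?M) (\<lambda>(x, p). V x * f x p)"
  proof (rule Bochner_Integration.integrable_bound[OF integrable_mult_right[OF VG, of M]])
    show "(\<lambda>(x, p). V x * f x p) \<in> borel_measurable (lborel \<Otimes>\<^sub>M ?M)"
      unfolding f_def by measurable
    show "AE q in lborel \<Otimes>\<^sub>M ?M. norm (case q of (x, p) \<Rightarrow> V x * f x p) \<le> norm (M * (case q of (x, p) \<Rightarrow> V x * G p))"
      using f_bd M(1) by (intro AE_I2) (simp add: case_prod_beta abs_mult)
  qed
  have cont: "continuous_on UNIV (\<lambda>z. P t1 z + P t2 z)" by (intro continuous_intros P_cont)
  have "energy t2 - energy t1 = 1/2 * (LINT x|lborel. (R t2 x)\<^sup>2 - (R t1 x)\<^sup>2)"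
    unfolding energy_def by (subst Bochner_Integration.integral_diff[OF R_sq_int R_sq_int]) simp
  also have "(LINT x|lborel. (R t2 x)\<^sup>2 - (R t1 x)\<^sup>2) = (LINT x|lborel. LINT p|?M. V x * f x p)"
  proof (intro Bochner_Integration.integral_cong refl)
    fix x
    have "(R t2 x)\<^sup>2 - (R t1 x)\<^sup>2 = V x * (R t2 x - R t1 x)" by (simp add: V_def power2_eq_square algebra_simps)
    also have "R t2 x - R t1 x = \<sigma> x * (w t2 x - w t1 x)" by (simp add: residual_def algebra_simps)
    also have "V x * (\<sigma> x * (w t2 x - w t1 x)) = V x * (w t2 x - w t1 x)"
    proof -
      have "V x * \<sigma> x = V x"
        by (simp only: V_def mult.commute[of _ "\<sigma> x"] distrib_left \<sigma>_R)
      then show ?thesis by (simp only: mult.assoc[symmetric])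
    qed
    also have "w t2 x - w t1 x = (LINT p|?M. f x p)"
      unfolding inc f_def by (rule flux_prod_integral[OF t(1,3) k_diff_cont, symmetric])
    finally show "(R t2 x)\<^sup>2 - (R t1 x)\<^sup>2 = (LINT p|?M. V x * f x p)" by simp
  qed
  also have "\<dots> = (LINT p|?M. LINT x|lborel. V x * f x p)"
    by (rule L3.Fubini_integral[OF Vf, symmetric])
  also have "\<dots> = (LINT p|?M. - (\<lambda>(s, z). \<bar>U s z\<bar> * indicator {t1..t2} s * ((P t1 z + P t2 z) \<bullet> P s z)) p)"
  proof (intro Bochner_Integration.integral_cong refl)
    fix p :: "real \<times> 'a"
    obtain s z where p: "p = (s, z)" by (cases p)
    show "(LINT x|lborel. V x * f x p) = - (\<lambda>(s, z). \<bar>U s z\<bar> * indicator {t1..t2} s * ((P t1 z + P t2 z) \<bullet> P s z)) p"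
    proof (cases "z \<in> \<Omega>")
      case True
      note iR = integrable_scaleR_k[OF R_int R_out True]
      have iV: "integrable lborel (\<lambda>x. V x *\<^sub>R k (x - z))"
        using V V_out True by (rule integrable_scaleR_k)
      have PV: "(LINT x|lborel. V x *\<^sub>R k (x - z)) = - (P t1 z + P t2 z)"
        unfolding V_def potential_grad_def scaleR_left_distrib scaleR_minus_left
        by (simp add: Bochner_Integration.integral_add[OF iR iR])
      have "(LINT x|lborel. V x * f x p) = (LINT x|lborel. (\<bar>U s z\<bar> * indicator {t1..t2} s) * ((V x *\<^sub>R k (x - z)) \<bullet> P s z))"
        by (intro Bochner_Integration.integral_cong refl) (simp add: p f_def mult_ac)
      also have "\<dots> = (\<bar>U s z\<bar> * indicator {t1..t2} s) * ((LINT x|lborel. V x *\<^sub>R k (x - z)) \<bullet> P s z)"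
        unfolding integral_mult_right_zero integral_inner_left[OF iV] ..
      finally show ?thesis unfolding PV inner_minus_left by (simp only: p prod.case mult_minus_right)
    next
      case False
      have z: "V x * f x p = 0" for x using U_out[OF False] by (simp add: p f_def)
      show ?thesis unfolding z using U_out[OF False] by (simp add: p)
    qed
  qed
  also have "\<dots> = - (LINT s:{t1..t2}|lborel. flux (\<lambda>z. P t1 z + P t2 z) s)"
    unfolding flux_prod_integral[OF t(1,3) cont, symmetric] by (rule integral_minus)
  finally show ?thesis by simp
qed

lemma P_increment:
  assumes t: "0 < t1" "t1 \<le> t2" "t2 < T"
    and inc: "\<And>y. w t2 y - w t1 y = (LINT s:{t1..t2}|lborel. flux (\<lambda>z. k (y - z)) s)"
    and z: "z \<in> \<Omega>"
  shows "norm (P t2 z - P t1 z) \<le> M * (vol * M) * (LINT s:{t1..t2}|lborel. flux_mass s)"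
proof -
  define q where "q = (LINT s:{t1..t2}|lborel. flux_mass s)"
  note iR = integrable_scaleR_k[OF R_int R_out z]
  have dR: "integrable lborel (\<lambda>x. R t1 x - R t2 x)" by (intro Bochner_Integration.integrable_diff R_int)
  have "P t2 z - P t1 z = (LINT x|lborel. (R t1 x - R t2 x) *\<^sub>R k (x - z))"
    unfolding potential_grad_def scaleR_minus_left scaleR_left_diff_distrib
    by (simp add: Bochner_Integration.integral_diff[OF iR iR])
  then have "norm (P t2 z - P t1 z) \<le> M * (LINT x|lborel. \<bar>R t1 x - R t2 x\<bar>)"
    using norm_integral_R_k_le[OF dR _ z] R_out by simp
  also have "(LINT x|lborel. \<bar>R t1 x - R t2 x\<bar>) \<le> (LINT x|lborel. indicator \<Omega> x * (M * q))"
  proof (rule integral_mono)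
    show "integrable lborel (\<lambda>x. \<bar>R t1 x - R t2 x\<bar>)" using dR by (rule integrable_abs)
    show "integrable lborel (\<lambda>x. indicator \<Omega> x * (M * q))" by (intro integrable_mult_left ind_\<Omega>_int)
    fix x
    show "\<bar>R t1 x - R t2 x\<bar> \<le> indicator \<Omega> x * (M * q)"
    proof (cases "x \<in> \<Omega>")
      case True
      have "\<bar>w t2 x - w t1 x\<bar> \<le> M * q"
        unfolding inc q_def using M(3)[OF True] by (intro set_integral_abs_flux_le t k_diff_cont) auto
      moreover have "\<bar>R t1 x - R t2 x\<bar> \<le> \<bar>w t2 x - w t1 x\<bar>"
        using \<sigma>_01[of x] by (auto simp: residual_def)
      ultimately show ?thesis using True by simp
    qed (simp add: R_out)
  qed
  also have "\<dots> = vol * (M * q)" by (simp add: vol_def)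
  finally show ?thesis using M(1) by (simp add: q_def mult.assoc)
qed

text \<open>The bound on \<open>w\<close> off the null set is a by-product that later provides the dominating function for the
continuity of \<open>H\<close> in time.\<close>

theorem energy_decay_slab:
  assumes ab: "0 < a" "a < b" "b < T"
  obtains N B where "N \<in> null_sets lebesgue"
    "\<And>t1 t2. t1 \<in> {a..b} - N \<Longrightarrow> t2 \<in> {a..b} - N \<Longrightarrow> t1 \<le> t2 \<Longrightarrow> energy t2 \<le> energy t1"
    "\<And>t x. t \<in> {a..b} - N \<Longrightarrow> x \<in> \<Omega> \<Longrightarrow> \<bar>w t x\<bar> \<le> B"
proof -
  obtain N where N: "N \<in> null_sets lebesgue" and inc: "\<And>t1 t2 y. t1 \<in> {a..b} - N \<Longrightarrow> t2 \<in> {a..b} - N \<Longrightarrow> t1 \<le> t2 \<Longrightarrow>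
      w t2 y - w t1 y = (LINT s:{t1..t2}|lborel. flux (\<lambda>z. k (y - z)) s)"
    using w_increment[OF ab] by blast
  define Q where "Q t = (LINT s:{a..t}|lborel. flux_mass s)" for t
  have sp: "set_integrable lborel {a..b} flux_mass" using ab by (intro flux_mass_set_integrable)
  have sp': "set_integrable lborel {s..t} flux_mass" if "a \<le> s" "t \<le> b" for s t
    using sp that by (auto intro: set_integrable_subset)
  have Q_diff: "Q t - Q s = (LINT r:{s..t}|lborel. flux_mass r)" if "a \<le> s" "s \<le> t" "t \<le> b" for s t
    unfolding Q_def using set_integral_Icc_diff[OF sp that] .
  have sp0: "0 \<le> flux_mass s" for s unfolding flux_mass_def by (intro Bochner_Integration.integral_nonneg) auto
  have Q_mono: "Q s \<le> Q t" if "a \<le> s" "s \<le> t" "t \<le> b" for s t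
  proof -
    have "0 \<le> (LINT r:{s..t}|lborel. flux_mass r)"
      unfolding set_lebesgue_integral_def using sp0 by (intro Bochner_Integration.integral_nonneg) auto
    then show ?thesis using Q_diff[OF that] by simp
  qed
  have Q_cont: "continuous_on {a..b} Q"
  proof -
    have "continuous_on {a..b} (\<lambda>t. integral {a..t} flux_mass)"
      using set_borel_integral_eq_integral(1)[OF sp] by (rule indefinite_integral_continuous_1)
    moreover have "integral {a..t} flux_mass = Q t" if "t \<in> {a..b}" for t
      unfolding Q_def using set_borel_integral_eq_integral(2)[OF sp'[of a t]] that by simp
    ultimately show ?thesis by (rule continuous_on_eq)
  qed
  define C where "C = M * (vol * M)"
  have C: "0 \<le> C" unfolding C_def using M(1) vol_nonneg by simp
  have quad: "energy t2 - energy t1 \<le> C * (Q t2 - Q t1)\<^sup>2"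
    if t: "t1 \<in> {a..b} - N" "t2 \<in> {a..b} - N" "t1 < t2" for t1 t2
  proof -
    have t': "0 < t1" "t1 \<le> t2" "t2 < T" "a \<le> t1" "t2 \<le> b" using t ab by auto
    define q where "q = Q t2 - Q t1"
    have cont: "continuous_on UNIV (\<lambda>z. P t1 z + P t2 z)" by (intro continuous_intros P_cont)
    have pw: "- 1/2 * flux (\<lambda>z. P t1 z + P t2 z) s \<le> (C * q) * flux_mass s" if s: "s \<in> {t1..t2} - N" for s
    proof -
      have s': "s \<in> {a..b} - N" "t1 \<le> s" "s \<le> t2" "0 < s" "s < T" using s t' by auto
      have d: "norm (P s z - P t1 z) \<le> C * q" "norm (P t2 z - P s z) \<le> C * q" if z: "z \<in> \<Omega>" for z
      proof -
        have "norm (P s z - P t1 z) \<le> C * (Q s - Q t1)"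
          unfolding C_def using P_increment[OF t'(1) s'(2,5) inc[OF t(1) s'(1,2)] z] Q_diff[of t1 s] s' t' by simp
        also have "\<dots> \<le> C * q" using C Q_mono[of s t2] s' t' by (intro mult_left_mono) (auto simp: q_def)
        finally show "norm (P s z - P t1 z) \<le> C * q" .
        have "norm (P t2 z - P s z) \<le> C * (Q t2 - Q s)"
          unfolding C_def using P_increment[OF s'(4,3) t'(3) inc[OF s'(1) t(2) s'(3)] z] Q_diff[of s t2] s' t' by simp
        also have "\<dots> \<le> C * q" using C Q_mono[of t1 s] s' t' by (intro mult_left_mono) (auto simp: q_def)
        finally show "norm (P t2 z - P s z) \<le> C * q" .
      qed
      have "- 1/2 * flux (\<lambda>z. P t1 z + P t2 z) s = (LINT z|lborel. - 1/2 * (\<bar>U s z\<bar> * ((P t1 z + P t2 z) \<bullet> P s z)))"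
        unfolding flux_def by simp
      also have "\<dots> \<le> (LINT z|lborel. (C * q) * (\<bar>U s z\<bar> * norm (P s z)))"
      proof (rule integral_mono_AE')
        show "integrable lborel (\<lambda>z. (C * q) * (\<bar>U s z\<bar> * norm (P s z)))" by (intro integrable_mult_right U_P_int)
        have "- 1/2 * (\<bar>U s z\<bar> * ((P t1 z + P t2 z) \<bullet> P s z)) \<le> (C * q) * (\<bar>U s z\<bar> * norm (P s z))" for z
        proof (cases "z \<in> \<Omega>")
          case True
          \<comment> \<open>Comparison of both gradients with the one at the intermediate time \<open>s\<close>.\<close>
          have "- 1/2 * ((P t1 z + P t2 z) \<bullet> P s z) = 1/2 * ((P s z - P t1 z) \<bullet> P s z) - 1/2 * ((P t2 z - P s z) \<bullet> P s z) - P s z \<bullet> P s z"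
            by (simp add: algebra_simps inner_add_left inner_diff_left)
          also have "\<dots> \<le> 1/2 * (C * q * norm (P s z)) + 1/2 * (C * q * norm (P s z)) - 0"
          proof -
            have "(P s z - P t1 z) \<bullet> P s z \<le> C * q * norm (P s z)"
              by (rule order_trans[OF norm_cauchy_schwarz]) (intro mult_right_mono d True norm_ge_zero)
            moreover have "- ((P t2 z - P s z) \<bullet> P s z) \<le> C * q * norm (P s z)"
              using Cauchy_Schwarz_ineq2[of "P t2 z - P s z" "P s z"] mult_right_mono[OF d(2)[OF True] norm_ge_zero[of "P s z"]]
              by linarith
            ultimately show ?thesis using inner_ge_zero[of "P s z"] by linarith
          qed
          also have "\<dots> = C * q * norm (P s z)" by simp
          finally have "\<bar>U s z\<bar> * (- 1/2 * ((P t1 z + P t2 z) \<bullet> P s z)) \<le> \<bar>U s z\<bar> * (C * q * norm (P s z))"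
            by (intro mult_left_mono) auto
          then show ?thesis by (simp add: mult_ac)
        qed (simp add: U_out)
        then show "AE z in lborel. - 1/2 * (\<bar>U s z\<bar> * ((P t1 z + P t2 z) \<bullet> P s z)) \<le> (C * q) * (\<bar>U s z\<bar> * norm (P s z))"
          by (intro AE_I2)
        have "0 \<le> C * q" using C Q_mono[OF t'(4,2,5)] by (simp add: q_def)
        then show "AE z in lborel. 0 \<le> (C * q) * (\<bar>U s z\<bar> * norm (P s z))" by (intro AE_I2) simp
      qed
      finally show ?thesis by (simp add: flux_mass_def)
    qed
    have "energy t2 - energy t1 = (LINT s:{t1..t2}|lborel. - 1/2 * flux (\<lambda>z. P t1 z + P t2 z) s)"
      unfolding energy_increment[OF t'(1-3) inc[OF t(1,2) t'(2)]] by (rule set_integral_mult_right[symmetric])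
    also have "\<dots> \<le> (LINT s:{t1..t2}|lborel. (C * q) * flux_mass s)"
    proof (rule set_integral_mono_AE)
      show "set_integrable lborel {t1..t2} (\<lambda>s. - 1/2 * flux (\<lambda>z. P t1 z + P t2 z) s)"
        by (intro set_integrable_mult_right flux_set_integrable(2) t' cont)
      show "set_integrable lborel {t1..t2} (\<lambda>s. (C * q) * flux_mass s)"
        by (intro set_integrable_mult_right sp' t')
      have "AE s in lebesgue. s \<notin> N" using N by (rule AE_not_in)
      then have "AE s in lborel. s \<notin> N" by (simp add: AE_completion_iff)
      then show "AE s\<in>{t1..t2} in lborel. - 1/2 * flux (\<lambda>z. P t1 z + P t2 z) s \<le> (C * q) * flux_mass s"
        by eventually_elim (use pw in blast)
    qed
    also have "\<dots> = C * q * q" unfolding q_def Q_diff[OF t'(4,2,5)] by simp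
    finally show ?thesis by (simp add: q_def power2_eq_square mult.assoc)
  qed
  obtain t0 where t0: "a < t0" "t0 < b" "t0 \<notin> N" using null_set_avoid[OF N ab(2)] by blast
  show ?thesis
  proof (rule that[OF N])
    show "energy t2 \<le> energy t1" if "t1 \<in> {a..b} - N" "t2 \<in> {a..b} - N" "t1 \<le> t2" for t1 t2
      by (rule nonincreasing_if_quadratic_increments[OF N Q_cont Q_mono quad C that])
    fix t x assume t: "t \<in> {a..b} - N" and x: "x \<in> \<Omega>"
    have inc_bd: "\<bar>w r x - w s x\<bar> \<le> M * (Q b - Q a)" if "s \<in> {a..b} - N" "r \<in> {a..b} - N" "s \<le> r" for r s
    proof -
      have "\<bar>w r x - w s x\<bar> \<le> M * (Q r - Q s)"
        using that ab M(3)[OF x] Q_diff[of s r] set_integral_abs_flux_le[of s r "\<lambda>z. k (x - z)" M] k_diff_cont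
        by (simp add: inc)
      also have "\<dots> \<le> M * (Q b - Q a)"
        using that M(1) Q_mono[of r b] Q_mono[of a s] by (intro mult_left_mono) auto
      finally show ?thesis .
    qed
    have "\<bar>w t x - w t0 x\<bar> \<le> M * (Q b - Q a)"
      using inc_bd[of t t0] inc_bd[of t0 t] t t0 by (cases "t \<le> t0") (auto simp: abs_minus_commute)
    then show "\<bar>w t x\<bar> \<le> M * mass t0 + M * (Q b - Q a)"
      using w_bound[OF x, of t0] by linarith
  qed
qed

end

section \<open>Borel representatives of a weak solution\<close>

lemma
  fixes f g :: "'a::euclidean_space \<Rightarrow> real"
  assumes f: "f \<in> borel_measurable lebesgue" and g: "g \<in> borel_measurable borel" and eq: "AE x in lborel. f x = g x"
  shows integral_lebesgue_eq_lborel: "integral\<^sup>L lebesgue f = integral\<^sup>L lborel g"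
    and integrable_lebesgue_iff_lborel: "integrable lebesgue f \<longleftrightarrow> integrable lborel g"
proof -
  have g': "g \<in> borel_measurable lborel" "g \<in> borel_measurable lebesgue" using g by (auto intro: measurable_completion)
  have eq': "AE x in lebesgue. f x = g x" using eq by (rule AE_completion)
  show "integral\<^sup>L lebesgue f = integral\<^sup>L lborel g"
    using integral_cong_AE[OF f g'(2) eq'] integral_completion[OF g'(1)] by simp
  show "integrable lebesgue f \<longleftrightarrow> integrable lborel g"
    using integrable_cong_AE[OF f g'(2) eq'] integrable_completion[OF g'(1)] by simp
qed

lemma borel_measurable_lebesgueI:
  fixes f :: "'a::euclidean_space \<Rightarrow> 'b::topological_space"
  shows "f \<in> borel_measurable borel \<Longrightarrow> f \<in> borel_measurable lebesgue"
  by (rule measurable_completion) simp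

text \<open>The segment from a point of \<open>\<Omega>\<close> to a point of the complement meets the frontier. The distance to
the complement is the more convenient one, being Lipschitz on the whole space and positive exactly on \<open>\<Omega>\<close>.\<close>

lemma infdist_frontier_eq_infdist_compl:
  fixes \<Omega> :: "'a::euclidean_space set"
  assumes "open \<Omega>" "\<Omega> \<noteq> UNIV" "x \<in> \<Omega>"
  shows "infdist x (frontier \<Omega>) = infdist x (- \<Omega>)"
proof (rule antisym)
  have meets: "\<exists>z\<in>frontier \<Omega>. dist x z \<le> dist x y" if "y \<in> - \<Omega>" for y
  proof -
    have "closed_segment x y \<inter> frontier \<Omega> \<noteq> {}"
    proof (rule connected_Int_frontier)
      show "connected (closed_segment x y)" by (rule connected_segment)
      show "closed_segment x y \<inter> \<Omega> \<noteq> {}" using assms(3) by auto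
      show "closed_segment x y - \<Omega> \<noteq> {}" using that by auto
    qed
    then obtain z where "z \<in> closed_segment x y" "z \<in> frontier \<Omega>" by blast
    then show ?thesis using dist_in_closed_segment[of z x y] by (auto simp: dist_commute)
  qed
  have ne: "- \<Omega> \<noteq> {}" using assms(2) by auto
  show "infdist x (frontier \<Omega>) \<le> infdist x (- \<Omega>)"
    unfolding infdist_notempty[OF ne]
  proof (rule cINF_greatest[OF ne])
    fix y assume "y \<in> - \<Omega>"
    then obtain z where "z \<in> frontier \<Omega>" "dist x z \<le> dist x y" using meets by blast
    then show "infdist x (frontier \<Omega>) \<le> dist x y" by (rule infdist_le2)
  qed
  have "frontier \<Omega> \<noteq> {}" using meets ne by blast
  moreover have "frontier \<Omega> \<subseteq> - \<Omega>"
    using assms(1) by (auto simp: frontier_def interior_open)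
  ultimately show "infdist x (- \<Omega>) \<le> infdist x (frontier \<Omega>)" by (intro infdist_mono)
qed

lemma GDERIV_tensor:
  assumes "GDERIV \<psi> x :> \<psi>' x" "(\<theta> has_field_derivative \<theta>' t) (at t)"
  shows "GDERIV (\<lambda>(x, t). \<psi> x * \<theta> t) (x, t) :> (\<theta> t *\<^sub>R \<psi>' x, \<psi> x * \<theta>' t)"
proof -
  have 1: "((\<lambda>p. \<psi> (fst p)) has_derivative (\<lambda>h. fst h \<bullet> \<psi>' x)) (at (x, t))"
    using has_derivative_compose[of fst fst "(x, t)" UNIV \<psi> "\<lambda>h. h \<bullet> \<psi>' x"] assms(1)
    by (simp add: gderiv_def has_derivative_fst)
  have 2: "((\<lambda>p. \<theta> (snd p)) has_derivative (\<lambda>h. snd h * \<theta>' t)) (at (x, t))"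
  proof -
    have "(\<theta> has_derivative (\<lambda>h. h * \<theta>' t)) (at t)"
      using assms(2) by (simp add: has_field_derivative_def mult_commute_abs)
    then show ?thesis
      using has_derivative_compose[of snd snd "(x, t)" UNIV \<theta> "\<lambda>h. h * \<theta>' t"]
      by (simp add: has_derivative_snd)
  qed
  have "((\<lambda>p. \<psi> (fst p) * \<theta> (snd p)) has_derivative
     (\<lambda>h. \<psi> (fst (x, t)) * (snd h * \<theta>' t) + (fst h \<bullet> \<psi>' x) * \<theta> (snd (x, t)))) (at (x, t))"
    by (rule has_derivative_mult[OF 1 2])
  then show ?thesis
    unfolding gderiv_def by (simp add: case_prod_unfold inner_prod_def algebra_simps)
qed

text \<open>The hypotheses of the theorem, with the gradient \<open>k\<close> of the kernel made explicit.\<close>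

locale weak_problem =
  fixes \<Omega> S :: "'a::euclidean_space set" and T :: real
    and K f u0 :: "'a \<Rightarrow> real" and k :: "'a \<Rightarrow> 'a" and u :: "'a \<Rightarrow> real \<Rightarrow> real"
  assumes open_\<Omega>: "open \<Omega>" and bounded_\<Omega>: "bounded \<Omega>"
    and S: "S \<in> sets lebesgue" "S \<subseteq> \<Omega>" and T: "T > 0"
    and K: "\<And>x. GDERIV K x :> k x" and k: "continuous_on UNIV k"
    and f: "set_borel_measurable lebesgue \<Omega> f" "set_integrable lebesgue \<Omega> (\<lambda>x. (f x)\<^sup>2)"
    and sol: "weak_solution \<Omega> S T K f u0 u"
begin

text \<open>The extension of \<open>u\<close> by zero, which turns integrals over \<open>\<Omega>\<close> into integrals over the whole space.\<close>

definition u_ext :: "real \<Rightarrow> 'a \<Rightarrow> real" where "u_ext t x = indicator \<Omega> x * u x t"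

lemma u_ext_int: "t \<in> {0<..T} \<Longrightarrow> integrable lebesgue (u_ext t)"
  using sol unfolding weak_solution_def set_integrable_def by (auto simp: u_ext_def[abs_def])

lemma u_ext_out: "x \<notin> \<Omega> \<Longrightarrow> u_ext t x = 0" by (simp add: u_ext_def)

lemma \<Omega>_not_UNIV: "\<Omega> \<noteq> UNIV" using bounded_\<Omega> not_bounded_UNIV by auto

lemma layer_u_ext_int:
  assumes "t \<in> {0<..T}"
  shows "integrable lebesgue (\<lambda>x. indicator {x. infdist x (- \<Omega>) < \<epsilon>} x * \<bar>u_ext t x\<bar>)"
proof -
  have "{x. infdist x (- \<Omega>) < \<epsilon>} \<in> sets lebesgue"
    by (intro lmeasurable_open[THEN fmeasurableD] sets_completionI_sets) (auto intro!: borel_open open_Collect_less continuous_intros)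
  from integrable_mult_indicator[OF this integrable_abs[OF u_ext_int[OF assms]]]
  show ?thesis by simp
qed

text \<open>The integral is over Lebesgue measurable slices and holds for every single time, as is needed for weakly
continuous solutions; the representative inherits it.\<close>

lemma layer_u_ext:
  assumes "0 < a" "0 < e"
  shows "\<exists>\<epsilon>0>0. \<forall>\<epsilon>. 0 < \<epsilon> \<longrightarrow> \<epsilon> < \<epsilon>0 \<longrightarrow> (\<forall>t\<in>{a..T}.
    (LINT x|lebesgue. indicator {x. infdist x (- \<Omega>) < \<epsilon>} x * \<bar>u_ext t x\<bar>) \<le> e * \<epsilon>)"
proof (cases "a \<le> T")
  case True
  let ?I = "\<lambda>\<epsilon> t. LINT x:{x \<in> \<Omega>. infdist x (frontier \<Omega>) < \<epsilon>}|lebesgue. \<bar>u x t\<bar>"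
  have I: "?I \<epsilon> t = (LINT x|lebesgue. indicator {x. infdist x (- \<Omega>) < \<epsilon>} x * \<bar>u_ext t x\<bar>)" for \<epsilon> t
    unfolding set_lebesgue_integral_def
    by (intro Bochner_Integration.integral_cong refl)
      (auto simp: u_ext_def indicator_def infdist_frontier_eq_infdist_compl[OF open_\<Omega> \<Omega>_not_UNIV])
  have "uniform_limit {a..T} (\<lambda>\<epsilon> t. (1 / \<epsilon>) * ?I \<epsilon> t) (\<lambda>t. 0) (at_right 0)"
    using sol True assms(1) unfolding weak_solution_def zero_boundary_values_def by auto
  then have "\<forall>\<^sub>F \<epsilon> in at_right 0. \<forall>t\<in>{a..T}. dist ((1 / \<epsilon>) * ?I \<epsilon> t) 0 < e"
    using assms(2) by (rule uniform_limitD)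
  then obtain b where b: "b > 0" "\<And>\<epsilon> t. 0 < \<epsilon> \<Longrightarrow> \<epsilon> < b \<Longrightarrow> t \<in> {a..T} \<Longrightarrow> dist ((1 / \<epsilon>) * ?I \<epsilon> t) 0 < e"
    unfolding eventually_at_right_field by auto
  have "(LINT x|lebesgue. indicator {x. infdist x (- \<Omega>) < \<epsilon>} x * \<bar>u_ext t x\<bar>) \<le> e * \<epsilon>"
    if "0 < \<epsilon>" "\<epsilon> < b" "t \<in> {a..T}" for \<epsilon> t
  proof -
    have "\<bar>(1 / \<epsilon>) * ?I \<epsilon> t\<bar> < e" using b(2)[OF that] unfolding dist_real_def diff_0_right .
    then have "(1 / \<epsilon>) * ?I \<epsilon> t < e" using abs_ge_self[of "(1 / \<epsilon>) * ?I \<epsilon> t"] by linarith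
    then have "?I \<epsilon> t \<le> e * \<epsilon>" using that(1) by (simp add: field_simps)
    then show ?thesis unfolding I .
  qed
  then show ?thesis using b(1) by blast
next
  case False
  then show ?thesis by (intro exI[of _ 1]) auto
qed

text \<open>Local integrability gives measurability on compact subsets only; countably many of them exhaust
\<open>\<Omega> \<times> (0, T]\<close>.\<close>

lemma u_spacetime_measurable:
  "(\<lambda>p. indicator (\<Omega> \<times> {0<..T}) p * (\<lambda>(x, t). u x t) p) \<in> borel_measurable lebesgue"
proof -
  define C where "C n = {x. 1 / real (Suc n) \<le> infdist x (- \<Omega>)} \<times> {1 / real (Suc n)..T}" for n
  have C: "compact (C n)" "C n \<subseteq> \<Omega> \<times> {0<..T}" for n
  proof -
    have "1 / real (Suc n) > 0" by simp
    note * = compact_infdist_compl_ge[OF bounded_\<Omega> this]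
    show "compact (C n)" unfolding C_def by (intro compact_Times * compact_Icc)
    have "{1 / real (Suc n)..T} \<subseteq> {0<..T}"
    proof
      fix t assume "t \<in> {1 / real (Suc n)..T}"
      then show "t \<in> {0<..T}"
        using \<open>1 / real (Suc n) > 0\<close> unfolding atLeastAtMost_iff greaterThanAtMost_iff by linarith
    qed
    then show "C n \<subseteq> \<Omega> \<times> {0<..T}" unfolding C_def using *(2) by (intro Sigma_mono) auto
  qed
  have "(\<lambda>p. indicator (C n) p * (\<lambda>(x, t). u x t) p) \<in> borel_measurable lebesgue" for n
  proof -
    have "set_integrable lebesgue (C n) (\<lambda>(x, t). u x t)"
      using sol C unfolding weak_solution_def locally_integrable_on_def by blast
    then show ?thesis unfolding set_integrable_def by (auto dest: borel_measurable_integrable)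
  qed
  moreover have "(\<lambda>n. indicator (C n) p * (\<lambda>(x, t). u x t) p) \<longlonglongrightarrow> indicator (\<Omega> \<times> {0<..T}) p * (\<lambda>(x, t). u x t) p" for p
  proof (rule tendsto_mult_right)
    show "(\<lambda>n. indicator (C n) p :: real) \<longlonglongrightarrow> indicator (\<Omega> \<times> {0<..T}) p"
    proof (cases "p \<in> \<Omega> \<times> {0<..T}")
      case False
      then have "p \<notin> C n" for n using C(2) by blast
      then show ?thesis using False by simp
    next
      case True
      then have "infdist (fst p) (- \<Omega>) > 0"
        using \<Omega>_not_UNIV open_\<Omega> by (intro infdist_pos_not_in_closed) (auto simp: closed_Compl)
      then have pos: "min (infdist (fst p) (- \<Omega>)) (snd p) > 0" using True by auto
      have "(\<lambda>n. 1 / real (Suc n)) \<longlonglongrightarrow> 0" by (rule LIMSEQ_Suc[OF lim_1_over_n])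
      then have "\<forall>\<^sub>F n in sequentially. 1 / real (Suc n) < min (infdist (fst p) (- \<Omega>)) (snd p)"
        using pos by (rule order_tendstoD(2))
      then have "\<forall>\<^sub>F n in sequentially. indicator (C n) p = (indicator (\<Omega> \<times> {0<..T}) p :: real)"
      proof eventually_elim
        fix n assume n: "1 / real (Suc n) < min (infdist (fst p) (- \<Omega>)) (snd p)"
        then have "p \<in> C n" using True by (cases p) (auto simp: C_def simp del: of_nat_Suc)
        then show "indicator (C n) p = (indicator (\<Omega> \<times> {0<..T}) p :: real)" using True by simp
      qed
      then show ?thesis by (rule tendsto_eventually)
    qed
  qed
  ultimately show ?thesis by (rule borel_measurable_LIMSEQ_real[rotated])
qed

lemma indicator_S_borel:
  obtains \<sigma> where "\<sigma> \<in> borel_measurable borel" "\<And>x. \<sigma> x = 0 \<or> \<sigma> x = (1::real)" "\<And>x. x \<notin> \<Omega> \<Longrightarrow> \<sigma> x = 0"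
    "AE x in lborel. \<sigma> x = indicator S x"
proof -
  have "(indicator S :: 'a \<Rightarrow> real) \<in> borel_measurable lebesgue" using S(1) by simp
  then obtain g where g: "g \<in> borel_measurable lborel" "AE x in lborel. (indicator S x :: real) = g x"
    using completion_ex_borel_measurable_real by blast
  have [measurable]: "g \<in> borel_measurable borel" "\<Omega> \<in> sets borel" using g(1) open_\<Omega> by auto
  define \<sigma> :: "'a \<Rightarrow> real" where "\<sigma> = indicator ({x. g x = 1} \<inter> \<Omega>)"
  show ?thesis
  proof (rule that[of \<sigma>])
    show "\<sigma> \<in> borel_measurable borel" unfolding \<sigma>_def by measurable
    show "AE x in lborel. \<sigma> x = indicator S x"
      using g(2)
    proof eventually_elim
      fix x assume "(indicator S x :: real) = g x"
      then show "\<sigma> x = indicator S x" using S(2) by (cases "x \<in> S") (auto simp: \<sigma>_def)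
    qed
  qed (auto simp: \<sigma>_def indicator_def)
qed

lemma f_S_borel:
  assumes \<sigma>: "\<sigma> \<in> borel_measurable borel" "\<And>x. \<sigma> x = 0 \<or> \<sigma> x = (1::real)" "AE x in lborel. \<sigma> x = indicator S x"
  obtains \<phi> where "\<phi> \<in> borel_measurable borel" "integrable lborel (\<lambda>x. (\<phi> x)\<^sup>2)" "\<And>x. \<sigma> x * \<phi> x = \<phi> x"
    "AE x in lborel. \<phi> x = indicator S x * f x"
proof -
  have "(\<lambda>x. indicator \<Omega> x * f x) \<in> borel_measurable lebesgue"
    using f(1) by (simp add: set_borel_measurable_def)
  then obtain g where g: "g \<in> borel_measurable lborel" "AE x in lborel. indicator \<Omega> x * f x = g x"
    using completion_ex_borel_measurable_real by blast
  define \<phi> where "\<phi> x = \<sigma> x * g x" for x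
  have \<phi>_meas: "\<phi> \<in> borel_measurable borel" unfolding \<phi>_def[abs_def] using \<sigma>(1) g(1) by measurable
  have ae: "AE x in lborel. \<phi> x = indicator S x * f x"
    using g(2) \<sigma>(3)
  proof eventually_elim
    fix x assume "indicator \<Omega> x * f x = g x" "\<sigma> x = indicator S x"
    then show "\<phi> x = indicator S x * f x" using S(2) by (auto simp: \<phi>_def indicator_def split: if_splits)
  qed
  have "integrable lebesgue (\<lambda>x. indicator S x *\<^sub>R (indicator \<Omega> x *\<^sub>R (f x)\<^sup>2))"
    using f(2) unfolding set_integrable_def by (rule integrable_mult_indicator[OF S(1)])
  moreover have "integrable lebesgue (\<lambda>x. indicator S x *\<^sub>R (indicator \<Omega> x *\<^sub>R (f x)\<^sup>2)) \<longleftrightarrow> integrable lborel (\<lambda>x. (\<phi> x)\<^sup>2)"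
  proof (rule integrable_lebesgue_iff_lborel)
    show "(\<lambda>x. indicator S x *\<^sub>R (indicator \<Omega> x *\<^sub>R (f x)\<^sup>2)) \<in> borel_measurable lebesgue"
      using calculation by (rule borel_measurable_integrable)
    show "(\<lambda>x. (\<phi> x)\<^sup>2) \<in> borel_measurable borel" using \<phi>_meas by measurable
    show "AE x in lborel. indicator S x *\<^sub>R (indicator \<Omega> x *\<^sub>R (f x)\<^sup>2) = (\<phi> x)\<^sup>2"
      using ae by eventually_elim (use S(2) in \<open>auto simp: indicator_def\<close>)
  qed
  ultimately have "integrable lborel (\<lambda>x. (\<phi> x)\<^sup>2)" by simp
  moreover have "\<sigma> x * \<phi> x = \<phi> x" for x using \<sigma>(2)[of x] by (auto simp: \<phi>_def)
  ultimately show ?thesis using that \<phi>_meas ae by blast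
qed

lemma K_cont: "continuous_on UNIV K" using K by (rule GDERIV_continuous_on)

definition Ku :: "real \<Rightarrow> 'a \<Rightarrow> real" where "Ku t x = (LINT z|lebesgue. K (x - z) * u_ext t z)"

lemma opA_eq: "opA \<Omega> S K (\<lambda>y. u y t) x = indicator S x * Ku t x"
  unfolding opA_def Ku_def set_lebesgue_integral_def
  by (intro arg_cong2[where f="(*)"] Bochner_Integration.integral_cong refl) (simp add: u_ext_def)

lemma K_diff_meas: "(\<lambda>z. K (x - z)) \<in> borel_measurable borel"
  by (intro borel_measurable_continuous_onI continuous_on_compose2[OF K_cont] continuous_intros) auto

lemma Ku_eq_conv:
  assumes U: "U t \<in> borel_measurable borel" and t: "t \<in> {0<..T}" "AE x in lborel. u_ext t x = U t x"
  shows "Ku t x = conv K U t x"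
  unfolding Ku_def conv_def
proof (rule integral_lebesgue_eq_lborel)
  show "(\<lambda>y. K (x - y) * u_ext t y) \<in> borel_measurable lebesgue"
    by (rule borel_measurable_times[OF borel_measurable_lebesgueI[OF K_diff_meas] borel_measurable_integrable[OF u_ext_int[OF t(1)]]])
  show "(\<lambda>y. K (x - y) * U t y) \<in> borel_measurable borel"
    using K_diff_meas U by (rule borel_measurable_times)
  show "AE y in lborel. K (x - y) * u_ext t y = K (x - y) * U t y"
    using t(2) by eventually_elim simp
qed

lemma opA_adj_eq:
  assumes R: "R \<in> borel_measurable borel" "AE x in lborel. R x = indicator S x * g x"
    and g: "(\<lambda>x. indicator S x * g x) \<in> borel_measurable lebesgue"
  shows "opA_adj S K g y = (LINT x|lborel. K (x - y) * R x)"
proof -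
  have [measurable]: "K \<in> borel_measurable borel" using K_cont by (rule borel_measurable_continuous_onI)
  have "opA_adj S K g y = (LINT x|lebesgue. K (x - y) * (indicator S x * g x))"
    unfolding opA_adj_def set_lebesgue_integral_def by (intro Bochner_Integration.integral_cong refl) simp
  also have "\<dots> = (LINT x|lborel. K (x - y) * R x)"
  proof (rule integral_lebesgue_eq_lborel)
    have "(\<lambda>x. K (x - y)) \<in> borel_measurable lebesgue" by (intro borel_measurable_lebesgueI) measurable
    then show "(\<lambda>x. K (x - y) * (indicator S x * g x)) \<in> borel_measurable lebesgue"
      using g by (rule borel_measurable_times)
    show "(\<lambda>x. K (x - y) * R x) \<in> borel_measurable borel" using R(1) by measurable
    show "AE x in lborel. K (x - y) * (indicator S x * g x) = K (x - y) * R x"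
      using R(2) by eventually_elim simp
  qed
  finally show ?thesis .
qed

text \<open>A Borel function that agrees with \<open>u\<close> almost everywhere in space-time agrees with it almost everywhere in
space at almost every time. It is set to zero at the exceptional times.\<close>

lemma borel_representative_of_u:
  obtains U and N :: "real set"
  where "(\<lambda>(t, x). U t x) \<in> borel_measurable (borel \<Otimes>\<^sub>M borel)" "\<And>t x. x \<notin> \<Omega> \<Longrightarrow> U t x = 0"
    "\<And>t x. t \<notin> {0<..T} - N \<Longrightarrow> U t x = 0"
    "N \<in> null_sets lborel" "\<And>t. t \<in> {0<..T} - N \<Longrightarrow> AE x in lborel. u_ext t x = U t x"
    "AE p in lborel. indicator (\<Omega> \<times> {0<..T}) p * (\<lambda>(x, t). u x t) p = U (snd p) (fst p)"
    "AE p in (lborel :: ('a \<times> real) measure). snd p \<notin> N"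
proof -
  let ?h = "\<lambda>p. indicator (\<Omega> \<times> {0<..T}) p * (\<lambda>(x, t). u x t) p"
  obtain g where g: "g \<in> borel_measurable lborel" "AE p in lborel. ?h p = g p"
    using completion_ex_borel_measurable_real[OF u_spacetime_measurable] by blast
  have g_meas[measurable]: "g \<in> borel_measurable (borel \<Otimes>\<^sub>M borel)"
    using g(1) by (simp add: borel_prod)
  have [measurable]: "\<Omega> \<in> sets borel" using open_\<Omega> by auto
  have "AE p in lborel \<Otimes>\<^sub>M lborel. ?h p = g p" unfolding lborel_prod by (rule g(2))
  then obtain N0 where N0: "N0 \<in> null_sets (lborel \<Otimes>\<^sub>M lborel)" "\<And>p. p \<notin> N0 \<Longrightarrow> ?h p = g p"
    by (elim AE_E3) (auto simp: space_pair_measure)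
  have N0m: "{p \<in> space (lborel \<Otimes>\<^sub>M lborel). (fst p, snd p) \<notin> N0} \<in> sets (lborel \<Otimes>\<^sub>M lborel)"
  proof -
    have "{p \<in> space (lborel \<Otimes>\<^sub>M lborel). (fst p, snd p) \<notin> N0} = space (lborel \<Otimes>\<^sub>M lborel) - N0" by auto
    then show ?thesis using null_setsD2[OF N0(1)] by (simp only: sets.compl_sets)
  qed
  have "AE x in lborel. AE t in lborel. (x, t) \<notin> N0"
    using lborel_pair.AE_pair[OF AE_not_in[OF N0(1)]] by simp
  then have "AE t in lborel. AE x in lborel. (x, t) \<notin> N0"
    using lborel_pair.AE_commute[OF N0m] by simp
  then obtain N where N: "N \<in> null_sets lborel" "\<And>t. t \<notin> N \<Longrightarrow> AE x in lborel. (x, t) \<notin> N0"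
    by (elim AE_E3) auto
  have [measurable]: "N \<in> sets borel" using N(1) by auto
  define U where "U t x = indicator ({0<..T} - N) t * (indicator \<Omega> x * g (x, t))" for t x
  have NN: "AE p in (lborel :: ('a \<times> real) measure). snd p \<notin> N"
    unfolding lborel_prod[symmetric]
  proof (rule lborel_pair.AE_pair_measure)
    show "{p \<in> space (lborel \<Otimes>\<^sub>M lborel). snd p \<notin> N} \<in> sets (lborel \<Otimes>\<^sub>M (lborel :: real measure))"
      by measurable
    show "AE x in lborel. AE y in lborel. snd (x, y) \<notin> N" using AE_not_in[OF N(1)] by simp
  qed
  show ?thesis
  proof (rule that[of U N])
    show "(\<lambda>(t, x). U t x) \<in> borel_measurable (borel \<Otimes>\<^sub>M borel)" unfolding U_def by measurable
    show "AE x in lborel. u_ext t x = U t x" if t: "t \<in> {0<..T} - N" for t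
    proof -
      have "AE x in lborel. (x, t) \<notin> N0" using N(2) t by blast
      then show ?thesis
      proof eventually_elim
        fix x assume "(x, t) \<notin> N0"
        then show "u_ext t x = U t x" using N0(2)[of "(x, t)"] t by (auto simp: U_def u_ext_def indicator_def)
      qed
    qed
    show "AE p in lborel. ?h p = U (snd p) (fst p)"
      using g(2) NN
    proof eventually_elim
      fix p assume p: "?h p = g p" "snd p \<notin> N"
      show "?h p = U (snd p) (fst p)"
      proof (cases "p \<in> \<Omega> \<times> {0<..T}")
        case True
        then have "U (snd p) (fst p) = g p" using p(2) by (auto simp: U_def)
        then show ?thesis using p(1) by simp
      next
        case False
        then have "fst p \<notin> \<Omega> \<or> snd p \<notin> {0<..T} - N" by (cases p) auto
        then have "U (snd p) (fst p) = 0" unfolding U_def by (elim disjE) simp_all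
        then show ?thesis using False by simp
      qed
    qed
  qed (use N NN in \<open>auto simp: U_def\<close>)
qed

end

context weak_problem begin

lemma f_\<Omega>_meas: "(\<lambda>x. indicator \<Omega> x * f x) \<in> borel_measurable lebesgue"
  using f(1) by (simp add: set_borel_measurable_def)

lemma f_S_meas: "(\<lambda>x. indicator S x * f x) \<in> borel_measurable lebesgue"
proof -
  have "(\<lambda>x. indicator S x * (indicator \<Omega> x * f x)) \<in> borel_measurable lebesgue"
    by (rule borel_measurable_times[OF borel_measurable_indicator[OF S(1)] f_\<Omega>_meas])
  moreover have "indicator S x * (indicator \<Omega> x * f x) = indicator S x * f x" for x
    using S(2) by (auto simp: indicator_def)
  ultimately show ?thesis by simp
qed

text \<open>The weak equation is tested with \<open>\<psi>(x) \<theta>(t)\<close>. For times off \<open>N\<close>, where \<open>U\<close> and \<open>u\<close> agree almost everywhere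
in space, \<open>A\<^sup>T(Au - f)\<close> is the same function for both at every point, hence so is its gradient.\<close>

lemma borel_problem:
  obtains \<sigma> \<phi> U and N :: "real set" where "borel_weak_solution \<Omega> K k \<sigma> \<phi> U T"
    "N \<in> null_sets lborel" "\<And>t. t \<in> {0<..T} - N \<Longrightarrow> AE x in lborel. u_ext t x = U t x"
    "AE x in lborel. \<sigma> x = indicator S x" "AE x in lborel. \<phi> x = indicator S x * f x"
proof -
  obtain \<sigma> where \<sigma>: "\<sigma> \<in> borel_measurable borel" "\<And>x. \<sigma> x = 0 \<or> \<sigma> x = (1::real)" "\<And>x. x \<notin> \<Omega> \<Longrightarrow> \<sigma> x = 0"
    "AE x in lborel. \<sigma> x = indicator S x"
    using indicator_S_borel by blast
  obtain \<phi> where \<phi>: "\<phi> \<in> borel_measurable borel" "integrable lborel (\<lambda>x. (\<phi> x)\<^sup>2)" "\<And>x. \<sigma> x * \<phi> x = \<phi> x"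
    "AE x in lborel. \<phi> x = indicator S x * f x"
    using f_S_borel[OF \<sigma>(1,2,4)] by blast
  obtain U and N :: "real set" where U: "(\<lambda>(t, x). U t x) \<in> borel_measurable (borel \<Otimes>\<^sub>M borel)" "\<And>t x. x \<notin> \<Omega> \<Longrightarrow> U t x = 0"
    "\<And>t x. t \<notin> {0<..T} - N \<Longrightarrow> U t x = 0"
    and N: "N \<in> null_sets lborel" and Uv: "\<And>t. t \<in> {0<..T} - N \<Longrightarrow> AE x in lborel. u_ext t x = U t x"
    and Uu: "AE p in lborel. indicator (\<Omega> \<times> {0<..T}) p * (\<lambda>(x, t). u x t) p = U (snd p) (fst p)"
    and NN: "AE p in (lborel :: ('a \<times> real) measure). snd p \<notin> N"
    using borel_representative_of_u by blast
  note U(1)[measurable]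
  have U_slice_meas: "U t \<in> borel_measurable borel" for t
    using measurable_compose[OF measurable_Pair1' U(1), of t] by simp
  have slice: "integrable lborel (U t)" for t
  proof (cases "t \<in> {0<..T} - N")
    case True
    then show ?thesis
      using integrable_lebesgue_iff_lborel[of "u_ext t" "U t"] u_ext_int[of t] Uv[OF True] U_slice_meas
      by (auto dest: borel_measurable_integrable)
  next
    case False
    then have "U t = (\<lambda>x. 0)" using U(3) by auto
    then show ?thesis by simp
  qed
  interpret B: borel_flow_data \<Omega> K k \<sigma> \<phi> U
    using open_\<Omega> bounded_\<Omega> K k \<sigma>(1-3) \<phi>(1-3) U(1,2) slice by unfold_locales
  have adj: "opA_adj S K (\<lambda>z. opA \<Omega> S K (\<lambda>y. u y t) z - f z) y = (LINT x|lborel. K (x - y) * residual K \<sigma> \<phi> U t x)"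
    if t: "t \<in> {0<..T} - N" for t y
  proof (rule opA_adj_eq)
    show "residual K \<sigma> \<phi> U t \<in> borel_measurable borel" by (rule B.R_slice_meas)
    have op: "opA \<Omega> S K (\<lambda>y. u y t) z = indicator S z * conv K U t z" for z
      unfolding opA_eq using Ku_eq_conv[of U t] U_slice_meas t Uv[OF t] by auto
    have eq: "indicator S x * (opA \<Omega> S K (\<lambda>y. u y t) x - f x) = indicator S x * conv K U t x - indicator S x * f x" for x
      unfolding op by (simp add: indicator_def)
    show "AE x in lborel. residual K \<sigma> \<phi> U t x = indicator S x * (opA \<Omega> S K (\<lambda>y. u y t) x - f x)"
      using \<sigma>(4) \<phi>(4) by eventually_elim (simp add: eq residual_def)
    have "(\<lambda>x. indicator S x * conv K U t x) \<in> borel_measurable lebesgue"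
      by (rule borel_measurable_times[OF borel_measurable_indicator[OF S(1)] borel_measurable_lebesgueI[OF B.w_slice_meas]])
    then show "(\<lambda>x. indicator S x * (opA \<Omega> S K (\<lambda>y. u y t) x - f x)) \<in> borel_measurable lebesgue"
      unfolding eq using f_S_meas by (rule borel_measurable_diff)
  qed
  have grad_adj: "grad (opA_adj S K (\<lambda>z. opA \<Omega> S K (\<lambda>y. u y t) z - f z)) x = potential_grad K k \<sigma> \<phi> U t x"
    if t: "t \<in> {0<..T} - N" for t x
  proof (rule grad_eq)
    have "opA_adj S K (\<lambda>z. opA \<Omega> S K (\<lambda>y. u y t) z - f z) = (\<lambda>y. LINT x|lborel. K (x - y) * residual K \<sigma> \<phi> U t x)"
      using adj[OF t] by auto
    then show "GDERIV (opA_adj S K (\<lambda>z. opA \<Omega> S K (\<lambda>y. u y t) z - f z)) x :> potential_grad K k \<sigma> \<phi> U t x"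
      unfolding potential_grad_def
      using GDERIV_integral_kernel[OF K k B.R_int bounded_\<Omega> B.R_out] by simp
  qed
  have "borel_weak_solution \<Omega> K k \<sigma> \<phi> U T"
  proof
    fix a e :: real assume ae: "0 < a" "0 < e"
    obtain \<epsilon>0 where \<epsilon>0: "\<epsilon>0 > 0" "\<And>\<epsilon> t. 0 < \<epsilon> \<Longrightarrow> \<epsilon> < \<epsilon>0 \<Longrightarrow> t \<in> {a..T} \<Longrightarrow>
      (LINT x|lebesgue. indicator {x. infdist x (- \<Omega>) < \<epsilon>} x * \<bar>u_ext t x\<bar>) \<le> e * \<epsilon>"
      using layer_u_ext[OF ae] by blast
    have "(LINT x|lborel. indicator {x. infdist x (- \<Omega>) < \<epsilon>} x * \<bar>U t x\<bar>) \<le> e * \<epsilon>"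
      if \<epsilon>: "0 < \<epsilon>" "\<epsilon> < \<epsilon>0" "t \<in> {a..T}" for \<epsilon> t
    proof (cases "t \<in> {0<..T} - N")
      case True
      have "(LINT x|lebesgue. indicator {x. infdist x (- \<Omega>) < \<epsilon>} x * \<bar>u_ext t x\<bar>)
        = (LINT x|lborel. indicator {x. infdist x (- \<Omega>) < \<epsilon>} x * \<bar>U t x\<bar>)"
      proof (rule integral_lebesgue_eq_lborel)
        show "(\<lambda>x. indicator {x. infdist x (- \<Omega>) < \<epsilon>} x * \<bar>u_ext t x\<bar>) \<in> borel_measurable lebesgue"
          using layer_u_ext_int[of t \<epsilon>] True by (auto dest: borel_measurable_integrable)
        show "(\<lambda>x. indicator {x. infdist x (- \<Omega>) < \<epsilon>} x * \<bar>U t x\<bar>) \<in> borel_measurable borel"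
          by measurable
        show "AE x in lborel. indicator {x. infdist x (- \<Omega>) < \<epsilon>} x * \<bar>u_ext t x\<bar> = indicator {x. infdist x (- \<Omega>) < \<epsilon>} x * \<bar>U t x\<bar>"
          using Uv[OF True] by eventually_elim simp
      qed
      then show ?thesis using \<epsilon>0(2)[OF \<epsilon>] by simp
    next
      case False
      then show ?thesis using U(3) ae \<epsilon> by simp
    qed
    then show "\<exists>\<epsilon>0>0. \<forall>\<epsilon>. 0 < \<epsilon> \<longrightarrow> \<epsilon> < \<epsilon>0 \<longrightarrow> (\<forall>t\<in>{a..T}.
        (LINT x|lborel. indicator {x. infdist x (- \<Omega>) < \<epsilon>} x * \<bar>U t x\<bar>) \<le> e * \<epsilon>)"
      using \<epsilon>0(1) by blast
  next
    fix C :: "'a set" and a :: real assume C: "compact C" "C \<subseteq> \<Omega>" and a: "0 < a"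
    have [measurable]: "C \<in> sets borel" using C(1) by (simp add: borel_compact)
    have "compact (C \<times> {a..T})" "C \<times> {a..T} \<subseteq> \<Omega> \<times> {0<..T}" using C a by (auto intro: compact_Times)
    then have "set_integrable lebesgue (C \<times> {a..T}) (\<lambda>(x, t). u x t)"
      using sol unfolding weak_solution_def locally_integrable_on_def by blast
    then have i: "integrable lebesgue (\<lambda>p. indicator (C \<times> {a..T}) p *\<^sub>R (\<lambda>(x, t). u x t) p)"
      unfolding set_integrable_def .
    have "integrable lborel (\<lambda>p. indicator {a..T} (snd p) * (indicator C (fst p) * U (snd p) (fst p)))"
    proof (rule integrable_lebesgue_iff_lborel[THEN iffD1, OF _ _ _ i])
      show "(\<lambda>p. indicator (C \<times> {a..T}) p *\<^sub>R (\<lambda>(x, t). u x t) p) \<in> borel_measurable lebesgue"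
        using i by (rule borel_measurable_integrable)
      show "(\<lambda>p. indicator {a..T} (snd p) * (indicator C (fst p) * U (snd p) (fst p))) \<in> borel_measurable borel"
        unfolding borel_prod[symmetric] by measurable
      show "AE p in lborel. indicator (C \<times> {a..T}) p *\<^sub>R (\<lambda>(x, t). u x t) p
          = indicator {a..T} (snd p) * (indicator C (fst p) * U (snd p) (fst p))"
        using Uu
      proof eventually_elim
        fix p assume p: "indicator (\<Omega> \<times> {0<..T}) p * (\<lambda>(x, t). u x t) p = U (snd p) (fst p)"
        show "indicator (C \<times> {a..T}) p *\<^sub>R (\<lambda>(x, t). u x t) p
          = indicator {a..T} (snd p) * (indicator C (fst p) * U (snd p) (fst p))"
          unfolding p[symmetric] using C(2) a by (cases p) (auto simp: indicator_def)
      qed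
    qed
    then have "integrable (lborel \<Otimes>\<^sub>M lborel) (\<lambda>(x, t). (\<lambda>(t, x). indicator {a..T} t * (indicator C x * U t x)) (t, x))"
      by (simp add: lborel_prod case_prod_unfold)
    then show "integrable (lborel \<Otimes>\<^sub>M lborel) (\<lambda>(t, x). indicator {a..T} t * (indicator C x * U t x))"
      by (rule lborel_pair.integrable_product_swap_iff[THEN iffD1])
  next
    fix \<psi> \<psi>' C \<theta> \<theta>' and a b :: real
    assume \<psi>: "\<And>x. GDERIV \<psi> x :> \<psi>' x" "continuous_on UNIV \<psi>'" and C: "compact C" "C \<subseteq> \<Omega>" "\<And>x. x \<notin> C \<Longrightarrow> \<psi> x = 0"
      and \<theta>: "\<And>t. (\<theta> has_field_derivative \<theta>' t) (at t)" "continuous_on UNIV \<theta>'" "0 < a" "b < T" "\<And>t. t \<notin> {a..b} \<Longrightarrow> \<theta> t = 0"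
    have \<psi>_cont: "continuous_on UNIV \<psi>" using \<psi>(1) by (rule GDERIV_continuous_on)
    have \<theta>_cont: "continuous_on UNIV \<theta>" using \<theta>(1) by (auto intro!: GDERIV_continuous_on)
    have [measurable]: "\<theta> \<in> borel_measurable borel" "\<theta>' \<in> borel_measurable borel" "\<psi> \<in> borel_measurable borel" "\<psi>' \<in> borel_measurable borel"
      using \<theta>_cont \<theta>(2) \<psi>_cont \<psi>(2) by (auto intro: borel_measurable_continuous_onI)
    define \<eta> where "\<eta> = (\<lambda>(x, t). \<psi> x * \<theta> t)"
    have supp: "closure {z. \<eta> z \<noteq> 0} \<subseteq> C \<times> {a..b}"
    proof (rule closure_minimal)
      show "closed (C \<times> {a..b})" using C(1) by (intro closed_Times compact_imp_closed) auto
      show "{z. \<eta> z \<noteq> 0} \<subseteq> C \<times> {a..b}"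
      proof
        fix z assume "z \<in> {z. \<eta> z \<noteq> 0}"
        then have "\<psi> (fst z) \<noteq> 0" "\<theta> (snd z) \<noteq> 0" by (auto simp: \<eta>_def case_prod_unfold)
        then have "fst z \<in> C" "snd z \<in> {a..b}" using C(3) \<theta>(5) by blast+
        then show "z \<in> C \<times> {a..b}" by (cases z) auto
      qed
    qed
    have "C1_compact_support (\<Omega> \<times> {0<..<T}) \<eta>"
      unfolding C1_compact_support_def
    proof (intro conjI)
      show "C1 \<eta>"
        unfolding C1_def
      proof (intro exI conjI allI)
        show "GDERIV \<eta> p :> (\<theta> (snd p) *\<^sub>R \<psi>' (fst p), \<psi> (fst p) * \<theta>' (snd p))" for p
          unfolding \<eta>_def using GDERIV_tensor[of \<psi> "fst p" \<psi>' \<theta> \<theta>' "snd p"] \<psi>(1) \<theta>(1) by simp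
        show "continuous_on UNIV (\<lambda>p. (\<theta> (snd p) *\<^sub>R \<psi>' (fst p), \<psi> (fst p) * \<theta>' (snd p)))"
          by (intro continuous_intros continuous_on_compose2[OF \<theta>_cont] continuous_on_compose2[OF \<psi>(2)]
            continuous_on_compose2[OF \<psi>_cont] continuous_on_compose2[OF \<theta>(2)]) auto
      qed
      show "compact (closure {z. \<eta> z \<noteq> 0})"
        using compact_Int_closed[OF compact_Times[OF C(1) compact_Icc[of a b]] closed_closure, of "{z. \<eta> z \<noteq> 0}"] supp
        by (simp add: Int_absorb1)
      show "closure {z. \<eta> z \<noteq> 0} \<subseteq> \<Omega> \<times> {0<..<T}"
        using supp C(2) \<theta>(3,4) by force
    qed
    define F where "F = (\<lambda>(x, t). deriv (\<lambda>s. \<eta> (x, s)) t * u x t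
                   - \<bar>u x t\<bar> * (grad (\<lambda>y. \<eta> (y, t)) x \<bullet>
                        grad (opA_adj S K (\<lambda>z. opA \<Omega> S K (\<lambda>y. u y t) z - f z)) x))"
    have F: "set_integrable lebesgue (\<Omega> \<times> {0<..T}) F" "(LINT z:\<Omega> \<times> {0<..T}|lebesgue. F z) = 0"
      using sol \<open>C1_compact_support (\<Omega> \<times> {0<..<T}) \<eta>\<close> unfolding weak_solution_def Let_def F_def by blast+
    let ?G = "\<lambda>(t, x). \<theta>' t * \<psi> x * U t x - \<bar>U t x\<bar> * \<theta> t * (\<psi>' x \<bullet> potential_grad K k \<sigma> \<phi> U t x)"
    have G_meas[measurable]: "?G \<in> borel_measurable (borel \<Otimes>\<^sub>M borel)" by measurable
    have F_eq: "F (x, t) = \<theta>' t * \<psi> x * u x t - \<bar>u x t\<bar> * \<theta> t * (\<psi>' x \<bullet> potential_grad K k \<sigma> \<phi> U t x)"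
      if "t \<in> {0<..T} - N" for x t
    proof -
      have d: "deriv (\<lambda>s. \<eta> (x, s)) t = \<psi> x * \<theta>' t"
        unfolding \<eta>_def using DERIV_cmult[OF \<theta>(1), of "\<psi> x" t] by (auto intro!: DERIV_imp_deriv)
      have "GDERIV (\<lambda>y. \<eta> (y, t)) x :> \<theta> t *\<^sub>R \<psi>' x"
        unfolding \<eta>_def using GDERIV_mult[OF \<psi>(1) GDERIV_const[of "\<theta> t"], of x] by simp
      then have g: "grad (\<lambda>y. \<eta> (y, t)) x = \<theta> t *\<^sub>R \<psi>' x" by (rule grad_eq)
      show ?thesis unfolding F_def by (simp add: d g grad_adj[OF that])
    qed
    have ae: "AE p in lborel. indicator (\<Omega> \<times> {0<..T}) p *\<^sub>R F p = ?G (snd p, fst p)"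
      using Uu NN
    proof eventually_elim
      fix p assume p: "indicator (\<Omega> \<times> {0<..T}) p * (\<lambda>(x, t). u x t) p = U (snd p) (fst p)" "snd p \<notin> N"
      show "indicator (\<Omega> \<times> {0<..T}) p *\<^sub>R F p = ?G (snd p, fst p)"
      proof (cases "p \<in> \<Omega> \<times> {0<..T}")
        case True
        then have "U (snd p) (fst p) = u (fst p) (snd p)" using p(1) by (auto simp: case_prod_unfold)
        moreover have "F (fst p, snd p) = \<theta>' (snd p) * \<psi> (fst p) * u (fst p) (snd p)
            - \<bar>u (fst p) (snd p)\<bar> * \<theta> (snd p) * (\<psi>' (fst p) \<bullet> potential_grad K k \<sigma> \<phi> U (snd p) (fst p))"
          using True p(2) by (intro F_eq) auto
        ultimately show ?thesis using True by simp
      next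
        case False
        then have "U (snd p) (fst p) = 0" using p(1) by simp
        then show ?thesis using False by simp
      qed
    qed
    have Fm: "(\<lambda>p. indicator (\<Omega> \<times> {0<..T}) p *\<^sub>R F p) \<in> borel_measurable lebesgue"
      using F(1) unfolding set_integrable_def by (rule borel_measurable_integrable)
    have Gm: "(\<lambda>p. ?G (snd p, fst p)) \<in> borel_measurable borel"
      unfolding borel_prod[symmetric] by measurable
    have "integrable lborel (\<lambda>p. ?G (snd p, fst p))"
      using F(1) integrable_lebesgue_iff_lborel[OF Fm Gm ae] unfolding set_integrable_def by simp
    then have "integrable (lborel \<Otimes>\<^sub>M lborel) (\<lambda>(x, t). ?G (t, x))"
      unfolding lborel_prod by (simp add: case_prod_unfold)
    then have 1: "integrable (lborel \<Otimes>\<^sub>M lborel) ?G"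
      by (rule lborel_pair.integrable_product_swap_iff[THEN iffD1])
    have "(LINT p|lborel. ?G (snd p, fst p)) = 0"
      using F(2) integral_lebesgue_eq_lborel[OF Fm Gm ae] unfolding set_lebesgue_integral_def by simp
    then have "(LINT p|(lborel \<Otimes>\<^sub>M lborel). (\<lambda>(x, t). ?G (t, x)) p) = 0"
      unfolding lborel_prod by (simp add: case_prod_unfold)
    then have "(LINT p|(lborel \<Otimes>\<^sub>M lborel). ?G p) = 0"
      using lborel_pair.integral_product_swap[of ?G] 1 by (simp add: borel_measurable_integrable)
    with 1 show "integrable (lborel \<Otimes>\<^sub>M lborel) ?G \<and> (LINT p|(lborel \<Otimes>\<^sub>M lborel). ?G p) = 0" by blast
  qed
  then show ?thesis using that N Uv \<sigma>(4) \<phi>(4) by blast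
qed

end

section \<open>Monotonicity of the functional\<close>

context weak_problem begin

abbreviation H :: "real \<Rightarrow> real" where "H t \<equiv> H_functional \<Omega> S K f (\<lambda>x. u x t)"

definition G :: "real \<Rightarrow> 'a \<Rightarrow> real" where
  "G t x = (indicator S x * Ku t x - indicator \<Omega> x * f x)\<^sup>2"

lemma G_nonneg: "0 \<le> G t x" by (simp add: G_def)

lemma H_eq: "H t = 1/2 * (LINT x|lebesgue. G t x)"
proof -
  have "(LINT x:\<Omega>|lebesgue. (opA \<Omega> S K (\<lambda>x. u x t) x - f x)\<^sup>2) = (LINT x|lebesgue. G t x)"
    unfolding set_lebesgue_integral_def opA_eq
    by (intro Bochner_Integration.integral_cong refl) (use S(2) in \<open>auto simp: G_def indicator_def\<close>)
  moreover have "0 \<le> (LINT x|lebesgue. G t x)"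
    using G_nonneg by (intro Bochner_Integration.integral_nonneg)
  ultimately show ?thesis by (simp add: H_functional_def L2_norm_on_def)
qed

lemma Ku_meas: assumes "t \<in> {0<..T}" shows "Ku t \<in> borel_measurable borel"
proof -
  obtain g where g: "g \<in> borel_measurable lborel" "AE x in lborel. u_ext t x = g x"
    using completion_ex_borel_measurable_real[OF borel_measurable_integrable[OF u_ext_int[OF assms]]] by blast
  have [measurable]: "K \<in> borel_measurable borel" using K_cont by (rule borel_measurable_continuous_onI)
  have [measurable]: "g \<in> borel_measurable borel" using g(1) by simp
  have "Ku t x = conv K (\<lambda>_. g) t x" for x
    using g(2) assms by (intro Ku_eq_conv) auto
  then have "Ku t = conv K (\<lambda>_. g) t" by auto
  moreover have "conv K (\<lambda>_. g) t \<in> borel_measurable borel" unfolding conv_def by measurable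
  ultimately show ?thesis by simp
qed

lemma G_meas: assumes "t \<in> {0<..T}" shows "G t \<in> borel_measurable lebesgue"
proof -
  have "(\<lambda>x. indicator S x * Ku t x) \<in> borel_measurable lebesgue"
    by (rule borel_measurable_times[OF borel_measurable_indicator[OF S(1)] borel_measurable_lebesgueI[OF Ku_meas[OF assms]]])
  then show ?thesis
    unfolding G_def[abs_def] using f_\<Omega>_meas by (intro borel_measurable_power borel_measurable_diff)
qed

lemma f_outside_int: "integrable lebesgue (\<lambda>x. indicator (- S) x * (indicator \<Omega> x * (f x)\<^sup>2))"
proof -
  have "- S \<in> sets lebesgue" using sets.compl_sets[OF S(1)] by (simp add: Compl_eq_Diff_UNIV)
  then have "integrable lebesgue (\<lambda>x. indicator (- S) x *\<^sub>R (indicator \<Omega> x *\<^sub>R (f x)\<^sup>2))"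
    using f(2) unfolding set_integrable_def by (rule integrable_mult_indicator)
  then show ?thesis by simp
qed

text \<open>Compact time intervals that exhaust \<open>(0, T)\<close> give countably many null sets. On the good times \<open>H\<close> is the
energy plus a constant, half the integral of \<open>f\<^sup>2\<close> over the part of \<open>\<Omega>\<close> outside \<open>S\<close>.\<close>

lemma monotone_off_null_set:
  obtains N where "N \<in> null_sets lebesgue"
    "\<And>t1 t2. t1 \<in> {0<..<T} - N \<Longrightarrow> t2 \<in> {0<..<T} - N \<Longrightarrow> t1 \<le> t2 \<Longrightarrow> H t2 \<le> H t1"
    "\<And>a b. 0 < a \<Longrightarrow> b < T \<Longrightarrow> \<exists>B. \<forall>t\<in>{a..b} - N. \<forall>x\<in>\<Omega>. \<bar>Ku t x\<bar> \<le> B"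
    "\<And>t. t \<in> {0<..<T} - N \<Longrightarrow> integrable lebesgue (G t)"
proof -
  obtain \<sigma> \<phi> U and N0 :: "real set" where bws: "borel_weak_solution \<Omega> K k \<sigma> \<phi> U T"
    and N0: "N0 \<in> null_sets lborel" "\<And>t. t \<in> {0<..T} - N0 \<Longrightarrow> AE x in lborel. u_ext t x = U t x"
    and \<sigma>: "AE x in lborel. \<sigma> x = indicator S x" and \<phi>: "AE x in lborel. \<phi> x = indicator S x * f x"
    using borel_problem by blast
  interpret B: borel_weak_solution \<Omega> K k \<sigma> \<phi> U T by (rule bws)
  define c0 where "c0 = 1/2 * (LINT x|lebesgue. indicator (- S) x * (indicator \<Omega> x * (f x)\<^sup>2))"
  have Ku_eq: "Ku t x = conv K U t x" if "t \<in> {0<..T} - N0" for t x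
    using that N0(2)[OF that] B.U_slice_meas by (intro Ku_eq_conv) auto
  have energy: "integrable lebesgue (G t)" "H t = B.energy t + c0" if t: "t \<in> {0<..T} - N0" for t
  proof -
    let ?A = "\<lambda>x. (indicator S x * Ku t x - indicator S x * f x)\<^sup>2"
    have G_eq: "G t x = ?A x + indicator (- S) x * (indicator \<Omega> x * (f x)\<^sup>2)" for x
      using S(2) by (auto simp: G_def indicator_def)
    have A_meas: "?A \<in> borel_measurable lebesgue"
    proof -
      have "(\<lambda>x. indicator S x * Ku t x) \<in> borel_measurable lebesgue"
        by (rule borel_measurable_times[OF borel_measurable_indicator[OF S(1)] borel_measurable_lebesgueI[OF Ku_meas]])
          (use t in simp)
      then show ?thesis using f_S_meas by (intro borel_measurable_power borel_measurable_diff)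
    qed
    have R_meas: "(\<lambda>x. (residual K \<sigma> \<phi> U t x)\<^sup>2) \<in> borel_measurable borel" by measurable
    have ae: "AE x in lborel. ?A x = (residual K \<sigma> \<phi> U t x)\<^sup>2"
      using \<sigma> \<phi> by eventually_elim (simp add: residual_def Ku_eq[OF t])
    have A_int: "integrable lebesgue ?A"
      using integrable_lebesgue_iff_lborel[OF A_meas R_meas ae] B.R_sq_int by simp
    show "integrable lebesgue (G t)"
      unfolding G_eq[abs_def] using A_int f_outside_int by (rule Bochner_Integration.integrable_add)
    have "(LINT x|lebesgue. G t x) = (LINT x|lebesgue. ?A x) + (LINT x|lebesgue. indicator (- S) x * (indicator \<Omega> x * (f x)\<^sup>2))"
      unfolding G_eq using A_int f_outside_int by (rule Bochner_Integration.integral_add)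
    then show "H t = B.energy t + c0"
      unfolding H_eq B.energy_def c0_def integral_lebesgue_eq_lborel[OF A_meas R_meas ae] by simp
  qed
  define a b where "a n = T / real (n + 3)" and "b n = T - T / real (n + 3)" for n
  have ab: "0 < a n" "a n < b n" "b n < T" for n
  proof -
    have "T / real (n + 3) \<le> T / 3" using T by (intro divide_left_mono) auto
    then show "a n < b n" unfolding a_def b_def using T by linarith
  qed (use T in \<open>auto simp: a_def b_def\<close>)
  have exhaust: "\<exists>n. a n \<le> p \<and> q \<le> b n" if "0 < p" "q < T" for p q
  proof -
    define e where "e = min p (T - q)"
    have e: "e > 0" using that by (simp add: e_def)
    obtain n where n: "T / e < real n" using reals_Archimedean2 by blast
    then have "T / e < real (n + 3)" by simp
    then have "T / real (n + 3) < e" using e T by (simp add: field_simps)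
    then show ?thesis by (intro exI[of _ n]) (auto simp: a_def b_def e_def)
  qed
  have "\<exists>NB. fst NB \<in> null_sets lebesgue \<and>
      (\<forall>t1 t2. t1 \<in> {a n..b n} - fst NB \<longrightarrow> t2 \<in> {a n..b n} - fst NB \<longrightarrow> t1 \<le> t2 \<longrightarrow> B.energy t2 \<le> B.energy t1) \<and>
      (\<forall>t x. t \<in> {a n..b n} - fst NB \<longrightarrow> x \<in> \<Omega> \<longrightarrow> \<bar>conv K U t x\<bar> \<le> snd NB)" for n
  proof -
    obtain N B' where "N \<in> null_sets lebesgue"
      "\<And>t1 t2. t1 \<in> {a n..b n} - N \<Longrightarrow> t2 \<in> {a n..b n} - N \<Longrightarrow> t1 \<le> t2 \<Longrightarrow> B.energy t2 \<le> B.energy t1"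
      "\<And>t x. t \<in> {a n..b n} - N \<Longrightarrow> x \<in> \<Omega> \<Longrightarrow> \<bar>conv K U t x\<bar> \<le> B'"
      using B.energy_decay_slab[OF ab[of n]] by blast
    then show ?thesis by (intro exI[of _ "(N, B')"]) simp
  qed
  then obtain NB where NB: "\<And>n. fst (NB n) \<in> null_sets lebesgue"
      "\<And>n t1 t2. t1 \<in> {a n..b n} - fst (NB n) \<Longrightarrow> t2 \<in> {a n..b n} - fst (NB n) \<Longrightarrow> t1 \<le> t2 \<Longrightarrow> B.energy t2 \<le> B.energy t1"
      "\<And>n t x. t \<in> {a n..b n} - fst (NB n) \<Longrightarrow> x \<in> \<Omega> \<Longrightarrow> \<bar>conv K U t x\<bar> \<le> snd (NB n)"
    by metis
  define N where "N = N0 \<union> (\<Union>n. fst (NB n))"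
  show ?thesis
  proof (rule that[of N])
    show "N \<in> null_sets lebesgue"
      unfolding N_def using null_sets_completionI[OF N0(1)] NB(1) by (intro null_sets.Un null_sets_UN') auto
    fix t1 t2 assume t: "t1 \<in> {0<..<T} - N" "t2 \<in> {0<..<T} - N" "t1 \<le> t2"
    obtain n where n: "a n \<le> t1" "t2 \<le> b n" using exhaust[of t1 t2] t by auto
    have "B.energy t2 \<le> B.energy t1"
      using t n by (intro NB(2)[of _ n]) (auto simp: N_def)
    moreover have "t1 \<in> {0<..T} - N0" "t2 \<in> {0<..T} - N0" using t by (auto simp: N_def)
    ultimately show "H t2 \<le> H t1" using energy(2) by simp
  next
    fix p q :: real assume pq: "0 < p" "q < T"
    obtain n where n: "a n \<le> p" "q \<le> b n" using exhaust[OF pq] by auto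
    have "\<bar>Ku t x\<bar> \<le> snd (NB n)" if "t \<in> {p..q} - N" "x \<in> \<Omega>" for t x
    proof -
      have "t \<in> {0<..T} - N0" using that pq by (auto simp: N_def)
      moreover have "\<bar>conv K U t x\<bar> \<le> snd (NB n)"
        using that n by (intro NB(3)) (auto simp: N_def)
      ultimately show ?thesis by (simp add: Ku_eq)
    qed
    then show "\<exists>B. \<forall>t\<in>{p..q} - N. \<forall>x\<in>\<Omega>. \<bar>Ku t x\<bar> \<le> B" by blast
  next
    fix t assume "t \<in> {0<..<T} - N"
    then show "integrable lebesgue (G t)" by (intro energy(1)) (auto simp: N_def)
  qed
qed

text \<open>Cutting off \<open>\<psi>\<close> near the boundary changes the moment by little, uniformly in time, by the boundary
condition.\<close>

lemma moment_continuous: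
  assumes wc: "weakly_continuous_in_time \<Omega> T u"
    and \<psi>: "\<And>x. GDERIV \<psi> x :> \<psi>' x" "continuous_on UNIV \<psi>'"
    and s: "0 < a" "\<And>n. s n \<in> {a..T}" "s \<longlonglongrightarrow> t"
  shows "(\<lambda>n. LINT x|lebesgue. \<psi> x * u_ext (s n) x) \<longlonglongrightarrow> (LINT x|lebesgue. \<psi> x * u_ext t x)"
proof (rule LIMSEQ_I)
  fix r :: real assume r: "r > 0"
  have t: "t \<in> {a..T}" using closed_sequentially[OF closed_atLeastAtMost _ s(3)] s(2) by blast
  have pos: "\<tau> \<in> {0<..T}" if "\<tau> \<in> {a..T}" for \<tau> using that s(1) by auto
  have \<psi>_cont: "continuous_on UNIV \<psi>" using \<psi>(1) by (rule GDERIV_continuous_on)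
  obtain m where m: "m > 0" "\<And>x. x \<in> \<Omega> \<Longrightarrow> norm (\<psi> x) \<le> m"
    using continuous_bounded_on_bounded[OF \<psi>_cont bounded_\<Omega>] by blast
  define e where "e = r / (4 * m)"
  have e: "e > 0" using r m by (simp add: e_def)
  obtain \<epsilon>0 where \<epsilon>0: "\<epsilon>0 > 0" "\<And>\<epsilon> \<tau>. 0 < \<epsilon> \<Longrightarrow> \<epsilon> < \<epsilon>0 \<Longrightarrow> \<tau> \<in> {a..T} \<Longrightarrow>
      (LINT x|lebesgue. indicator {x. infdist x (- \<Omega>) < \<epsilon>} x * \<bar>u_ext \<tau> x\<bar>) \<le> e * \<epsilon>"
    using layer_u_ext[OF s(1) e] by blast
  define \<epsilon> where "\<epsilon> = min 1 (\<epsilon>0 / 2)"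
  have \<epsilon>: "0 < \<epsilon>" "\<epsilon> < \<epsilon>0" "\<epsilon> \<le> 1" using \<epsilon>0(1) by (auto simp: \<epsilon>_def)
  obtain \<rho> \<rho>' where \<rho>: "\<And>x. GDERIV \<rho> x :> \<rho>' x" "continuous_on UNIV \<rho>'"
    "\<And>x. 0 \<le> \<rho> x" "\<And>x. \<rho> x \<le> 1" "\<And>x. norm (\<rho>' x) \<le> 4 / \<epsilon>"
    "\<And>x. infdist x (- \<Omega>) < \<epsilon> / 4 \<Longrightarrow> \<rho> x = 0" "\<And>x. \<epsilon> \<le> infdist x (- \<Omega>) \<Longrightarrow> \<rho> x = 1 \<and> \<rho>' x = 0"
    using smooth_cutoff[OF bounded_\<Omega> \<epsilon>(1)] by blast
  have \<rho>_cont: "continuous_on UNIV \<rho>" using \<rho>(1) by (rule GDERIV_continuous_on)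
  define \<phi> where "\<phi> x = \<rho> x * \<psi> x" for x
  have \<phi>_cont: "continuous_on UNIV \<phi>" unfolding \<phi>_def[abs_def] by (intro continuous_intros \<rho>_cont \<psi>_cont)
  have "\<epsilon> / 4 > 0" using \<epsilon> by simp
  note C = compact_infdist_compl_ge[OF bounded_\<Omega> this]
  have supp: "closure {x. \<phi> x \<noteq> 0} \<subseteq> {x. \<epsilon> / 4 \<le> infdist x (- \<Omega>)}"
  proof (rule closure_minimal[OF _ compact_imp_closed[OF C(1)]])
    show "{x. \<phi> x \<noteq> 0} \<subseteq> {x. \<epsilon> / 4 \<le> infdist x (- \<Omega>)}"
      using \<rho>(6) by (force simp: \<phi>_def not_less[symmetric])
  qed
  have "C1_compact_support \<Omega> \<phi>"
    unfolding C1_compact_support_def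
  proof (intro conjI)
    show "C1 \<phi>" unfolding C1_def \<phi>_def[abs_def]
    proof (intro exI conjI allI)
      show "GDERIV (\<lambda>x. \<rho> x * \<psi> x) x :> \<rho> x *\<^sub>R \<psi>' x + \<psi> x *\<^sub>R \<rho>' x" for x
        using \<rho>(1) \<psi>(1) by (rule GDERIV_mult)
      show "continuous_on UNIV (\<lambda>x. \<rho> x *\<^sub>R \<psi>' x + \<psi> x *\<^sub>R \<rho>' x)"
        by (intro continuous_intros \<rho>_cont \<rho>(2) \<psi>(2) \<psi>_cont)
    qed
    show "compact (closure {x. \<phi> x \<noteq> 0})"
      using compact_Int_closed[OF C(1) closed_closure, of "{x. \<phi> x \<noteq> 0}"] supp by (simp add: Int_absorb1)
    show "closure {x. \<phi> x \<noteq> 0} \<subseteq> \<Omega>" using supp C(2) by blast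
  qed
  then have "continuous_on {0<..T} (\<lambda>t. LINT x:\<Omega>|lebesgue. \<phi> x * u x t)"
    using wc unfolding weakly_continuous_in_time_def by blast
  moreover have "(LINT x:\<Omega>|lebesgue. \<phi> x * u x t) = (LINT x|lebesgue. \<phi> x * u_ext t x)" for t
    unfolding set_lebesgue_integral_def by (intro Bochner_Integration.integral_cong refl) (simp add: u_ext_def)
  ultimately have "continuous_on {0<..T} (\<lambda>t. LINT x|lebesgue. \<phi> x * u_ext t x)" by simp
  then have lim: "(\<lambda>n. LINT x|lebesgue. \<phi> x * u_ext (s n) x) \<longlonglongrightarrow> (LINT x|lebesgue. \<phi> x * u_ext t x)"
    using s pos t unfolding continuous_on_sequentially comp_def by blast
  have "r / 2 > 0" using r by simp
  from LIMSEQ_D[OF lim this] obtain n0 where n0: "\<And>n. n \<ge> n0 \<Longrightarrow> norm ((LINT x|lebesgue. \<phi> x * u_ext (s n) x) - (LINT x|lebesgue. \<phi> x * u_ext t x)) < r / 2"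
    by blast
  have mult_int: "integrable lebesgue (\<lambda>x. q x * u_ext \<tau> x)"
    if q: "continuous_on UNIV q" and \<tau>: "\<tau> \<in> {a..T}" for q \<tau>
  proof -
    obtain c where c: "c > 0" "\<And>x. x \<in> \<Omega> \<Longrightarrow> norm (q x) \<le> c"
      using continuous_bounded_on_bounded[OF q bounded_\<Omega>] by blast
    have vi: "integrable lebesgue (u_ext \<tau>)" using pos[OF \<tau>] by (rule u_ext_int)
    show ?thesis
    proof (rule Bochner_Integration.integrable_bound[OF integrable_mult_right[OF vi, of c]])
      show "(\<lambda>x. q x * u_ext \<tau> x) \<in> borel_measurable lebesgue"
        by (rule borel_measurable_times[OF borel_measurable_lebesgueI[OF borel_measurable_continuous_onI[OF q]] borel_measurable_integrable[OF vi]])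
      show "AE x in lebesgue. norm (q x * u_ext \<tau> x) \<le> norm (c * u_ext \<tau> x)"
      proof (intro AE_I2)
        fix x show "norm (q x * u_ext \<tau> x) \<le> norm (c * u_ext \<tau> x)"
          using c u_ext_out[of x \<tau>] mult_right_mono_on[of x \<Omega> "\<bar>q x\<bar>" c "\<bar>u_ext \<tau> x\<bar>"] by (simp add: abs_mult)
      qed
    qed
  qed
  have close: "\<bar>(LINT x|lebesgue. \<psi> x * u_ext \<tau> x) - (LINT x|lebesgue. \<phi> x * u_ext \<tau> x)\<bar> \<le> r / 4" if \<tau>: "\<tau> \<in> {a..T}" for \<tau>
  proof -
    have "\<bar>(LINT x|lebesgue. \<psi> x * u_ext \<tau> x) - (LINT x|lebesgue. \<phi> x * u_ext \<tau> x)\<bar> = \<bar>LINT x|lebesgue. \<psi> x * u_ext \<tau> x - \<phi> x * u_ext \<tau> x\<bar>"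
      by (simp only: Bochner_Integration.integral_diff[OF mult_int[OF \<psi>_cont \<tau>] mult_int[OF \<phi>_cont \<tau>]])
    also have "\<dots> \<le> (LINT x|lebesgue. \<bar>\<psi> x * u_ext \<tau> x - \<phi> x * u_ext \<tau> x\<bar>)" by (rule integral_abs_bound)
    also have "\<dots> \<le> (LINT x|lebesgue. m * (indicator {x. infdist x (- \<Omega>) < \<epsilon>} x * \<bar>u_ext \<tau> x\<bar>))"
    proof (rule integral_mono)
      show "integrable lebesgue (\<lambda>x. \<bar>\<psi> x * u_ext \<tau> x - \<phi> x * u_ext \<tau> x\<bar>)"
        by (rule integrable_abs[OF Bochner_Integration.integrable_diff[OF mult_int[OF \<psi>_cont \<tau>] mult_int[OF \<phi>_cont \<tau>]]])
      show "integrable lebesgue (\<lambda>x. m * (indicator {x. infdist x (- \<Omega>) < \<epsilon>} x * \<bar>u_ext \<tau> x\<bar>))"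
        by (rule integrable_mult_right[OF layer_u_ext_int[OF pos[OF \<tau>]]])
      fix x
      have eq: "\<psi> x * u_ext \<tau> x - \<phi> x * u_ext \<tau> x = (1 - \<rho> x) * (\<psi> x * u_ext \<tau> x)" by (simp add: \<phi>_def algebra_simps)
      show "\<bar>\<psi> x * u_ext \<tau> x - \<phi> x * u_ext \<tau> x\<bar> \<le> m * (indicator {x. infdist x (- \<Omega>) < \<epsilon>} x * \<bar>u_ext \<tau> x\<bar>)"
      proof (cases "x \<in> \<Omega> \<and> infdist x (- \<Omega>) < \<epsilon>")
        case True
        have "\<bar>1 - \<rho> x\<bar> * (\<bar>\<psi> x\<bar> * \<bar>u_ext \<tau> x\<bar>) \<le> 1 * (m * \<bar>u_ext \<tau> x\<bar>)"
          using \<rho>(3,4)[of x] m True by (intro mult_mono mult_right_mono) auto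
        then show ?thesis unfolding eq using True by (simp add: abs_mult)
      next
        case False
        then have z: "(1 - \<rho> x) * (\<psi> x * u_ext \<tau> x) = 0" using \<rho>(7)[of x] u_ext_out[of x \<tau>] by auto
        show ?thesis unfolding eq z using m(1) by simp
      qed
    qed
    also have "\<dots> = m * (LINT x|lebesgue. indicator {x. infdist x (- \<Omega>) < \<epsilon>} x * \<bar>u_ext \<tau> x\<bar>)"
      by (rule integral_mult_right_zero)
    also have "\<dots> \<le> m * (e * \<epsilon>)" using \<epsilon>0(2)[OF \<epsilon>(1,2) \<tau>] m(1) by (intro mult_left_mono) auto
    also have "\<dots> \<le> m * (e * 1)" using \<epsilon>(3) e m(1) by (intro mult_left_mono) auto
    also have "\<dots> = r / 4" using m(1) by (simp add: e_def)
    finally show ?thesis .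
  qed
  have "norm ((LINT x|lebesgue. \<psi> x * u_ext (s n) x) - (LINT x|lebesgue. \<psi> x * u_ext t x)) < r" if "n \<ge> n0" for n
    using n0[OF that] close[OF s(2), of n] close[OF t] r unfolding real_norm_def by linarith
  then show "\<exists>n0. \<forall>n\<ge>n0. norm ((LINT x|lebesgue. \<psi> x * u_ext (s n) x) - (LINT x|lebesgue. \<psi> x * u_ext t x)) < r" by blast
qed

lemma Ku_continuous:
  assumes wc: "weakly_continuous_in_time \<Omega> T u" and s: "0 < a" "\<And>n. s n \<in> {a..T}" "s \<longlonglongrightarrow> t"
  shows "(\<lambda>n. Ku (s n) x) \<longlonglongrightarrow> Ku t x"
  unfolding Ku_def
proof (rule moment_continuous[OF wc _ _ s])
  show "GDERIV (\<lambda>z. K (x - z)) z :> - k (x - z)" for z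
    using GDERIV_reflect[OF K] .
  show "continuous_on UNIV (\<lambda>z. - k (x - z))"
    by (intro continuous_intros continuous_on_compose2[OF k]) auto
qed

lemma G_continuous:
  assumes wc: "weakly_continuous_in_time \<Omega> T u" and s: "0 < a" "\<And>n. s n \<in> {a..T}" "s \<longlonglongrightarrow> t"
  shows "(\<lambda>n. G (s n) x) \<longlonglongrightarrow> G t x"
  unfolding G_def by (intro tendsto_intros Ku_continuous[OF wc s])

text \<open>The bound is a hypothesis because continuity of \<open>w\<close> in time at each point does not dominate it in space;
it is available along good times.\<close>

lemma H_tendsto:
  assumes wc: "weakly_continuous_in_time \<Omega> T u" and s: "0 < a" "\<And>n. s n \<in> {a..T}" "s \<longlonglongrightarrow> t"
    and B: "\<And>n x. x \<in> \<Omega> \<Longrightarrow> \<bar>Ku (s n) x\<bar> \<le> B"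
  shows "(\<lambda>n. H (s n)) \<longlonglongrightarrow> H t"
proof -
  have t: "t \<in> {a..T}" using closed_sequentially[OF closed_atLeastAtMost _ s(3)] s(2) by blast
  have "(\<lambda>n. LINT x|lebesgue. G (s n) x) \<longlonglongrightarrow> (LINT x|lebesgue. G t x)"
  proof (rule integral_dominated_convergence[where w="\<lambda>x. indicator \<Omega> x * (2 * B\<^sup>2) + 2 * (indicator \<Omega> x * (f x)\<^sup>2)"])
    show "G t \<in> borel_measurable lebesgue" using t s(1) by (intro G_meas) auto
    show "G (s n) \<in> borel_measurable lebesgue" for n using s(1) s(2)[of n] by (intro G_meas) auto
    have "integrable lebesgue (indicator \<Omega> :: 'a \<Rightarrow> real)"
      by (rule integrable_real_indicator) (use open_\<Omega> emeasure_bounded_finite[OF bounded_\<Omega>] in auto)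
    moreover have "integrable lebesgue (\<lambda>x. indicator \<Omega> x * (f x)\<^sup>2)"
      using f(2) by (simp add: set_integrable_def)
    ultimately show "integrable lebesgue (\<lambda>x. indicator \<Omega> x * (2 * B\<^sup>2) + 2 * (indicator \<Omega> x * (f x)\<^sup>2))"
      by (intro Bochner_Integration.integrable_add integrable_mult_left integrable_mult_right)
    show "AE x in lebesgue. (\<lambda>n. G (s n) x) \<longlonglongrightarrow> G t x"
      by (intro AE_I2 G_continuous[OF wc s])
    show "AE x in lebesgue. norm (G (s n) x) \<le> indicator \<Omega> x * (2 * B\<^sup>2) + 2 * (indicator \<Omega> x * (f x)\<^sup>2)" for n
    proof (intro AE_I2)
      fix x
      show "norm (G (s n) x) \<le> indicator \<Omega> x * (2 * B\<^sup>2) + 2 * (indicator \<Omega> x * (f x)\<^sup>2)"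
      proof (cases "x \<in> \<Omega>")
        case True
        have "\<bar>indicator S x * Ku (s n) x\<bar> \<le> B"
          using B[OF True, of n] by (auto simp: indicator_def)
        then have 1: "(indicator S x * Ku (s n) x)\<^sup>2 \<le> B\<^sup>2" by (rule abs_le_square_iff[THEN iffD1, OF order_trans[OF _ abs_ge_self]])
        have "(p - q)\<^sup>2 \<le> 2 * p\<^sup>2 + 2 * q\<^sup>2" for p q :: real
          using zero_le_power2[of "p + q"] by (simp add: power2_sum power2_diff)
        from this[of "indicator S x * Ku (s n) x" "f x"] 1
        have "(indicator S x * Ku (s n) x - f x)\<^sup>2 \<le> 2 * B\<^sup>2 + 2 * (f x)\<^sup>2" by linarith
        then show ?thesis using True by (simp add: G_def)
      next
        case False
        then have "x \<notin> S" using S(2) by blast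
        then show ?thesis using False by (simp add: G_def)
      qed
    qed
  qed
  then show ?thesis unfolding H_eq by (intro tendsto_intros)
qed

text \<open>At \<open>t = T\<close> no bound on \<open>w\<close> along the approximating times is at hand, but Fatou's lemma gives the inequality
in the direction needed.\<close>

lemma H_lower_semicontinuous:
  assumes wc: "weakly_continuous_in_time \<Omega> T u" and s: "0 < a" "\<And>n. s n \<in> {a..T}" "s \<longlonglongrightarrow> t"
    and int: "\<And>n. integrable lebesgue (G (s n))" and h: "\<And>n. H (s n) \<le> h"
  shows "H t \<le> h"
proof -
  have t: "t \<in> {0<..T}" using closed_sequentially[OF closed_atLeastAtMost _ s(3)] s(1,2) by force
  have pos: "s n \<in> {0<..T}" for n using s(1) s(2)[of n] by auto
  have "0 \<le> (LINT x|lebesgue. G (s 0) x)" by (intro Bochner_Integration.integral_nonneg G_nonneg)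
  then have h0: "0 \<le> h" using h[of 0] unfolding H_eq by linarith
  have meas: "(\<lambda>x. ennreal (G \<tau> x)) \<in> borel_measurable lebesgue" if "\<tau> \<in> {0<..T}" for \<tau>
    using G_meas[OF that] by measurable
  have "(\<integral>\<^sup>+x. ennreal (G t x) \<partial>lebesgue) = (\<integral>\<^sup>+x. liminf (\<lambda>n. ennreal (G (s n) x)) \<partial>lebesgue)"
    by (intro nn_integral_cong lim_imp_Liminf[symmetric] tendsto_ennrealI G_continuous[OF wc s]) auto
  also have "\<dots> \<le> liminf (\<lambda>n. \<integral>\<^sup>+x. ennreal (G (s n) x) \<partial>lebesgue)"
    by (intro nn_integral_liminf meas pos)
  also have "\<dots> \<le> liminf (\<lambda>n::nat. ennreal (2 * h))"
  proof (intro Liminf_mono always_eventually allI)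
    fix n
    have "(\<integral>\<^sup>+x. ennreal (G (s n) x) \<partial>lebesgue) = ennreal (LINT x|lebesgue. G (s n) x)"
      using int G_nonneg by (intro nn_integral_eq_integral) auto
    also have "\<dots> \<le> ennreal (2 * h)" using h[of n] by (intro ennreal_leI) (simp add: H_eq)
    finally show "(\<integral>\<^sup>+x. ennreal (G (s n) x) \<partial>lebesgue) \<le> ennreal (2 * h)" .
  qed
  also have "\<dots> = ennreal (2 * h)" by (simp add: Liminf_const)
  finally have "enn2real (\<integral>\<^sup>+x. ennreal (G t x) \<partial>lebesgue) \<le> 2 * h"
    using h0 by (intro enn2real_leI) auto
  moreover have "(LINT x|lebesgue. G t x) = enn2real (\<integral>\<^sup>+x. ennreal (G t x) \<partial>lebesgue)"
    using G_meas[OF t] G_nonneg by (intro integral_eq_nn_integral) auto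
  ultimately show ?thesis by (simp add: H_eq)
qed

text \<open>Good times \<open>r\<^sub>n\<close> decrease to \<open>t\<^sub>1 < T\<close>, where \<open>H\<close> is continuous, and good times \<open>s\<^sub>n\<close> increase to \<open>t\<^sub>2\<close>, where
\<open>H\<close> is lower semicontinuous. A midpoint separates the two sequences.\<close>

lemma monotone_if_weakly_continuous:
  assumes wc: "weakly_continuous_in_time \<Omega> T u" and t: "0 < t1" "t1 < t2" "t2 \<le> T"
  shows "H t2 \<le> H t1"
proof -
  obtain N where N: "N \<in> null_sets lebesgue"
    and mono: "\<And>t1 t2. t1 \<in> {0<..<T} - N \<Longrightarrow> t2 \<in> {0<..<T} - N \<Longrightarrow> t1 \<le> t2 \<Longrightarrow> H t2 \<le> H t1"
    and bdd: "\<And>a b. 0 < a \<Longrightarrow> b < T \<Longrightarrow> \<exists>B. \<forall>t\<in>{a..b} - N. \<forall>x\<in>\<Omega>. \<bar>Ku t x\<bar> \<le> B"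
    and int: "\<And>t. t \<in> {0<..<T} - N \<Longrightarrow> integrable lebesgue (G t)"
    using monotone_off_null_set by blast
  define c where "c = (t1 + t2) / 2"
  have c: "t1 < c" "c < t2" using t by (auto simp: c_def)
  have inv: "1 / real (Suc n) > 0" for n by simp
  have lim0: "(\<lambda>n. 1 / real (Suc n)) \<longlonglongrightarrow> 0" by (rule LIMSEQ_Suc[OF lim_1_over_n])
  have "\<exists>r. t1 < r \<and> r < min c (t1 + 1 / real (Suc n)) \<and> r \<notin> N" for n
    using null_set_avoid[OF N, of t1 "min c (t1 + 1 / real (Suc n))"] c(1) inv[of n] by auto
  then obtain r where r: "\<And>n. t1 < r n" "\<And>n. r n < min c (t1 + 1 / real (Suc n))" "\<And>n. r n \<notin> N" by metis
  have "\<exists>r. max c (t2 - 1 / real (Suc n)) < r \<and> r < t2 \<and> r \<notin> N" for n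
    using null_set_avoid[OF N, of "max c (t2 - 1 / real (Suc n))" t2] c(2) inv[of n] by auto
  then obtain s where s: "\<And>n. max c (t2 - 1 / real (Suc n)) < s n" "\<And>n. s n < t2" "\<And>n. s n \<notin> N" by metis
  have r_lim: "r \<longlonglongrightarrow> t1"
  proof (rule tendsto_sandwich)
    show "\<forall>\<^sub>F n in sequentially. t1 \<le> r n" using r(1) by (intro always_eventually allI less_imp_le)
    show "\<forall>\<^sub>F n in sequentially. r n \<le> t1 + 1 / real (Suc n)" using r(2) by (intro always_eventually allI) (simp add: less_imp_le)
    show "(\<lambda>n. t1 + 1 / real (Suc n)) \<longlonglongrightarrow> t1" using tendsto_add[OF tendsto_const lim0, of t1] by simp
  qed auto
  have s_lim: "s \<longlonglongrightarrow> t2"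
  proof (rule tendsto_sandwich)
    show "\<forall>\<^sub>F n in sequentially. s n \<le> t2" using s(2) by (intro always_eventually allI less_imp_le)
    show "\<forall>\<^sub>F n in sequentially. t2 - 1 / real (Suc n) \<le> s n" using s(1) by (intro always_eventually allI) (simp add: less_imp_le)
    show "(\<lambda>n. t2 - 1 / real (Suc n)) \<longlonglongrightarrow> t2" using tendsto_diff[OF tendsto_const lim0, of t2] by simp
  qed auto
  have r': "t1 < r n" "r n < c" "r n \<notin> N" and s': "c < s n" "s n < t2" "s n \<notin> N" for n
    using r[of n] s[of n] by auto
  have "c < T" using c t by simp
  then obtain B where B: "\<And>t x. t \<in> {t1..c} - N \<Longrightarrow> x \<in> \<Omega> \<Longrightarrow> \<bar>Ku t x\<bar> \<le> B"
    using bdd[OF t(1)] by blast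
  have rH: "(\<lambda>n. H (r n)) \<longlonglongrightarrow> H t1"
  proof (rule H_tendsto[OF wc t(1) _ r_lim])
    show "r n \<in> {t1..T}" for n using r'[of n] c t by auto
    show "\<bar>Ku (r n) x\<bar> \<le> B" if "x \<in> \<Omega>" for n x using r'[of n] that by (intro B) auto
  qed
  show ?thesis
  proof (rule H_lower_semicontinuous[OF wc t(1) _ s_lim])
    show "s n \<in> {t1..T}" for n using s'[of n] c t by auto
    show "integrable lebesgue (G (s n))" for n using s'[of n] c t by (intro int) auto
    fix n
    have "H (s n) \<le> H (r j)" for j
      using s'[of n] r'[of j] c t by (intro mono) auto
    then show "H (s n) \<le> H t1" by (intro LIMSEQ_le_const[OF rH]) auto
  qed
qed

end

theorem proposition1:
  fixes \<Omega> S :: "'a::euclidean_space set"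
    and T :: real
    and K f u\<^sub>0 :: "'a \<Rightarrow> real"
    and u :: "'a \<Rightarrow> real \<Rightarrow> real"
  assumes "open \<Omega>" and "bounded \<Omega>"
    and "S \<in> sets lebesgue" and "S \<subseteq> \<Omega>"
    and "T > 0"
    and "C1 K"
    and "set_borel_measurable lebesgue \<Omega> f"
    and "set_integrable lebesgue \<Omega> (\<lambda>x. (f x)\<^sup>2)"
    and "continuous_on \<Omega> u\<^sub>0"
    and "weak_solution \<Omega> S T K f u\<^sub>0 u"
  shows "(\<exists>N\<in>null_sets lebesgue. \<forall>t\<^sub>1\<in>{0<..T} - N. \<forall>t\<^sub>2\<in>{0<..T} - N. t\<^sub>1 \<le> t\<^sub>2 \<longrightarrow>
            H_functional \<Omega> S K f (\<lambda>x. u x t\<^sub>2) \<le> H_functional \<Omega> S K f (\<lambda>x. u x t\<^sub>1)) \<and>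
         (weakly_continuous_in_time \<Omega> T u \<longrightarrow>
           (\<forall>t\<^sub>1 t\<^sub>2. 0 < t\<^sub>1 \<and> t\<^sub>1 \<le> t\<^sub>2 \<and> t\<^sub>2 \<le> T \<longrightarrow>
            H_functional \<Omega> S K f (\<lambda>x. u x t\<^sub>2) \<le> H_functional \<Omega> S K f (\<lambda>x. u x t\<^sub>1)))"
proof -
  obtain k where k: "\<And>x. GDERIV K x :> k x" "continuous_on UNIV k"
    using \<open>C1 K\<close> unfolding C1_def by blast
  interpret weak_problem \<Omega> S T K f u\<^sub>0 k u
    by (rule weak_problem.intro[OF assms(1-5) k assms(7,8,10)])
  show ?thesis
  proof (intro conjI impI allI)
    obtain N where N: "N \<in> null_sets lebesgue"
      "\<And>t1 t2. t1 \<in> {0<..<T} - N \<Longrightarrow> t2 \<in> {0<..<T} - N \<Longrightarrow> t1 \<le> t2 \<Longrightarrow> H t2 \<le> H t1"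
      by (rule monotone_off_null_set) (rule that)
    have "insert T N \<in> null_sets lebesgue" using N(1) by (simp add: negligible_iff_null_sets[symmetric])
    moreover have "H t2 \<le> H t1" if "t1 \<in> {0<..T} - insert T N" "t2 \<in> {0<..T} - insert T N" "t1 \<le> t2" for t1 t2
      using that by (intro N(2)) auto
    ultimately show "\<exists>N\<in>null_sets lebesgue. \<forall>t\<^sub>1\<in>{0<..T} - N. \<forall>t\<^sub>2\<in>{0<..T} - N. t\<^sub>1 \<le> t\<^sub>2 \<longrightarrow> H t\<^sub>2 \<le> H t\<^sub>1"
      by blast
  next
    fix t\<^sub>1 t\<^sub>2 assume "weakly_continuous_in_time \<Omega> T u" "0 < t\<^sub>1 \<and> t\<^sub>1 \<le> t\<^sub>2 \<and> t\<^sub>2 \<le> T"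
    then show "H t\<^sub>2 \<le> H t\<^sub>1"
      using monotone_if_weakly_continuous[of t\<^sub>1 t\<^sub>2] by (cases "t\<^sub>1 = t\<^sub>2") auto
  qed
qed

end
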